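(* Modulo $\mathcal L_{\mathrm{PA}}$: $\mathrm{DEF}$ syntactically defines $\mathrm{TB}$ and $\mathrm{USB}$ syntactically defines $\mathrm{DEF}$; but $\mathrm{TB}$ does not semantically define $\mathrm{DEF}$, and $\mathrm{DEF}$ does not semantically define $\mathrm{USB}$.
   Context: $\mathcal L_{\mathrm{PA}}=\{0,1,+,\times,<\}$; $\underline{\ulcorner\phi\urcorner}$ is the numeral of the Gödel number of $\phi$. $T$ (unary), $D$ (binary), $S$ (binary) are fresh predicates. - $\mathrm{TB}$ is $\mathrm{PA}$ plus $T(\underline{\ulcorner\phi\urcorner})\leftrightarrow\phi$ for all $\mathcal L_{\mathrm{PA}}$-sentences $\phi$, plus the full induction scheme for $\mathcal L_{\mathrm{PA}}\cup\{T\}$. - $\mathrm{DEF}$ is $\mathrm{PA}$ plus $\forall y\,(D(\underline{\ulcorner\phi(x)\urcorner},y)\leftrightarrow(\exists!x\,\phi(x)\wedge\phi(y)))$ for all $\mathcal L_{\mathrm{PA}}$-formulae $\phi(x)$, plus the full induction scheme for $\mathcal L_{\mathrm{PA}}\cup\{D\}$. - $\mathrm{USB}$ is $\mathrm{PA}$ plus $\forall x\,(S(\underline{\ulcorner\phi\urcorner},x)\leftrightarrow\phi(x))$ for all $\mathcal L_{\mathrm{PA}}$-formulae $\phi(x)$, plus the full induction scheme for $\mathcal L_{\mathrm{PA}}\cup\{S\}$. For a theory $V$ in $\mathcal L_{\mathrm{PA}}\cup\{R\}$ with $R$ a single predicate: $W$ syntactically defines $V$ modulo $\mathcal L_{\mathrm{PA}}$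 if there is a parameter-free formula $\phi_R$ of the language of $W$ such that $W\vdash\Phi[\phi_R/R]$ for every axiom $\Phi$ of $V$ (arithmetical symbols left unchanged). $W$ semantically defines $V$ modulo $\mathcal L_{\mathrm{PA}}$ if for every $\mathcal M\models W$ there is a formula $\phi_R$ of the language of $W$ with parameters from $\mathcal M$ such that $\mathcal M\models\Phi[\phi_R/R]$ for every axiom $\Phi$ of $V$. *)

theory Defs
  imports Main "HOL-Library.Nat_Bijection"
begin

section \<open>Syntax\<close>

text \<open>
  First-order formulas over \<open>{0, 1, +, \<times>, <}\<close> together with the fresh predicate symbols
  \<open>T\<close>, \<open>D\<close>, \<open>S\<close>. Variables are de Bruijn indices: in \<open>Forall \<phi>\<close> the index \<open>0\<close> of \<open>\<phi>\<close> is bound,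
  and \<open>Var (Suc i)\<close> inside \<open>\<phi>\<close> denotes what \<open>Var i\<close> denotes outside.
\<close>

datatype psym = PT | PD | PS

fun arity :: "psym \<Rightarrow> nat" where
  "arity PT = 1"
| "arity PD = 2"
| "arity PS = 2"

datatype tm = Var nat | Zero | One | Add tm tm | Mul tm tm

datatype fm = Eq tm tm | Lt tm tm | Rel psym "tm list" | Falsum | Imp fm fm | Forall fm

abbreviation Neg :: "fm \<Rightarrow> fm" where "Neg \<phi> \<equiv> Imp \<phi> Falsum"
abbreviation And :: "fm \<Rightarrow> fm \<Rightarrow> fm" where "And \<phi> \<psi> \<equiv> Neg (Imp \<phi> (Neg \<psi>))"
abbreviation Or :: "fm \<Rightarrow> fm \<Rightarrow> fm" where "Or \<phi> \<psi> \<equiv> Imp (Neg \<phi>) \<psi>"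
abbreviation Iff :: "fm \<Rightarrow> fm \<Rightarrow> fm" where "Iff \<phi> \<psi> \<equiv> And (Imp \<phi> \<psi>) (Imp \<psi> \<phi>)"
abbreviation Exists :: "fm \<Rightarrow> fm" where "Exists \<phi> \<equiv> Neg (Forall (Neg \<phi>))"
abbreviation Le :: "tm \<Rightarrow> tm \<Rightarrow> fm" where "Le s t \<equiv> Or (Lt s t) (Eq s t)"

text \<open>\<open>in_lang L \<phi>\<close>: \<open>\<phi>\<close> is a formula of \<open>\<L>\<^sub>P\<^sub>A \<union> L\<close>.\<close>

fun in_lang :: "psym set \<Rightarrow> fm \<Rightarrow> bool" where
  "in_lang L (Eq s t) = True"
| "in_lang L (Lt s t) = True"
| "in_lang L (Rel r ts) = (r \<in> L \<and> length ts = arity r)"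
| "in_lang L Falsum = True"
| "in_lang L (Imp \<phi> \<psi>) = (in_lang L \<phi> \<and> in_lang L \<psi>)"
| "in_lang L (Forall \<phi>) = in_lang L \<phi>"

abbreviation arithmetical :: "fm \<Rightarrow> bool" where "arithmetical \<equiv> in_lang {}"

fun fv_tm :: "tm \<Rightarrow> nat set" where
  "fv_tm (Var i) = {i}"
| "fv_tm Zero = {}"
| "fv_tm One = {}"
| "fv_tm (Add s t) = fv_tm s \<union> fv_tm t"
| "fv_tm (Mul s t) = fv_tm s \<union> fv_tm t"

fun fv :: "fm \<Rightarrow> nat set" where
  "fv (Eq s t) = fv_tm s \<union> fv_tm t"
| "fv (Lt s t) = fv_tm s \<union> fv_tm t"
| "fv (Rel r ts) = (\<Union>t\<in>set ts. fv_tm t)"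
| "fv Falsum = {}"
| "fv (Imp \<phi> \<psi>) = fv \<phi> \<union> fv \<psi>"
| "fv (Forall \<phi>) = {i. Suc i \<in> fv \<phi>}"

abbreviation sentence :: "fm \<Rightarrow> bool" where "sentence \<phi> \<equiv> fv \<phi> = {}"

text \<open>Simultaneous capture-avoiding substitution.\<close>

fun subst_tm :: "(nat \<Rightarrow> tm) \<Rightarrow> tm \<Rightarrow> tm" where
  "subst_tm \<sigma> (Var i) = \<sigma> i"
| "subst_tm \<sigma> Zero = Zero"
| "subst_tm \<sigma> One = One"
| "subst_tm \<sigma> (Add s t) = Add (subst_tm \<sigma> s) (subst_tm \<sigma> t)"
| "subst_tm \<sigma> (Mul s t) = Mul (subst_tm \<sigma> s) (subst_tm \<sigma> t)"

definition up :: "(nat \<Rightarrow> tm) \<Rightarrow> nat \<Rightarrow> tm" where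
  "up \<sigma> = case_nat (Var 0) (\<lambda>i. subst_tm (\<lambda>j. Var (Suc j)) (\<sigma> i))"

fun subst :: "(nat \<Rightarrow> tm) \<Rightarrow> fm \<Rightarrow> fm" where
  "subst \<sigma> (Eq s t) = Eq (subst_tm \<sigma> s) (subst_tm \<sigma> t)"
| "subst \<sigma> (Lt s t) = Lt (subst_tm \<sigma> s) (subst_tm \<sigma> t)"
| "subst \<sigma> (Rel r ts) = Rel r (map (subst_tm \<sigma>) ts)"
| "subst \<sigma> Falsum = Falsum"
| "subst \<sigma> (Imp \<phi> \<psi>) = Imp (subst \<sigma> \<phi>) (subst \<sigma> \<psi>)"
| "subst \<sigma> (Forall \<phi>) = Forall (subst (up \<sigma>) \<phi>)"

definition lift :: "fm \<Rightarrow> fm" where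
  "lift = subst (\<lambda>i. Var (Suc i))"

text \<open>Instantiation of the outermost variable, \<open>\<phi>(t)\<close>; the remaining indices move down by one.\<close>

definition inst :: "tm \<Rightarrow> fm \<Rightarrow> fm" where
  "inst t = subst (case_nat t Var)"

text \<open>
  \<open>\<exists>!x \<phi>(x)\<close>, written out as \<open>\<exists>x (\<phi>(x) \<and> \<forall>z (\<phi>(z) \<longrightarrow> z = x))\<close>. Below both quantifiers \<open>z\<close> is
  index \<open>0\<close> and \<open>x\<close> is index \<open>1\<close>, so the parameters of \<open>\<phi>\<close> are moved past \<open>x\<close>.
\<close>

definition Exists1 :: "fm \<Rightarrow> fm" where
  "Exists1 \<phi> = Exists (And \<phi>
     (Forall (Imp (subst (case_nat (Var 0) (\<lambda>i. Var (Suc (Suc i)))) \<phi>) (Eq (Var 0) (Var 1)))))"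

section \<open>Derivability\<close>

text \<open>
  Classical natural deduction with equality. Formulas with predicate symbols foreign to \<open>\<Gamma>\<close> and
  the goal may occur inside a derivation; by the usual conservativity this does not affect which
  formulas of the language of \<open>\<Gamma>\<close> are derivable.
\<close>

inductive derives :: "fm set \<Rightarrow> fm \<Rightarrow> bool" (infix "\<turnstile>" 50) where
  Assm: "\<phi> \<in> \<Gamma> \<Longrightarrow> \<Gamma> \<turnstile> \<phi>"
| ImpI: "insert \<phi> \<Gamma> \<turnstile> \<psi> \<Longrightarrow> \<Gamma> \<turnstile> Imp \<phi> \<psi>"
| ImpE: "\<Gamma> \<turnstile> Imp \<phi> \<psi> \<Longrightarrow> \<Gamma> \<turnstile> \<phi> \<Longrightarrow> \<Gamma> \<turnstile> \<psi>"
| Contr: "insert (Neg \<phi>) \<Gamma> \<turnstile> Falsum \<Longrightarrow> \<Gamma> \<turnstile> \<phi>"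
| ForallI: "lift ` \<Gamma> \<turnstile> \<phi> \<Longrightarrow> \<Gamma> \<turnstile> Forall \<phi>"
| ForallE: "\<Gamma> \<turnstile> Forall \<phi> \<Longrightarrow> \<Gamma> \<turnstile> inst t \<phi>"
| EqI: "\<Gamma> \<turnstile> Eq t t"
| EqE: "\<Gamma> \<turnstile> Eq s t \<Longrightarrow> \<Gamma> \<turnstile> inst s \<phi> \<Longrightarrow> \<Gamma> \<turnstile> inst t \<phi>"

section \<open>Structures and satisfaction\<close>

record 'a fo_struct =
  domI :: "'a set"
  zeroI :: 'a
  oneI :: 'a
  addI :: "'a \<Rightarrow> 'a \<Rightarrow> 'a"
  mulI :: "'a \<Rightarrow> 'a \<Rightarrow> 'a"
  ltI :: "'a \<Rightarrow> 'a \<Rightarrow> bool"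
  relI :: "psym \<Rightarrow> 'a list \<Rightarrow> bool"

definition is_struct :: "'a fo_struct \<Rightarrow> bool" where
  "is_struct M \<longleftrightarrow> zeroI M \<in> domI M \<and> oneI M \<in> domI M \<and>
     (\<forall>a\<in>domI M. \<forall>b\<in>domI M. addI M a b \<in> domI M \<and> mulI M a b \<in> domI M)"

fun eval :: "'a fo_struct \<Rightarrow> (nat \<Rightarrow> 'a) \<Rightarrow> tm \<Rightarrow> 'a" where
  "eval M e (Var i) = e i"
| "eval M e Zero = zeroI M"
| "eval M e One = oneI M"
| "eval M e (Add s t) = addI M (eval M e s) (eval M e t)"
| "eval M e (Mul s t) = mulI M (eval M e s) (eval M e t)"

fun sat :: "'a fo_struct \<Rightarrow> (nat \<Rightarrow> 'a) \<Rightarrow> fm \<Rightarrow> bool" where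
  "sat M e (Eq s t) \<longleftrightarrow> eval M e s = eval M e t"
| "sat M e (Lt s t) \<longleftrightarrow> ltI M (eval M e s) (eval M e t)"
| "sat M e (Rel r ts) \<longleftrightarrow> relI M r (map (eval M e) ts)"
| "sat M e Falsum \<longleftrightarrow> False"
| "sat M e (Imp \<phi> \<psi>) \<longleftrightarrow> (sat M e \<phi> \<longrightarrow> sat M e \<psi>)"
| "sat M e (Forall \<phi>) \<longleftrightarrow> (\<forall>a\<in>domI M. sat M (case_nat a e) \<phi>)"

definition models :: "'a fo_struct \<Rightarrow> fm set \<Rightarrow> bool" where
  "models M \<Gamma> \<longleftrightarrow> (\<forall>\<phi>\<in>\<Gamma>. \<forall>e. range e \<subseteq> domI M \<longrightarrow> sat M e \<phi>)"

section \<open>Goedel numbers\<close>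

text \<open>
  Codes are built with the Cantor pairing function, so the operations on codes corresponding to
  the connectives are quadratic polynomials up to a factor of two. Codes of bound-variable
  variants coincide since formulas are nameless.
\<close>

fun gn_tm :: "tm \<Rightarrow> nat" where
  "gn_tm (Var i) = prod_encode (0, i)"
| "gn_tm Zero = prod_encode (1, 0)"
| "gn_tm One = prod_encode (2, 0)"
| "gn_tm (Add s t) = prod_encode (3, prod_encode (gn_tm s, gn_tm t))"
| "gn_tm (Mul s t) = prod_encode (4, prod_encode (gn_tm s, gn_tm t))"

fun gn_psym :: "psym \<Rightarrow> nat" where
  "gn_psym PT = 0"
| "gn_psym PD = 1"
| "gn_psym PS = 2"

fun gn :: "fm \<Rightarrow> nat" where
  "gn (Eq s t) = prod_encode (0, prod_encode (gn_tm s, gn_tm t))"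
| "gn (Lt s t) = prod_encode (1, prod_encode (gn_tm s, gn_tm t))"
| "gn (Rel r ts) = prod_encode (2, prod_encode (gn_psym r, list_encode (map gn_tm ts)))"
| "gn Falsum = prod_encode (3, 0)"
| "gn (Imp \<phi> \<psi>) = prod_encode (4, prod_encode (gn \<phi>, gn \<psi>))"
| "gn (Forall \<phi>) = prod_encode (5, gn \<phi>)"

fun numeral_tm :: "nat \<Rightarrow> tm" where
  "numeral_tm 0 = Zero"
| "numeral_tm (Suc n) = Add (numeral_tm n) One"

definition quot :: "fm \<Rightarrow> tm" where
  "quot \<phi> = numeral_tm (gn \<phi>)"

section \<open>The theories\<close>

text \<open>
  The axioms of discretely ordered semirings (the usual base theory \<open>PA\<^sup>-\<close>), universally closed;
  quantifiers over variables that do not occur are vacuous.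
\<close>

definition PA_minus :: "fm set" where
  "PA_minus = (let x = Var 0; y = Var 1; z = Var 2 in (\<lambda>\<phi>. Forall (Forall (Forall \<phi>))) `
    {Eq (Add (Add x y) z) (Add x (Add y z)),
     Eq (Add x y) (Add y x),
     Eq (Mul (Mul x y) z) (Mul x (Mul y z)),
     Eq (Mul x y) (Mul y x),
     Eq (Mul x (Add y z)) (Add (Mul x y) (Mul x z)),
     Eq (Add x Zero) x,
     Eq (Mul x Zero) Zero,
     Eq (Mul x One) x,
     Imp (And (Lt x y) (Lt y z)) (Lt x z),
     Neg (Lt x x),
     Or (Or (Lt x y) (Eq x y)) (Lt y x),
     Imp (Lt x y) (Lt (Add x z) (Add y z)),
     Imp (And (Lt Zero z) (Lt x y)) (Lt (Mul x z) (Mul y z)),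
     Imp (Lt x y) (Exists (Eq (Add (Var 1) (Var 0)) (Var 2))),
     Lt Zero One,
     Imp (Lt Zero x) (Le One x),
     Le Zero x})"

text \<open>Induction on index \<open>0\<close>; the remaining free indices of \<open>\<phi>\<close> are parameters.\<close>

definition induction_fm :: "fm \<Rightarrow> fm" where
  "induction_fm \<phi> = Imp
     (And (inst Zero \<phi>)
          (Forall (Imp \<phi> (subst (case_nat (Add (Var 0) One) (\<lambda>i. Var (Suc i))) \<phi>))))
     (Forall \<phi>)"

text \<open>The induction scheme for \<open>\<L>\<^sub>P\<^sub>A \<union> L\<close>, all instances closed off by universal quantifiers.\<close>

definition Induction :: "psym set \<Rightarrow> fm set" where
  "Induction L = {(Forall ^^ n) (induction_fm \<phi>) | n \<phi>.
     in_lang L \<phi> \<and> fv (induction_fm \<phi>) \<subseteq> {..<n}}"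

text \<open>
  A theory in \<open>\<L>\<^sub>P\<^sub>A \<union> {R}\<close> is given by its predicate \<open>R\<close> and its set of axioms. As
  \<open>Induction {}\<close> is contained in \<open>Induction {R}\<close>, the axioms of \<open>PA\<close> are among those below.
\<close>

record fo_theory =
  symb :: psym
  axms :: "fm set"

definition TB :: fo_theory where
  "TB = \<lparr>symb = PT, axms = PA_minus \<union> Induction {PT} \<union>
     {Iff (Rel PT [quot \<phi>]) \<phi> | \<phi>. arithmetical \<phi> \<and> sentence \<phi>}\<rparr>"

definition DEF :: fo_theory where
  "DEF = \<lparr>symb = PD, axms = PA_minus \<union> Induction {PD} \<union>
     {Forall (Iff (Rel PD [quot \<phi>, Var 0]) (And (Exists1 \<phi>) \<phi>)) | \<phi>.
        arithmetical \<phi> \<and> fv \<phi> \<subseteq> {0}}\<rparr>"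

definition USB :: fo_theory where
  "USB = \<lparr>symb = PS, axms = PA_minus \<union> Induction {PS} \<union>
     {Forall (Iff (Rel PS [quot \<phi>, Var 0]) \<phi>) | \<phi>.
        arithmetical \<phi> \<and> fv \<phi> \<subseteq> {0}}\<rparr>"

section \<open>Definability modulo arithmetic\<close>

text \<open>
  \<open>rel_subst R \<psi> d \<Phi>\<close> is \<open>\<Phi>[\<psi>/R]\<close> for \<open>\<Phi>\<close> below \<open>d\<close> quantifiers. The indices below \<open>arity R\<close> of
  \<open>\<psi>\<close> are its argument places; index \<open>arity R + j\<close> is a parameter, which becomes the free variable
  \<open>j\<close> of \<open>\<Phi>[\<psi>/R]\<close> and hence index \<open>d + j\<close> at depth \<open>d\<close>.
\<close>

fun rel_subst :: "psym \<Rightarrow> fm \<Rightarrow> nat \<Rightarrow> fm \<Rightarrow> fm" where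
  "rel_subst R \<psi> d (Eq s t) = Eq s t"
| "rel_subst R \<psi> d (Lt s t) = Lt s t"
| "rel_subst R \<psi> d (Rel r ts) =
     (if r = R then subst (\<lambda>i. if i < arity R then ts ! i else Var (d + (i - arity R))) \<psi>
      else Rel r ts)"
| "rel_subst R \<psi> d Falsum = Falsum"
| "rel_subst R \<psi> d (Imp \<phi> \<chi>) = Imp (rel_subst R \<psi> d \<phi>) (rel_subst R \<psi> d \<chi>)"
| "rel_subst R \<psi> d (Forall \<phi>) = Forall (rel_subst R \<psi> (Suc d) \<phi>)"

definition syntactically_defines :: "fo_theory \<Rightarrow> fo_theory \<Rightarrow> bool" where
  "syntactically_defines W V \<longleftrightarrow>
     (\<exists>\<psi>. in_lang {symb W} \<psi> \<and> fv \<psi> \<subseteq> {..<arity (symb V)} \<and>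
        (\<forall>\<Phi>\<in>axms V. axms W \<turnstile> rel_subst (symb V) \<psi> 0 \<Phi>))"

text \<open>
  HOL cannot quantify over types inside a formula, so the models range over the structures whose
  domain is a subset of a given type. The assignment \<open>e\<close> supplies the parameters of \<open>\<psi>\<close>; only the
  finitely many values at indices free in \<open>\<psi>\<close> matter.
\<close>

definition semantically_defines :: "'a itself \<Rightarrow> fo_theory \<Rightarrow> fo_theory \<Rightarrow> bool" where
  "semantically_defines _ W V \<longleftrightarrow>
     (\<forall>M :: 'a fo_struct. is_struct M \<and> models M (axms W) \<longrightarrow>
        (\<exists>\<psi> e. in_lang {symb W} \<psi> \<and> range e \<subseteq> domI M \<and>
           (\<forall>\<Phi>\<in>axms V. sat M e (rel_subst (symb V) \<psi> 0 \<Phi>))))"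

end

theory Submission
  imports Defs
begin

text \<open>
  The positive claims are derivations: \<open>D\<close> is obtained from \<open>S\<close> by adding a uniqueness clause, and
  \<open>T(\<phi>)\<close> is \<open>D(\<phi> \<longrightarrow> x = 0, 0)\<close>.

  For the negative claims we use models of \<open>PA\<close> in which every element is definable from one
  parameter \<open>c\<close> coding a finite set. They are limits along an ultrafilter of the expansions
  \<open>(K, t k)\<close> of a fixed model \<open>K\<close> by standard codes \<open>t k\<close>, restricted to the elements definable
  from the new constant. The obstruction is always that, in a structure with full induction and a
  nonstandard element, the elements that a definable relation \<open>R(n, \<cdot>)\<close> determines uniquely for
  standard \<open>n\<close> are bounded.

  If \<open>K\<close> is the standard model and \<open>t k\<close> codes the elements defined by the first \<open>k\<close> formulas, the
  limit satisfies \<open>DEF\<close>, while a definition of \<open>USB\<close> would enumerate all elements \<open>x\<close> by way of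
  formulas true of \<open>(x + c)\<^sup>2 + x\<close> only. If \<open>K\<close> has a nonstandard \<open>\<emptyset>\<close>-definable element \<open>d\<close> and \<open>t k\<close>
  codes the first \<open>k\<close> truths of \<open>K\<close>, the limit satisfies \<open>TB\<close>, and since \<open>c < d\<close> its
  \<open>\<emptyset>\<close>-definable elements are cofinal, so that \<open>DEF\<close> is not definable.

  Such a \<open>K\<close> exists, for otherwise all models of \<open>PA\<close> satisfy the same sentences about numerals,
  and truth in the standard model would amount to the existence of arbitrarily large finite
  fragments of the diagram of a model, which is arithmetical.
\<close>

section \<open>Substitution and satisfaction\<close>

text \<open>The models may live in any infinite type, so limits are built as countable structures
  whose elements are named by numbers. Names for least counterexamples turn quantifiers into
  propositional conditions on the diagram: these pass to an ultrafilter limit directly, and the same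
  names supply both induction and definability from \<open>c\<close>.

  Two obstacles shape the negative claims. \<open>DEF\<close> speaks about formulas without
  \<open>c\<close>, whereas elements of the model are defined from \<open>c\<close>. When
  \<open>c\<close> lies below a \<open>\<emptyset>\<close>-definable \<open>d\<close>, one can bound
  the values obtained from all parameters \<open>a < d\<close>; the least bound no longer depends on
  \<open>c\<close>, and this is why the \<open>\<emptyset>\<close>-definable elements are cofinal.
  Over the standard model no such \<open>d\<close> exists, as the limit then has only standard
  \<open>\<emptyset>\<close>-definable elements; hence the search for a different \<open>K\<close>.
  \<open>USB\<close> speaks about unary formulas, so there \<open>c\<close> has to be passed in
  through the argument: \<open>(x + c)^2 + x\<close> determines both \<open>x\<close> and
  \<open>c\<close>.\<close>

lemma eval_subst_tm: "eval M e (subst_tm \<sigma> t) = eval M (\<lambda>i. eval M e (\<sigma> i)) t"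
  by (induction t) auto

lemma up_0 [simp]: "up \<sigma> 0 = Var 0"
  and up_Suc [simp]: "up \<sigma> (Suc i) = subst_tm (\<lambda>j. Var (Suc j)) (\<sigma> i)"
  by (simp_all add: up_def)

lemma eval_up: "(\<lambda>i. eval M (case_nat a e) (up \<sigma> i)) = case_nat a (\<lambda>i. eval M e (\<sigma> i))"
  by (rule ext) (simp add: eval_subst_tm split: nat.split)

lemma sat_subst: "sat M e (subst \<sigma> \<phi>) \<longleftrightarrow> sat M (\<lambda>i. eval M e (\<sigma> i)) \<phi>"
  by (induction \<phi> arbitrary: e \<sigma>)
     (auto simp: eval_subst_tm eval_up comp_def)

lemma subst_tm_cong: "(\<And>i. i \<in> fv_tm t \<Longrightarrow> \<sigma> i = \<tau> i) \<Longrightarrow> subst_tm \<sigma> t = subst_tm \<tau> t"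
  by (induction t) auto

lemma subst_cong: "(\<And>i. i \<in> fv \<phi> \<Longrightarrow> \<sigma> i = \<tau> i) \<Longrightarrow> subst \<sigma> \<phi> = subst \<tau> \<phi>"
proof (induction \<phi> arbitrary: \<sigma> \<tau>)
  case (Forall \<phi>)
  have "up \<sigma> i = up \<tau> i" if "i \<in> fv \<phi>" for i
    using Forall.prems that by (cases i) auto
  then have "subst (up \<sigma>) \<phi> = subst (up \<tau>) \<phi>" by (rule Forall.IH)
  then show ?case by simp
next
  case (Imp \<phi> \<psi>)
  have "subst \<sigma> \<phi> = subst \<tau> \<phi>" by (rule Imp.IH(1)) (simp add: Imp.prems)
  moreover have "subst \<sigma> \<psi> = subst \<tau> \<psi>" by (rule Imp.IH(2)) (simp add: Imp.prems)
  ultimately show ?case by simp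
qed (auto intro: subst_tm_cong)

lemma subst_tm_Var [simp]: "subst_tm Var t = t"
  by (induction t) auto

lemma up_Var [simp]: "up Var = Var"
  by (rule ext) (simp add: up_def split: nat.split)

lemma subst_Var [simp]: "subst Var \<phi> = \<phi>"
  by (induction \<phi>) (auto simp: map_idI)

lemma subst_id: "(\<And>i. i \<in> fv \<phi> \<Longrightarrow> \<sigma> i = Var i) \<Longrightarrow> subst \<sigma> \<phi> = \<phi>"
  using subst_cong[of \<phi> \<sigma> Var] by simp

lemma subst_tm_subst_tm: "subst_tm \<sigma> (subst_tm \<tau> t) = subst_tm (\<lambda>i. subst_tm \<sigma> (\<tau> i)) t"
  by (induction t) auto

lemma up_comp: "(\<lambda>i. subst_tm (up \<sigma>) (up \<tau> i)) = up (\<lambda>i. subst_tm \<sigma> (\<tau> i))"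
  by (rule ext) (auto simp: up_def subst_tm_subst_tm split: nat.split)

lemma subst_subst: "subst \<sigma> (subst \<tau> \<phi>) = subst (\<lambda>i. subst_tm \<sigma> (\<tau> i)) \<phi>"
  by (induction \<phi> arbitrary: \<sigma> \<tau>) (auto simp: subst_tm_subst_tm up_comp)

lemma in_lang_subst [simp]: "in_lang L (subst \<sigma> \<phi>) = in_lang L \<phi>"
  by (induction \<phi> arbitrary: \<sigma>) auto

lemma fv_subst_tm: "fv_tm (subst_tm \<sigma> t) = (\<Union>i\<in>fv_tm t. fv_tm (\<sigma> i))"
  by (induction t) auto

lemma fv_up: "{j. Suc j \<in> fv_tm (up \<sigma> i)} = (case i of 0 \<Rightarrow> {} | Suc k \<Rightarrow> fv_tm (\<sigma> k))"
  by (auto simp: fv_subst_tm split: nat.split)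

lemma fv_subst: "fv (subst \<sigma> \<phi>) = (\<Union>i\<in>fv \<phi>. fv_tm (\<sigma> i))"
proof (induction \<phi> arbitrary: \<sigma>)
  case (Forall \<phi>)
  have "fv (subst \<sigma> (Forall \<phi>)) = (\<Union>i\<in>fv \<phi>. {j. Suc j \<in> fv_tm (up \<sigma> i)})"
    using Forall by auto
  also have "\<dots> = (\<Union>i\<in>fv \<phi>. case i of 0 \<Rightarrow> {} | Suc k \<Rightarrow> fv_tm (\<sigma> k))"
    by (simp only: fv_up)
  also have "\<dots> = (\<Union>i\<in>fv (Forall \<phi>). fv_tm (\<sigma> i))"
  proof (intro equalityI subsetI)
    fix x assume "x \<in> (\<Union>i\<in>fv \<phi>. case i of 0 \<Rightarrow> {} | Suc k \<Rightarrow> fv_tm (\<sigma> k))"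
    then obtain i where "i \<in> fv \<phi>" "x \<in> (case i of 0 \<Rightarrow> {} | Suc k \<Rightarrow> fv_tm (\<sigma> k))" by blast
    then show "x \<in> (\<Union>i\<in>fv (Forall \<phi>). fv_tm (\<sigma> i))" by (cases i) auto
  next
    fix x assume "x \<in> (\<Union>i\<in>fv (Forall \<phi>). fv_tm (\<sigma> i))"
    then obtain i where "Suc i \<in> fv \<phi>" "x \<in> fv_tm (\<sigma> i)" by auto
    then show "x \<in> (\<Union>i\<in>fv \<phi>. case i of 0 \<Rightarrow> {} | Suc k \<Rightarrow> fv_tm (\<sigma> k))"
      by (intro UN_I[of "Suc i"]) auto
  qed
  finally show ?case .
qed (auto simp: fv_subst_tm)

lemma eval_cong: "(\<And>i. i \<in> fv_tm t \<Longrightarrow> e i = e' i) \<Longrightarrow> eval M e t = eval M e' t"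
  by (induction t) auto

lemma sat_cong: "(\<And>i. i \<in> fv \<phi> \<Longrightarrow> e i = e' i) \<Longrightarrow> sat M e \<phi> \<longleftrightarrow> sat M e' \<phi>"
proof (induction \<phi> arbitrary: e e')
  case (Rel r ts)
  have "map (eval M e) ts = map (eval M e') ts"
    by (rule map_cong[OF refl], rule eval_cong) (use Rel in auto)
  then show ?case by (simp only: sat.simps)
next
  case (Forall \<phi>)
  have "sat M (case_nat a e) \<phi> \<longleftrightarrow> sat M (case_nat a e') \<phi>" for a
    by (rule Forall.IH) (use Forall.prems in \<open>auto split: nat.split\<close>)
  then show ?case by simp
next
  case (Eq s t)
  have "eval M e s = eval M e' s" "eval M e t = eval M e' t"
    by (rule eval_cong, use Eq in simp)+
  then show ?case by simp
next
  case (Lt s t)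
  have "eval M e s = eval M e' s" "eval M e t = eval M e' t"
    by (rule eval_cong, use Lt in simp)+
  then show ?case by simp
next
  case (Imp \<phi> \<psi>)
  have "sat M e \<phi> \<longleftrightarrow> sat M e' \<phi>" "sat M e \<psi> \<longleftrightarrow> sat M e' \<psi>"
    by (rule Imp.IH(1), use Imp.prems in simp) (rule Imp.IH(2), use Imp.prems in simp)
  then show ?case by simp
qed simp

lemma sat_sentence: "sentence \<phi> \<Longrightarrow> sat M e \<phi> \<longleftrightarrow> sat M e' \<phi>"
  by (rule sat_cong) simp

lemma finite_fv_tm [simp]: "finite (fv_tm t)"
  by (induction t) auto

lemma finite_fv [simp]: "finite (fv \<phi>)"
proof (induction \<phi>)
  case (Forall \<phi>)
  have "{i. Suc i \<in> fv \<phi>} = Suc -` fv \<phi>" by auto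
  then show ?case using Forall finite_vimageI[of "fv \<phi>" Suc] by simp
qed auto

lemma eval_in_dom: "is_struct M \<Longrightarrow> range e \<subseteq> domI M \<Longrightarrow> eval M e t \<in> domI M"
  by (induction t) (auto simp: is_struct_def)

lemma range_case_nat: "range (case_nat a e) \<subseteq> A \<longleftrightarrow> a \<in> A \<and> range e \<subseteq> A"
proof
  assume h: "range (case_nat a e) \<subseteq> A"
  have "a \<in> A" using h[THEN subsetD, OF rangeI, of 0] by simp
  moreover have "e i \<in> A" for i using h[THEN subsetD, OF rangeI, of "Suc i"] by simp
  ultimately show "a \<in> A \<and> range e \<subseteq> A" by auto
next
  assume "a \<in> A \<and> range e \<subseteq> A"
  then show "range (case_nat a e) \<subseteq> A"
    by (auto simp: image_subset_iff split: nat.split)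
qed

section \<open>Standard elements and the meaning of numerals\<close>

fun num :: "'a fo_struct \<Rightarrow> nat \<Rightarrow> 'a" where
  "num M 0 = zeroI M"
| "num M (Suc n) = addI M (num M n) (oneI M)"

lemma eval_numeral_tm [simp]: "eval M e (numeral_tm n) = num M n"
  by (induction n) auto

lemma num_in_dom: "is_struct M \<Longrightarrow> num M n \<in> domI M"
  by (induction n) (auto simp: is_struct_def)

lemma fv_numeral_tm [simp]: "fv_tm (numeral_tm n) = {}"
  by (induction n) auto

lemma subst_numeral_tm [simp]: "subst_tm \<sigma> (numeral_tm n) = numeral_tm n"
  by (induction n) auto

lemma fv_quot [simp]: "fv_tm (quot \<phi>) = {}"
  and subst_quot [simp]: "subst_tm \<sigma> (quot \<phi>) = quot \<phi>"
  by (simp_all add: quot_def)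

lemma sat_Iff: "sat M e (Iff \<phi> \<psi>) \<longleftrightarrow> (sat M e \<phi> \<longleftrightarrow> sat M e \<psi>)"
  by auto

lemma sat_Exists1:
  assumes "fv \<phi> \<subseteq> {0}"
  shows "sat M e (Exists1 \<phi>) \<longleftrightarrow> (\<exists>!x. x \<in> domI M \<and> sat M (case_nat x e) \<phi>)"
proof -
  have 0: "i = 0" if "i \<in> fv \<phi>" for i
    using assms that by blast
  have "subst (case_nat (Var 0) (\<lambda>i. Var (Suc (Suc i)))) \<phi> = \<phi>"
    by (rule subst_id) (drule 0, simp)
  then have *: "Exists1 \<phi> = Exists (And \<phi> (Forall (Imp \<phi> (Eq (Var 0) (Var 1)))))"
    by (simp add: Exists1_def)
  have k: "sat M (case_nat y (case_nat x e)) \<phi> = sat M (case_nat y e) \<phi>" for x y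
  proof (rule sat_cong)
    fix i assume "i \<in> fv \<phi>"
    then have "i = 0" by (rule 0)
    then show "case_nat y (case_nat x e) i = case_nat y e i" by simp
  qed
  have "sat M e (Exists1 \<phi>) \<longleftrightarrow> (\<exists>x\<in>domI M. sat M (case_nat x e) \<phi> \<and>
      (\<forall>y\<in>domI M. sat M (case_nat y e) \<phi> \<longrightarrow> y = x))"
    unfolding * sat.simps eval.simps k by simp
  then show ?thesis
    by blast
qed

section \<open>Definable predicates on assignments\<close>

text \<open>Definability is attached to predicates on assignments, so that it can be proved by
  closure rules instead of writing out formulas with de Bruijn indices.\<close>

definition dfn :: "'a fo_struct \<Rightarrow> psym set \<Rightarrow> ((nat \<Rightarrow> 'a) \<Rightarrow> bool) \<Rightarrow> bool" where
  "dfn M L P \<longleftrightarrow> (\<exists>\<phi>. in_lang L \<phi> \<and> (\<forall>e. range e \<subseteq> domI M \<longrightarrow> (sat M e \<phi> \<longleftrightarrow> P e)))"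

definition tfn :: "'a fo_struct \<Rightarrow> ((nat \<Rightarrow> 'a) \<Rightarrow> 'a) \<Rightarrow> bool" where
  "tfn M f \<longleftrightarrow> (\<exists>t. \<forall>e. eval M e t = f e)"

lemma dfn_sat: "in_lang L \<phi> \<Longrightarrow> dfn M L (\<lambda>e. sat M e \<phi>)"
  unfolding dfn_def by blast

lemma tfn_var: "tfn M (\<lambda>e. e i)"
  unfolding tfn_def by (rule exI[of _ "Var i"]) simp

lemma tfn_zero: "tfn M (\<lambda>e. zeroI M)"
  unfolding tfn_def by (rule exI[of _ Zero]) simp

lemma tfn_one: "tfn M (\<lambda>e. oneI M)"
  unfolding tfn_def by (rule exI[of _ One]) simp

lemma tfn_add: "tfn M f \<Longrightarrow> tfn M g \<Longrightarrow> tfn M (\<lambda>e. addI M (f e) (g e))"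
  unfolding tfn_def
  by (elim exE, rule_tac x="Add t ta" in exI) simp

lemma tfn_mul: "tfn M f \<Longrightarrow> tfn M g \<Longrightarrow> tfn M (\<lambda>e. mulI M (f e) (g e))"
  unfolding tfn_def
  by (elim exE, rule_tac x="Mul t ta" in exI) simp

lemma dfn_eq: "tfn M f \<Longrightarrow> tfn M g \<Longrightarrow> dfn M L (\<lambda>e. f e = g e)"
  unfolding tfn_def dfn_def
  by (elim exE, rule_tac x="Eq t ta" in exI) simp

lemma dfn_lt: "tfn M f \<Longrightarrow> tfn M g \<Longrightarrow> dfn M L (\<lambda>e. ltI M (f e) (g e))"
  unfolding tfn_def dfn_def
  by (elim exE, rule_tac x="Lt t ta" in exI) simp

lemma dfn_imp: "dfn M L P \<Longrightarrow> dfn M L Q \<Longrightarrow> dfn M L (\<lambda>e. P e \<longrightarrow> Q e)"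
  unfolding dfn_def by (elim exE, rule_tac x="Imp \<phi> \<phi>'" in exI) simp

lemma dfn_False: "dfn M L (\<lambda>e. False)"
  unfolding dfn_def by (rule exI[of _ Falsum]) simp

lemma dfn_not: "dfn M L P \<Longrightarrow> dfn M L (\<lambda>e. \<not> P e)"
  using dfn_imp[OF _ dfn_False, of M L P] by simp

lemma dfn_or: "dfn M L P \<Longrightarrow> dfn M L Q \<Longrightarrow> dfn M L (\<lambda>e. P e \<or> Q e)"
  using dfn_imp[OF dfn_not, of M L P Q] by (simp add: disj_imp)

lemma dfn_and: "dfn M L P \<Longrightarrow> dfn M L Q \<Longrightarrow> dfn M L (\<lambda>e. P e \<and> Q e)"
  using dfn_not[OF dfn_imp[OF _ dfn_not, of M L P Q]] by simp

lemma dfn_iff: "dfn M L P \<Longrightarrow> dfn M L Q \<Longrightarrow> dfn M L (\<lambda>e. P e \<longleftrightarrow> Q e)"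
  using dfn_and[OF dfn_imp dfn_imp, of M L P Q Q P] by (simp add: iff_conv_conj_imp)

text \<open>In the hypothesis the quantified variable occupies index \<open>0\<close> and the others
  have moved up by one, so that resolution can pass below the quantifier.\<close>

lemma dfn_all:
  assumes "dfn M L (\<lambda>e. P (e 0) (\<lambda>i. e (Suc i)))"
  shows "dfn M L (\<lambda>e. \<forall>x\<in>domI M. P x e)"
proof -
  obtain \<phi> where "in_lang L \<phi>"
    and \<phi>: "\<And>e. range e \<subseteq> domI M \<Longrightarrow> sat M e \<phi> \<longleftrightarrow> P (e 0) (\<lambda>i. e (Suc i))"
    using assms unfolding dfn_def by blast
  have "sat M (case_nat x e) \<phi> \<longleftrightarrow> P x e" if "range e \<subseteq> domI M" "x \<in> domI M" for x e
    using \<phi>[of "case_nat x e"] that by (simp add: range_case_nat)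
  then show ?thesis
    unfolding dfn_def using \<open>in_lang L \<phi>\<close> by (intro exI[of _ "Forall \<phi>"]) auto
qed

lemma dfn_ex:
  assumes "dfn M L (\<lambda>e. P (e 0) (\<lambda>i. e (Suc i)))"
  shows "dfn M L (\<lambda>e. \<exists>x\<in>domI M. P x e)"
  using dfn_not[OF dfn_all[of M L "\<lambda>x e. \<not> P x e"], OF dfn_not, OF assms] by simp

lemma dfn_subst:
  assumes "is_struct M" "dfn M L P"
  shows "dfn M L (\<lambda>e. P (\<lambda>i. eval M e (\<sigma> i)))"
proof -
  obtain \<phi> where "in_lang L \<phi>" and \<phi>: "\<And>e. range e \<subseteq> domI M \<Longrightarrow> sat M e \<phi> \<longleftrightarrow> P e"
    using assms unfolding dfn_def by blast
  then show ?thesis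
    unfolding dfn_def using eval_in_dom[OF assms(1)]
    by (intro exI[of _ "subst \<sigma> \<phi>"]) (auto simp: sat_subst image_subset_iff)
qed

lemma dfn_reindex:
  assumes "is_struct M" "dfn M L P"
  shows "dfn M L (\<lambda>e. P (\<lambda>i. e (\<rho> i)))"
  using dfn_subst[OF assms, of "\<lambda>i. Var (\<rho> i)"] by simp

lemma dfn_cong:
  assumes "\<And>e. range e \<subseteq> domI M \<Longrightarrow> P e \<longleftrightarrow> Q e" "dfn M L P"
  shows "dfn M L Q"
  using assms unfolding dfn_def by metis

lemmas dfn_intros = tfn_var tfn_zero tfn_one tfn_add tfn_mul dfn_eq dfn_lt dfn_imp dfn_False
  dfn_not dfn_or dfn_and dfn_iff dfn_all dfn_ex

section \<open>Models of the base theory\<close>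

locale pa_minus =
  fixes M :: "'a fo_struct"
  assumes struct: "is_struct M"
    and base: "models M PA_minus"
begin

lemma zero_in [simp]: "zeroI M \<in> domI M"
  and one_in [simp]: "oneI M \<in> domI M"
  and add_in [simp]: "a \<in> domI M \<Longrightarrow> b \<in> domI M \<Longrightarrow> addI M a b \<in> domI M"
  and mul_in [simp]: "a \<in> domI M \<Longrightarrow> b \<in> domI M \<Longrightarrow> mulI M a b \<in> domI M"
  using struct by (auto simp: is_struct_def)

lemma num_in [simp]: "num M n \<in> domI M"
  using num_in_dom[OF struct] .

lemma base_axiom:
  assumes "Forall (Forall (Forall \<phi>)) \<in> PA_minus" "x \<in> domI M" "y \<in> domI M" "z \<in> domI M"
  shows "sat M (case_nat x (case_nat y (case_nat z (\<lambda>_. zeroI M)))) \<phi>"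
proof -
  have "sat M (\<lambda>_. zeroI M) (Forall (Forall (Forall \<phi>)))"
    using base assms(1) unfolding models_def by (auto simp: image_subset_iff)
  then show ?thesis
    using assms(2-4) by simp
qed

lemma
  assumes x: "x \<in> domI M" and y: "y \<in> domI M" and z: "z \<in> domI M"
  shows add_assoc: "addI M (addI M x y) z = addI M x (addI M y z)"
    and add_comm: "addI M x y = addI M y x"
    and distrib: "mulI M x (addI M y z) = addI M (mulI M x y) (mulI M x z)"
    and add_0: "addI M x (zeroI M) = x"
    and mul_0: "mulI M x (zeroI M) = zeroI M"
    and mul_1: "mulI M x (oneI M) = x"
    and lt_trans: "ltI M x y \<Longrightarrow> ltI M y z \<Longrightarrow> ltI M x z"
    and lt_irrefl: "\<not> ltI M x x"
    and lt_linear: "ltI M x y \<or> x = y \<or> ltI M y x"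
    and lt_add: "ltI M x y \<Longrightarrow> ltI M (addI M x z) (addI M y z)"
    and lt_diff: "ltI M x y \<Longrightarrow> \<exists>w\<in>domI M. addI M x w = y"
    and lt_0_1: "ltI M (zeroI M) (oneI M)"
    and discrete: "ltI M (zeroI M) x \<Longrightarrow> ltI M (oneI M) x \<or> oneI M = x"
    and zero_least: "ltI M (zeroI M) x \<or> zeroI M = x"
proof -
  note ax = base_axiom[OF _ x y z, unfolded PA_minus_def Let_def]
  show "addI M (addI M x y) z = addI M x (addI M y z)"
    using ax[of "Eq (Add (Add (Var 0) (Var 1)) (Var 2)) (Add (Var 0) (Add (Var 1) (Var 2)))"]
    by (simp add: eval_nat_numeral)
  show "addI M x y = addI M y x"
    using ax[of "Eq (Add (Var 0) (Var 1)) (Add (Var 1) (Var 0))"] by simp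
  show "mulI M x (addI M y z) = addI M (mulI M x y) (mulI M x z)"
    using ax[of "Eq (Mul (Var 0) (Add (Var 1) (Var 2)))
      (Add (Mul (Var 0) (Var 1)) (Mul (Var 0) (Var 2)))"]
    by (simp add: eval_nat_numeral)
  show "addI M x (zeroI M) = x"
    using ax[of "Eq (Add (Var 0) Zero) (Var 0)"] by simp
  show "mulI M x (zeroI M) = zeroI M"
    using ax[of "Eq (Mul (Var 0) Zero) Zero"] by simp
  show "mulI M x (oneI M) = x"
    using ax[of "Eq (Mul (Var 0) One) (Var 0)"] by simp
  show "ltI M x y \<Longrightarrow> ltI M y z \<Longrightarrow> ltI M x z"
    using ax[of "Imp (And (Lt (Var 0) (Var 1)) (Lt (Var 1) (Var 2))) (Lt (Var 0) (Var 2))"]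
    by (simp add: eval_nat_numeral)
  show "\<not> ltI M x x"
    using ax[of "Neg (Lt (Var 0) (Var 0))"] by simp
  show "ltI M x y \<or> x = y \<or> ltI M y x"
    using ax[of "Or (Or (Lt (Var 0) (Var 1)) (Eq (Var 0) (Var 1))) (Lt (Var 1) (Var 0))"] by auto
  show "ltI M x y \<Longrightarrow> ltI M (addI M x z) (addI M y z)"
    using ax[of "Imp (Lt (Var 0) (Var 1)) (Lt (Add (Var 0) (Var 2)) (Add (Var 1) (Var 2)))"]
    by (simp add: eval_nat_numeral)
  show "ltI M x y \<Longrightarrow> \<exists>w\<in>domI M. addI M x w = y"
    using ax[of "Imp (Lt (Var 0) (Var 1)) (Exists (Eq (Add (Var 1) (Var 0)) (Var 2)))"]
    by (auto simp add: eval_nat_numeral)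
  show "ltI M (zeroI M) (oneI M)"
    using ax[of "Lt Zero One"] by simp
  show "ltI M (zeroI M) x \<Longrightarrow> ltI M (oneI M) x \<or> oneI M = x"
    using ax[of "Imp (Lt Zero (Var 0)) (Le One (Var 0))"] by auto
  show "ltI M (zeroI M) x \<or> zeroI M = x"
    using ax[of "Le Zero (Var 0)"] by auto
qed

lemma lt_add_left:
  "x \<in> domI M \<Longrightarrow> y \<in> domI M \<Longrightarrow> z \<in> domI M \<Longrightarrow> ltI M x y \<Longrightarrow> ltI M (addI M z x) (addI M z y)"
  using lt_add[of x y z] add_comm[of z x z] add_comm[of z y z] by simp

lemma lt_Suc: "x \<in> domI M \<Longrightarrow> ltI M x (addI M x (oneI M))"
  using lt_0_1[of x x x] lt_add_left[of "zeroI M" "oneI M" x] add_0[of x x x] by auto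

text \<open>Discreteness: if \<open>y < x\<close>, then \<open>x = y + w\<close> with
  \<open>w\<close> positive, so \<open>w\<close> is at least one and \<open>x\<close> is at least
  \<open>y + 1\<close>.\<close>

lemma lt_Suc_iff:
  assumes "x \<in> domI M" "y \<in> domI M"
  shows "ltI M x (addI M y (oneI M)) \<longleftrightarrow> ltI M x y \<or> x = y"
proof
  assume lt: "ltI M x (addI M y (oneI M))"
  show "ltI M x y \<or> x = y"
  proof (rule ccontr)
    assume "\<not> ?thesis"
    then have yx: "ltI M y x" using lt_linear assms by blast
    then obtain w where w: "w \<in> domI M" "addI M y w = x" using lt_diff assms by blast
    have "zeroI M \<noteq> w"
      using w yx lt_irrefl[of x x x] add_0[of y y y] assms by auto
    then have "ltI M (zeroI M) w" using zero_least w by blast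
    then consider "ltI M (oneI M) w" | "oneI M = w" using discrete w by blast
    then show False
    proof cases
      case 1
      then have "ltI M (addI M y (oneI M)) x" using lt_add_left[of "oneI M" w y] w assms by simp
      then show False using lt lt_trans[of x "addI M y (oneI M)" x] lt_irrefl[of x x x] assms by simp
    next
      case 2
      then show False using lt w lt_irrefl[of x x x] assms by simp
    qed
  qed
next
  assume "ltI M x y \<or> x = y"
  then show "ltI M x (addI M y (oneI M))"
    using lt_Suc[of y] lt_trans[of x y "addI M y (oneI M)"] assms by auto
qed

lemma num_add: "num M (m + n) = addI M (num M m) (num M n)"
  by (induction n)
     (use add_0[of "num M m" "num M m" "num M m"] add_assoc[of "num M m" _ "oneI M"] in auto)

lemma num_1: "num M (Suc 0) = oneI M"
  using add_comm[of "zeroI M" "oneI M" "oneI M"] add_0[of "oneI M" "oneI M" "oneI M"] by simp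

lemma num_mul: "num M (m * n) = mulI M (num M m) (num M n)"
proof (induction n)
  case 0
  then show ?case using mul_0[of "num M m" "num M m" "num M m"] by simp
next
  case (Suc n)
  have "num M (m * Suc n) = addI M (num M (m * n)) (num M m)"
    by (metis num_add add.commute mult_Suc_right)
  then show ?case
    using Suc distrib[of "num M m" "num M n" "oneI M"] mul_1[of "num M m" "num M m" "num M m"] by simp
qed

text \<open>The standard elements form an initial segment: below \<open>n + 1\<close> lie only
  \<open>n\<close> and what is below \<open>n\<close>. This is the source of the absoluteness of
  bounded formulas at numerals.\<close>

lemma lt_num_iff:
  "x \<in> domI M \<Longrightarrow> ltI M x (num M n) \<longleftrightarrow> (\<exists>m<n. x = num M m)"
proof (induction n)
  case 0
  have "\<not> ltI M x (zeroI M)"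
    using zero_least[of x x x] lt_trans[of "zeroI M" x "zeroI M"] lt_irrefl[of "zeroI M" x x] 0
      lt_irrefl[of x x x] by auto
  then show ?case by simp
next
  case (Suc n)
  then show ?case using lt_Suc_iff[of x "num M n"] by (auto simp: less_Suc_eq)
qed

lemma lt_num_num: "m < n \<Longrightarrow> ltI M (num M m) (num M n)"
  using lt_num_iff by auto

lemma num_inj [simp]: "num M m = num M n \<longleftrightarrow> m = n"
  using lt_num_num[of m n] lt_num_num[of n m] lt_irrefl[OF num_in num_in num_in, of n]
  by (cases m n rule: linorder_cases) auto

lemma ltI_num [simp]: "ltI M (num M m) (num M n) \<longleftrightarrow> m < n"
  using lt_num_iff[of "num M m" n] by auto

lemma bex_lt_num:
  "(\<exists>x\<in>domI M. ltI M x (num M n) \<and> P x) \<longleftrightarrow> (\<exists>m<n. P (num M m))"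
  using lt_num_iff by auto

lemma nonstandard_above:
  assumes "x \<in> domI M" "\<And>n. x \<noteq> num M n"
  shows "ltI M (num M n) x"
  using lt_linear[of x "num M n" x] lt_num_iff[of x n] assms by auto

end

section \<open>The standard model\<close>

definition Nat_struct :: "nat fo_struct" where
  "Nat_struct = \<lparr>domI = UNIV, zeroI = 0, oneI = 1, addI = (+), mulI = (*), ltI = (<),
     relI = \<lambda>_ _. False\<rparr>"

lemma Nat_struct_simps [simp]:
  "domI Nat_struct = UNIV" "zeroI Nat_struct = 0" "oneI Nat_struct = Suc 0"
  "addI Nat_struct = (+)" "mulI Nat_struct = (*)" "ltI Nat_struct = (<)"
  by (simp_all add: Nat_struct_def)

lemma num_Nat_struct [simp]: "num Nat_struct n = n"
  by (induction n) auto

lemma is_struct_Nat: "is_struct Nat_struct"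
  by (simp add: is_struct_def)

lemma models_Nat_PA_minus: "models Nat_struct PA_minus"
  unfolding models_def PA_minus_def Let_def
  by (auto simp: algebra_simps eval_nat_numeral) (metis le_Suc_ex less_imp_le)

interpretation Nat: pa_minus Nat_struct
  by unfold_locales (rule is_struct_Nat models_Nat_PA_minus)+

section \<open>Closure properties of arithmetical relations and functions\<close>

abbreviation arith :: "((nat \<Rightarrow> nat) \<Rightarrow> bool) \<Rightarrow> bool" where
  "arith \<equiv> dfn Nat_struct {}"

text \<open>Pairing is not given by a term, so functions enter formulas through their graphs; index
  \<open>0\<close> is reserved for the value.\<close>

definition gfn :: "((nat \<Rightarrow> nat) \<Rightarrow> nat) \<Rightarrow> bool" where
  "gfn f \<longleftrightarrow> arith (\<lambda>e. e 0 = f (\<lambda>i. e (Suc i)))"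

lemma arith_all:
  "arith (\<lambda>e. P (e 0) (\<lambda>i. e (Suc i))) \<Longrightarrow> arith (\<lambda>e. \<forall>x. P x e)"
  using dfn_all[of Nat_struct "{}" P] by simp

lemma arith_ex:
  "arith (\<lambda>e. P (e 0) (\<lambda>i. e (Suc i))) \<Longrightarrow> arith (\<lambda>e. \<exists>x. P x e)"
  using dfn_ex[of Nat_struct "{}" P] by simp

lemma arith_comp:
  assumes "gfn f" "arith (\<lambda>e. P (e 0) (\<lambda>i. e (Suc i)))"
  shows "arith (\<lambda>e. P (f e) e)"
  using arith_ex[OF dfn_and, of "\<lambda>x e. x = f e" P] assms by (simp add: gfn_def)

lemma gfn_reindex: "gfn f \<Longrightarrow> gfn (\<lambda>e. f (\<lambda>i. e (\<rho> i)))"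
  unfolding gfn_def
  using dfn_reindex[OF is_struct_Nat, of "{}" "\<lambda>e. e 0 = f (\<lambda>i. e (Suc i))" "case_nat 0 (\<lambda>i. Suc (\<rho> i))"]
  by simp

lemma gfn_shift: "gfn f \<Longrightarrow> gfn (\<lambda>e. f (\<lambda>i. e (Suc i)))"
  by (rule gfn_reindex)

lemma arith_eq: "gfn f \<Longrightarrow> gfn g \<Longrightarrow> arith (\<lambda>e. f e = g e)"
  using arith_comp[of f "\<lambda>x e. x = g e"] by (simp add: gfn_def)

lemma gfn_var: "gfn (\<lambda>e. e n)"
  unfolding gfn_def by (rule dfn_eq; rule tfn_var)

lemma tfn_numeral: "tfn M (\<lambda>e. num M n)"
  unfolding tfn_def by (rule exI[of _ "numeral_tm n"]) simp

lemma gfn_const: "gfn (\<lambda>e. n)"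
  unfolding gfn_def using dfn_eq[OF tfn_var tfn_numeral, of Nat_struct "{}" 0 n] by simp

lemma gfn_comp2:
  assumes "gfn f" "gfn g" "arith (\<lambda>e. e 2 = h (e 0) (e 1))"
  shows "gfn (\<lambda>e. h (f e) (g e))"
proof -
  have *: "arith (\<lambda>e. e 2 = h (e 1) (e 0))"
    using dfn_reindex[OF is_struct_Nat assms(3), of "\<lambda>i. if i = 0 then 1 else if i = 1 then 0 else i"]
    by simp
  have "arith (\<lambda>e. e (Suc 0) = h (e 0) (g (\<lambda>i. e (Suc (Suc i)))))"
    using arith_comp[of "\<lambda>e. g (\<lambda>i. e (Suc (Suc i)))" "\<lambda>x e. e 1 = h (e 0) x"]
      gfn_reindex[OF assms(2)] * by (simp add: eval_nat_numeral)
  then show ?thesis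
    unfolding gfn_def
    using arith_comp[OF gfn_shift[OF assms(1)], of "\<lambda>x e. e 0 = h x (g (\<lambda>i. e (Suc i)))"] by simp
qed

lemma gfn_add: "gfn f \<Longrightarrow> gfn g \<Longrightarrow> gfn (\<lambda>e. f e + g e)"
  using gfn_comp2[of f g "(+)"] dfn_eq[OF tfn_var tfn_add[OF tfn_var tfn_var], of Nat_struct "{}" 2 0 1]
  by simp

lemma gfn_mult: "gfn f \<Longrightarrow> gfn g \<Longrightarrow> gfn (\<lambda>e. f e * g e)"
  using gfn_comp2[of f g "(*)"] dfn_eq[OF tfn_var tfn_mul[OF tfn_var tfn_var], of Nat_struct "{}" 2 0 1]
  by simp

lemma gfn_Suc: "gfn f \<Longrightarrow> gfn (\<lambda>e. Suc (f e))"
  using gfn_add[OF _ gfn_const, of f 1] by simp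

text \<open>Doubling removes the division in the triangular number and leaves a polynomial
  equation.\<close>

lemma prod_encode_eq_iff:
  "z = prod_encode (x, y) \<longleftrightarrow> z + z = (x + y) * Suc (x + y) + x + x"
proof -
  have "2 * triangle n = n * Suc n" for n
    by (simp add: triangle_def)
  then have "2 * prod_encode (x, y) = (x + y) * Suc (x + y) + x + x"
    by (simp add: prod_encode_def)
  then show ?thesis by linarith
qed

lemma gfn_prod_encode:
  assumes "gfn f" "gfn g" shows "gfn (\<lambda>e. prod_encode (f e, g e))"
proof -
  have "arith (\<lambda>e. e 2 = prod_encode (e 0, e 1))"
    unfolding prod_encode_eq_iff
    by (intro arith_eq gfn_add gfn_mult gfn_Suc gfn_var)
  then show ?thesis
    using gfn_comp2[of f g "\<lambda>x y. prod_encode (x, y)"] assms by simp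
qed

lemma arith_less:
  assumes "gfn f" "gfn g" shows "arith (\<lambda>e. f e < g e)"
proof -
  have "arith (\<lambda>e. \<exists>x. g e = f e + Suc x)"
    by (intro arith_ex arith_eq gfn_add gfn_Suc gfn_var gfn_shift assms)
  then show ?thesis
    by (simp add: less_iff_Suc_add)
qed

lemmas arith_intros = dfn_imp dfn_False dfn_not dfn_or dfn_and dfn_iff arith_all arith_ex
  arith_eq arith_less gfn_var gfn_const gfn_add gfn_mult gfn_Suc gfn_prod_encode

section \<open>Coding finite sets of natural numbers\<close>

text \<open>
  A finite set \<open>A \<subseteq> {..<m}\<close> is coded by \<open>m\<close>, \<open>b = m!\<close> and the product of the pairwise coprime numbers
  \<open>1 + (x + 1) b\<close> for \<open>x \<in> A\<close>. All quantifiers are bounded, so that membership in a standard code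
  is absolute.
\<close>

definition mem :: "nat \<Rightarrow> nat \<Rightarrow> bool" where
  "mem x t \<longleftrightarrow> (\<exists>m<Suc t. \<exists>a<Suc t. \<exists>b<Suc t. \<exists>q<Suc t. \<exists>r<Suc t.
     t + t = (m + r) * Suc (m + r) + m + m \<and> r + r = (a + b) * Suc (a + b) + a + a \<and>
     x < m \<and> a = q * Suc (Suc x * b))"

text \<open>The first argument of \<open>bex\<close> is the index of the code \<open>t\<close>
  inside the new quantifier, which moves up by one each time. The bound is \<open>t + 1\<close>
  because components may equal \<open>t\<close>.\<close>

definition mem_fm :: fm where
  "mem_fm =
    (let x = Var 5; t = Var 6; m = Var 4; a = Var 3; b = Var 2; q = Var 1; r = Var 0;
         bex = (\<lambda>i \<phi>. Exists (And (Lt (Var 0) (Add (Var i) One)) \<phi>)) in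
     bex 2 (bex 3 (bex 4 (bex 5 (bex 6
       (And (Eq (Add t t) (Add (Add (Mul (Add m r) (Add (Add m r) One)) m) m))
       (And (Eq (Add r r) (Add (Add (Mul (Add a b) (Add (Add a b) One)) a) a))
       (And (Lt x m) (Eq a (Mul q (Add (Mul (Add x One) b) One)))))))))))"

lemma arithmetical_mem_fm: "arithmetical mem_fm"
  by (simp add: mem_fm_def Let_def)

lemma (in pa_minus) sat_bounded_ex:
  assumes "e i = num M n"
  shows "sat M e (Exists (And (Lt (Var 0) (Add (Var (Suc i)) One)) \<phi>)) \<longleftrightarrow>
    (\<exists>m<Suc n. sat M (case_nat (num M m) e) \<phi>)"
  using bex_lt_num[of "Suc n" "\<lambda>x. sat M (case_nat x e) \<phi>"] assms by simp

lemma (in pa_minus) sat_mem_fm: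
  "sat M (case_nat (num M x) (case_nat (num M t) e)) mem_fm \<longleftrightarrow> mem x t"
proof -
  have s: "addI M (num M n) (oneI M) = num M (Suc n)" for n by simp
  have i: "2 = Suc 1" "3 = Suc 2" "4 = Suc 3" "5 = Suc 4" "6 = Suc (5 :: nat)" by simp_all
  show ?thesis
    unfolding mem_fm_def mem_def Let_def
    apply (subst i(1), subst sat_bounded_ex[where n = t], simp)
    apply (rule ex_cong1, rule conj_cong, rule refl)
    apply (subst i(2), subst sat_bounded_ex[where n = t], simp add: eval_nat_numeral)
    apply (rule ex_cong1, rule conj_cong, rule refl)
    apply (subst i(3), subst sat_bounded_ex[where n = t], simp add: eval_nat_numeral)
    apply (rule ex_cong1, rule conj_cong, rule refl)
    apply (subst i(4), subst sat_bounded_ex[where n = t], simp add: eval_nat_numeral)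
    apply (rule ex_cong1, rule conj_cong, rule refl)
    apply (subst i(5), subst sat_bounded_ex[where n = t], simp add: eval_nat_numeral)
    apply (rule ex_cong1, rule conj_cong, rule refl)
    apply (simp add: eval_nat_numeral s num_add[symmetric] num_mul[symmetric] del: num.simps
        mult_Suc_right mult_Suc add_Suc_right add_Suc)
    apply (simp only: conj_ac)
    done
qed

lemma mem_iff: "mem x t \<longleftrightarrow>
  (\<exists>m a b. t = prod_encode (m, prod_encode (a, b)) \<and> x < m \<and> Suc (Suc x * b) dvd a)"
proof
  assume "mem x t"
  then obtain m a b q r where *: "t + t = (m + r) * Suc (m + r) + m + m"
    "r + r = (a + b) * Suc (a + b) + a + a" "x < m" "a = q * Suc (Suc x * b)"
    unfolding mem_def by blast
  then have "r = prod_encode (a, b)" "t = prod_encode (m, r)"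
    by (simp_all only: prod_encode_eq_iff)
  then show "\<exists>m a b. t = prod_encode (m, prod_encode (a, b)) \<and> x < m \<and> Suc (Suc x * b) dvd a"
    using *(3,4) by (metis dvd_triv_right)
next
  assume "\<exists>m a b. t = prod_encode (m, prod_encode (a, b)) \<and> x < m \<and> Suc (Suc x * b) dvd a"
  then obtain m a b where t: "t = prod_encode (m, prod_encode (a, b))"
    and x: "x < m" and d: "Suc (Suc x * b) dvd a" by blast
  define r where "r = prod_encode (a, b)"
  obtain q where q: "a = q * Suc (Suc x * b)" using d by (metis dvdE mult.commute)
  have "m \<le> t" "r \<le> t" using t r_def le_prod_encode_1 le_prod_encode_2 by metis+
  moreover have "a \<le> r" "b \<le> r" unfolding r_def by (rule le_prod_encode_1, rule le_prod_encode_2)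
  moreover have "q \<le> a" using q by simp
  ultimately have "m < Suc t" "a < Suc t" "b < Suc t" "q < Suc t" "r < Suc t" by auto
  moreover have "t + t = (m + r) * Suc (m + r) + m + m" "r + r = (a + b) * Suc (a + b) + a + a"
    using t r_def prod_encode_eq_iff by metis+
  ultimately show "mem x t"
    unfolding mem_def using x q by blast
qed

text \<open>Goedel's beta function argument: a common divisor is coprime to \<open>m!\<close>, yet
  it divides the difference \<open>(x - y) m!\<close>, hence \<open>x - y\<close>, which itself
  divides \<open>m!\<close>.\<close>

lemma coprime_code:
  assumes "x < m" "y < m" "x \<noteq> y"
  shows "coprime (Suc (Suc x * fact m)) (Suc (Suc y * fact m))"
proof (rule coprimeI)
  let ?b = "fact m :: nat"
  fix c assume c: "c dvd Suc (Suc x * ?b)" "c dvd Suc (Suc y * ?b)"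
  have "coprime c ?b"
  proof (rule coprimeI)
    fix d assume "d dvd c" "d dvd ?b"
    then have "d dvd Suc (Suc x * ?b)" "d dvd Suc x * ?b" using c by (auto intro: dvd_trans)
    then have "d dvd 1" by (metis Suc_eq_plus1 dvd_add_right_iff)
    then show "is_unit d" .
  qed
  have "c dvd Suc (max x y) * ?b - Suc (min x y) * ?b"
  proof -
    have "c dvd Suc (Suc (max x y) * ?b) - Suc (Suc (min x y) * ?b)"
      by (rule dvd_diff_nat) (use c in \<open>auto simp: max_def min_def\<close>)
    then show ?thesis by simp
  qed
  also have "Suc (max x y) * ?b - Suc (min x y) * ?b = (max x y - min x y) * ?b"
    by (metis diff_Suc_Suc diff_mult_distrib)
  finally have "c dvd max x y - min x y"
    using \<open>coprime c ?b\<close> coprime_dvd_mult_left_iff by blast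
  moreover have "max x y - min x y dvd ?b"
    by (rule dvd_fact) (use assms in auto)
  ultimately have "c dvd ?b" by (rule dvd_trans)
  then show "is_unit c" using \<open>coprime c ?b\<close> by (meson coprime_common_divisor dvd_refl)
qed

text \<open>Codes can be chosen arbitrarily large; a sequence of codes with
  \<open>t k \<ge> k\<close> has a nonstandard limit.\<close>

lemma finite_set_coded:
  assumes "finite A"
  shows "\<exists>t\<ge>k. \<forall>x. mem x t \<longleftrightarrow> x \<in> A"
proof -
  define m where "m = Suc (Max (insert k A))"
  have less: "x < m" if "x \<in> insert k A" for x
    unfolding m_def using Max_ge[of "insert k A" x] assms that by (simp only: less_Suc_eq_le finite_insert)
  define b :: nat where "b = fact m"
  define a where "a = (\<Prod>y\<in>A. Suc (Suc y * b))"
  have *: "Suc (Suc x * b) dvd a \<longleftrightarrow> x \<in> A" if x: "x < m" for x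
  proof
    assume d: "Suc (Suc x * b) dvd a"
    show "x \<in> A"
    proof (rule ccontr)
      assume "x \<notin> A"
      then have "coprime (Suc (Suc x * b)) a"
        unfolding a_def b_def using coprime_code[OF x] less
        by (intro prod_coprime_right) (metis insertI2)
      then have "is_unit (Suc (Suc x * b))"
        using d by (meson coprime_common_divisor dvd_refl)
      then have "b = 0" by simp
      then show False by (simp add: b_def)
    qed
  next
    assume "x \<in> A"
    then show "Suc (Suc x * b) dvd a" unfolding a_def using assms by (rule dvd_prodI[rotated])
  qed
  show ?thesis
  proof (intro exI conjI allI)
    show "k \<le> prod_encode (m, prod_encode (a, b))"
      using le_prod_encode_1[of m "prod_encode (a, b)"] less[of k] by simp
    show "mem x (prod_encode (m, prod_encode (a, b))) \<longleftrightarrow> x \<in> A" for x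
      unfolding mem_iff using * less by (auto simp: prod_encode_eq)
  qed
qed

lemma arith_mem:
  assumes "gfn f" "gfn g" shows "arith (\<lambda>e. mem (f e) (g e))"
  unfolding mem_def by (intro arith_intros gfn_shift assms)

section \<open>Ultrafilters\<close>

text \<open>Zorn's lemma gives a minimal proper filter below \<open>sequentially\<close>. If
  \<open>P\<close> does not hold eventually, restricting to the complement of \<open>P\<close>
  leaves a proper filter, which by minimality is the same one.\<close>

lemma ultrafilter_exists:
  "\<exists>F. F \<noteq> bot \<and> F \<le> (sequentially :: nat filter) \<and>
     (\<forall>P. eventually P F \<or> eventually (\<lambda>n. \<not> P n) F)"
proof -
  let ?A = "{F :: nat filter. F \<noteq> bot \<and> F \<le> sequentially}"
  have "\<exists>m\<in>?A. \<forall>x\<in>?A. (\<lambda>x y. x \<ge> y) m x \<longrightarrow> x = m"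
  proof (rule predicate_Zorn)
    show "partial_order_on ?A (relation_of (\<lambda>x y. x \<ge> y) ?A)"
      by (rule partial_order_on_relation_ofI) auto
    fix C assume C: "C \<in> Chains (relation_of (\<lambda>x y. x \<ge> y) ?A)"
    then have CA: "C \<subseteq> ?A" and chain: "\<And>x y. x \<in> C \<Longrightarrow> y \<in> C \<Longrightarrow> x \<le> y \<or> y \<le> x"
      by (auto simp: Chains_def relation_of_def)
    show "\<exists>u\<in>?A. \<forall>a\<in>C. a \<ge> u"
    proof (cases "C = {}")
      case True
      then show ?thesis by (intro bexI[of _ sequentially]) auto
    next
      case False
      have "Inf C \<noteq> bot"
      proof
        assume "Inf C = bot"
        then have "eventually (\<lambda>_. False) (Inf C)" by simp
        then obtain F where "F \<in> C" "eventually (\<lambda>_. False) F"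
          by (subst (asm) eventually_Inf_base[OF False]) (use chain in \<open>force intro: le_infI\<close>)+
        then show False using CA by (auto simp: eventually_False)
      qed
      moreover have "Inf C \<le> sequentially"
      proof -
        obtain F where F: "F \<in> C" using False by blast
        then have "Inf C \<le> F" by (rule Inf_lower)
        also have "F \<le> sequentially" using F CA by blast
        finally show ?thesis .
      qed
      ultimately show ?thesis by (intro bexI[of _ "Inf C"]) (auto intro: Inf_lower)
    qed
  qed
  then obtain F where F: "F \<noteq> bot" "F \<le> sequentially"
    and min: "\<And>G. G \<noteq> bot \<Longrightarrow> G \<le> sequentially \<Longrightarrow> G \<le> F \<Longrightarrow> G = F" by blast
  have "eventually P F \<or> eventually (\<lambda>n. \<not> P n) F" for P
  proof (cases "inf F (principal {n. \<not> P n}) = bot")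
    case True
    then have "eventually (\<lambda>_. False) (inf F (principal {n. \<not> P n}))" by simp
    then show ?thesis by (simp add: eventually_inf_principal)
  next
    case False
    then have "inf F (principal {n. \<not> P n}) = F"
      using F by (intro min) (auto intro: le_infI1)
    moreover have "eventually (\<lambda>n. \<not> P n) (inf F (principal {n. \<not> P n}))"
      by (simp add: eventually_inf_principal)
    ultimately have "eventually (\<lambda>n. \<not> P n) F"
      by simp
    then show ?thesis ..
  qed
  then show ?thesis using F by blast
qed

definition ultra :: "nat filter" where
  "ultra = (SOME F. F \<noteq> bot \<and> F \<le> sequentially \<and>
     (\<forall>P. eventually P F \<or> eventually (\<lambda>n. \<not> P n) F))"

lemma ultra: "ultra \<noteq> bot" "ultra \<le> sequentially"
  "eventually P ultra \<or> eventually (\<lambda>n. \<not> P n) ultra"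
  using someI_ex[OF ultrafilter_exists] unfolding ultra_def by blast+

lemma ultra_not: "eventually (\<lambda>n. \<not> P n) ultra \<longleftrightarrow> \<not> eventually P ultra"
proof
  assume "eventually (\<lambda>n. \<not> P n) ultra"
  then show "\<not> eventually P ultra"
    using ultra(1) eventually_conj[of "\<lambda>n. \<not> P n" ultra P] eventually_False[of ultra] by auto
qed (use ultra(3) in blast)

lemma ultra_imp:
  "eventually (\<lambda>n. P n \<longrightarrow> Q n) ultra \<longleftrightarrow> (eventually P ultra \<longrightarrow> eventually Q ultra)"
proof
  assume "eventually (\<lambda>n. P n \<longrightarrow> Q n) ultra"
  then show "eventually P ultra \<longrightarrow> eventually Q ultra" using eventually_mp by blast
next
  assume "eventually P ultra \<longrightarrow> eventually Q ultra"
  then consider "eventually (\<lambda>n. \<not> P n) ultra" | "eventually Q ultra" by (auto simp: ultra_not)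
  then show "eventually (\<lambda>n. P n \<longrightarrow> Q n) ultra"
    by cases (auto elim: eventually_mono)
qed

lemma ultra_conj:
  "eventually (\<lambda>n. P n \<and> Q n) ultra \<longleftrightarrow> eventually P ultra \<and> eventually Q ultra"
  by (rule eventually_conj_iff)

lemma ultra_iff:
  "eventually (\<lambda>n. P n \<longleftrightarrow> Q n) ultra \<longleftrightarrow> (eventually P ultra \<longleftrightarrow> eventually Q ultra)"
  by (simp add: iff_conv_conj_imp ultra_conj ultra_imp)

lemma ultra_const: "eventually (\<lambda>n. P) ultra \<longleftrightarrow> P"
  using ultra(1) by (simp add: eventually_const)

lemma eventually_ultra: "(\<And>n. k \<le> n \<Longrightarrow> P n) \<Longrightarrow> eventually P ultra"
  using ultra(2) unfolding le_filter_def eventually_sequentially by blast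

section \<open>Satisfaction diagrams on coded names\<close>

text \<open>Induction appears as the least number principle for counterexamples, because this is
  what a Henkin name for a least counterexample provides. The induction axioms are recovered from it
  later.\<close>

locale pa_lang = pa_minus +
  fixes L :: "psym set"
  assumes lnp: "in_lang L \<phi> \<Longrightarrow> range e \<subseteq> domI M \<Longrightarrow> x \<in> domI M \<Longrightarrow> \<not> sat M (case_nat x e) \<phi> \<Longrightarrow>
    \<exists>x\<in>domI M. \<not> sat M (case_nat x e) \<phi> \<and>
      (\<forall>y\<in>domI M. ltI M y x \<longrightarrow> sat M (case_nat y e) \<phi>)"

lemma pa_lang_Nat: "pa_lang Nat_struct L"
proof unfold_locales
  fix \<phi> e and x :: nat
  assume "\<not> sat Nat_struct (case_nat x e) \<phi>"
  then show "\<exists>x\<in>domI Nat_struct. \<not> sat Nat_struct (case_nat x e) \<phi> \<and>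
      (\<forall>y\<in>domI Nat_struct. ltI Nat_struct y x \<longrightarrow> sat Nat_struct (case_nat y e) \<phi>)"
    using exists_least_iff[of "\<lambda>x. \<not> sat Nat_struct (case_nat x e) \<phi>"] by auto
qed

abbreviation pair :: "nat \<Rightarrow> nat \<Rightarrow> nat" where "pair a b \<equiv> prod_encode (a, b)"

text \<open>This is the step of \<open>list_encode\<close>, with \<open>0\<close> for the empty
  list, so environments are coded lists of names.\<close>

abbreviation cons_code :: "nat \<Rightarrow> nat \<Rightarrow> nat" where "cons_code a e \<equiv> Suc (pair a e)"

abbreviation nNum :: "nat \<Rightarrow> nat" where "nNum x \<equiv> pair 0 x"
abbreviation nPar :: nat where "nPar \<equiv> pair (Suc 0) 0"
abbreviation nAdd :: "nat \<Rightarrow> nat \<Rightarrow> nat" where "nAdd u v \<equiv> pair 2 (pair u v)"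
abbreviation nMul :: "nat \<Rightarrow> nat \<Rightarrow> nat" where "nMul u v \<equiv> pair 3 (pair u v)"
abbreviation nHen :: "nat \<Rightarrow> nat \<Rightarrow> nat" where "nHen p e \<equiv> pair 4 (pair p e)"

abbreviation iEv :: "nat \<Rightarrow> nat \<Rightarrow> nat \<Rightarrow> nat" where "iEv t e w \<equiv> pair 0 (pair t (pair e w))"
abbreviation iSat :: "nat \<Rightarrow> nat \<Rightarrow> nat" where "iSat p e \<equiv> pair 1 (pair p e)"
abbreviation iEq :: "nat \<Rightarrow> nat \<Rightarrow> nat" where "iEq u v \<equiv> pair 2 (pair u v)"
abbreviation iLt :: "nat \<Rightarrow> nat \<Rightarrow> nat" where "iLt u v \<equiv> pair 3 (pair u v)"

text \<open>
  Elements of a model are named by numbers: numerals, one parameter, sums, products, and for a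
  formula code \<open>p\<close> and a coded list \<open>e\<close> of names the least counterexample \<open>nHen p e\<close> to \<open>p\<close> under
  the assignment \<open>e\<close>. A diagram \<open>P\<close> decides the items \<open>iEv t e w\<close> (the term \<open>t\<close> takes the value
  \<open>w\<close> under \<open>e\<close>), \<open>iSat p e\<close>, \<open>iEq u v\<close> and \<open>iLt u v\<close>. Each instance of the condition below
  concerns finitely many items, so it survives passage to an ultrafilter limit, and finite
  fragments of diagrams are arithmetical.
\<close>

definition diagram_at ::
    "(nat \<Rightarrow> bool) \<Rightarrow> nat \<Rightarrow> nat \<Rightarrow> nat \<Rightarrow> nat \<Rightarrow> nat \<Rightarrow> nat \<Rightarrow> bool" where
  "diagram_at P x y z u v e \<longleftrightarrow>
     P (iEq x x) \<and>
     (P (iEq x y) \<and> P (iEq z y) \<longrightarrow> P (iEq x z)) \<and>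
     (P (iEq x y) \<and> P (iEq z u) \<longrightarrow>
        P (iEq (nAdd x z) (nAdd y u)) \<and> P (iEq (nMul x z) (nMul y u)) \<and>
        (P (iLt x z) \<longrightarrow> P (iLt y u))) \<and>
     P (iEq (nNum (Suc x)) (nAdd (nNum x) (nNum 1))) \<and>
     (P (iEv (pair 0 0) (cons_code x e) z) \<longleftrightarrow> P (iEq x z)) \<and>
     (P (iEv (pair 0 (Suc u)) (cons_code x e) z) \<longleftrightarrow> P (iEv (pair 0 u) e z)) \<and>
     (P (iEv (pair 0 u) 0 z) \<longleftrightarrow> P (iEq (nNum 0) z)) \<and>
     (P (iEv (pair 1 0) e z) \<longleftrightarrow> P (iEq (nNum 0) z)) \<and>
     (P (iEv (pair 2 0) e z) \<longleftrightarrow> P (iEq (nNum 1) z)) \<and>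
     (P (iEv x e u) \<and> P (iEv y e v) \<longrightarrow>
        (P (iEv (pair 3 (pair x y)) e z) \<longleftrightarrow> P (iEq (nAdd u v) z)) \<and>
        (P (iEv (pair 4 (pair x y)) e z) \<longleftrightarrow> P (iEq (nMul u v) z)) \<and>
        (P (iSat (pair 0 (pair x y)) e) \<longleftrightarrow> P (iEq u v)) \<and>
        (P (iSat (pair 1 (pair x y)) e) \<longleftrightarrow> P (iLt u v))) \<and>
     \<not> P (iSat (pair 3 0) e) \<and>
     (P (iSat (pair 4 (pair x y)) e) \<longleftrightarrow> (P (iSat x e) \<longrightarrow> P (iSat y e))) \<and>
     (P (iSat (pair 5 x) e) \<longrightarrow> P (iSat x (cons_code u e)) \<and> P (iEq (nHen x e) (nNum 0))) \<and>
     (\<not> P (iSat (pair 5 x) e) \<longrightarrow> \<not> P (iSat x (cons_code (nHen x e) e)) \<and>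
        (P (iLt u (nHen x e)) \<longrightarrow> P (iSat x (cons_code u e)))) \<and>
     (x \<in> gn ` PA_minus \<longrightarrow> P (iSat x e))"

definition diagram :: "(nat \<Rightarrow> bool) \<Rightarrow> bool" where
  "diagram P \<longleftrightarrow> (\<forall>x y z u v e. diagram_at P x y z u v e)"

text \<open>An instance is a propositional combination of decisions of \<open>P\<close>, and an
  ultrafilter commutes with all connectives. No quantifier has to be exchanged with the
  limit.\<close>

lemma diagram_at_limit:
  assumes "\<And>i. P i \<longleftrightarrow> eventually (\<lambda>n. A n i) ultra"
  shows "diagram_at P x y z u v e \<longleftrightarrow> eventually (\<lambda>n. diagram_at (A n) x y z u v e) ultra"
  unfolding diagram_at_def
  by (simp only: assms ultra_conj ultra_imp ultra_iff ultra_not ultra_const)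

subsection \<open>The diagram of a model\<close>

lemma snd_prod_decode_less: "0 < fst (prod_decode n) \<Longrightarrow> snd (prod_decode n) < n"
proof -
  assume h: "0 < fst (prod_decode n)"
  obtain k r where kr: "prod_decode n = (k, r)" by fastforce
  then have n: "n = pair k r" by (metis prod_decode_inverse)
  have "2 * triangle m \<ge> 2 * m" for m by (induction m) auto
  from this[of "k + r"] have "k + r \<le> triangle (k + r)" by simp
  then show ?thesis using h kr unfolding n by (simp add: prod_encode_def)
qed

lemma prod_decode_le: "fst (prod_decode n) \<le> n" "snd (prod_decode n) \<le> n"
  using le_prod_encode_1[of "fst (prod_decode n)" "snd (prod_decode n)"]
    le_prod_encode_2[of "snd (prod_decode n)" "fst (prod_decode n)"] by simp_all

lemma prod_decode_parts_less:
  assumes "prod_decode n = (k, r)" "0 < k" "prod_decode r = (s, t)"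
  shows "s < n" "t < n"
  using snd_prod_decode_less[of n] prod_decode_le[of r] assms by auto

lemma list_decode_le: "a \<in> set (list_decode n) \<Longrightarrow> a \<le> n"
proof -
  have "a \<in> set l \<Longrightarrow> a \<le> list_encode l" for l
  proof (induction l)
    case (Cons b l)
    then show ?case
      using le_prod_encode_1[of b "list_encode l"] le_prod_encode_2[of "list_encode l" b] by auto
  qed simp
  from this[of "list_decode n"] show "a \<in> set (list_decode n) \<Longrightarrow> a \<le> n" by simp
qed

text \<open>The diagram conditions range over all numbers, so decoding must be total; numbers that
  code nothing are read as some term.\<close>

function dtm :: "nat \<Rightarrow> tm" where
  "dtm n = (case prod_decode n of (k, r) \<Rightarrow>
     if k = 0 then Var r else if k = 1 then Zero else if k = 2 then One
     else case prod_decode r of (s, t) \<Rightarrow>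
       if k = 3 then Add (dtm s) (dtm t) else Mul (dtm s) (dtm t))"
  by pat_completeness auto
termination
  by (relation "measure id") (auto dest: prod_decode_parts_less[OF sym _ sym])

text \<open>Codes of atoms in the fresh predicates, like numbers that code no formula, become
  \<open>Falsum\<close>, so every decoded formula is arithmetical.\<close>

function dfm :: "nat \<Rightarrow> fm" where
  "dfm n = (case prod_decode n of (k, r) \<Rightarrow>
     if k = 5 then Forall (dfm r)
     else if k = 4 then (case prod_decode r of (s, t) \<Rightarrow> Imp (dfm s) (dfm t))
     else if k = 0 then (case prod_decode r of (s, t) \<Rightarrow> Eq (dtm s) (dtm t))
     else if k = 1 then (case prod_decode r of (s, t) \<Rightarrow> Lt (dtm s) (dtm t))
     else Falsum)"
  by pat_completeness auto
termination
  apply (relation "measure id")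
     apply simp
    apply (metis in_measure id_apply fst_conv snd_conv snd_prod_decode_less zero_less_numeral)
   apply (auto dest: prod_decode_parts_less[OF sym _ sym])
  done

declare dtm.simps [simp del] dfm.simps [simp del]

lemma dtm_simps [simp]:
  "dtm (pair 0 i) = Var i" "dtm (pair 1 i) = Zero" "dtm (pair (Suc 0) i) = Zero"
  "dtm (pair 2 i) = One"
  "dtm (pair 3 (pair s t)) = Add (dtm s) (dtm t)" "dtm (pair 4 (pair s t)) = Mul (dtm s) (dtm t)"
  by (subst dtm.simps, simp)+

lemma dfm_simps [simp]:
  "dfm (pair 0 (pair s t)) = Eq (dtm s) (dtm t)" "dfm (pair 1 (pair s t)) = Lt (dtm s) (dtm t)"
  "dfm (pair (Suc 0) (pair s t)) = Lt (dtm s) (dtm t)"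
  "dfm (pair 3 i) = Falsum" "dfm (pair 4 (pair p r)) = Imp (dfm p) (dfm r)"
  "dfm (pair 5 p) = Forall (dfm p)"
  by (subst dfm.simps, simp)+

lemma dtm_gn [simp]: "dtm (gn_tm t) = t"
  by (induction t) auto

lemma dfm_gn [simp]: "arithmetical \<phi> \<Longrightarrow> dfm (gn \<phi>) = \<phi>"
  by (induction \<phi>) auto

lemma arithmetical_dfm [simp]: "arithmetical (dfm n)"
proof (induction n rule: dfm.induct)
  case (1 n)
  then show ?case by (subst dfm.simps) (auto split: prod.split)
qed

lemma gn_inj: "arithmetical \<phi> \<Longrightarrow> arithmetical \<psi> \<Longrightarrow> gn \<phi> = gn \<psi> \<Longrightarrow> \<phi> = \<psi>"
  by (metis dfm_gn)

text \<open>The default \<open>z\<close> for variables beyond the list will be zero, in agreement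
  with the diagram's clause for variables in the empty environment.\<close>

primrec list_env :: "'a \<Rightarrow> 'a list \<Rightarrow> nat \<Rightarrow> 'a" where
  "list_env z [] = (\<lambda>_. z)"
| "list_env z (a # l) = case_nat a (list_env z l)"

text \<open>The value zero in the absence of a counterexample is not arbitrary: it matches the
  diagram's condition on \<open>nHen\<close>, which keeps every Henkin name definable in both
  cases.\<close>

definition least_cex :: "'a fo_struct \<Rightarrow> fm \<Rightarrow> (nat \<Rightarrow> 'a) \<Rightarrow> 'a" where
  "least_cex M \<phi> e = (if \<exists>x\<in>domI M. \<not> sat M (case_nat x e) \<phi>
     then SOME x. x \<in> domI M \<and> \<not> sat M (case_nat x e) \<phi> \<and>
       (\<forall>y\<in>domI M. ltI M y x \<longrightarrow> sat M (case_nat y e) \<phi>)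
     else zeroI M)"

function val :: "'a fo_struct \<Rightarrow> 'a \<Rightarrow> nat \<Rightarrow> 'a" where
  "val M p n = (case prod_decode n of (k, r) \<Rightarrow>
     if k = 0 then num M r else if k = 1 then p
     else case prod_decode r of (u, v) \<Rightarrow>
       if k = 2 then addI M (val M p u) (val M p v)
       else if k = 3 then mulI M (val M p u) (val M p v)
       else least_cex M (dfm u) (list_env (zeroI M) (map (val M p) (list_decode v))))"
  by pat_completeness auto
termination
  by (relation "measure (\<lambda>(M, p, n). n)")
     (auto dest: prod_decode_parts_less[OF sym _ sym] list_decode_le intro: le_less_trans)

declare val.simps [simp del]

definition val_env :: "'a fo_struct \<Rightarrow> 'a \<Rightarrow> nat \<Rightarrow> nat \<Rightarrow> 'a" where
  "val_env M p e = list_env (zeroI M) (map (val M p) (list_decode e))"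

lemma val_simps [simp]:
  "val M p (pair 0 x) = num M x" "val M p (pair (Suc 0) x) = p"
  "val M p (pair 2 (pair u v)) = addI M (val M p u) (val M p v)"
  "val M p (pair 3 (pair u v)) = mulI M (val M p u) (val M p v)"
  "val M p (pair 4 (pair u v)) = least_cex M (dfm u) (val_env M p v)"
  by (subst val.simps, simp add: val_env_def)+

lemma val_env_simps [simp]:
  "val_env M p 0 = (\<lambda>_. zeroI M)"
  "val_env M p (cons_code a e) = case_nat (val M p a) (val_env M p e)"
  by (simp_all add: val_env_def)

definition diag :: "'a fo_struct \<Rightarrow> 'a \<Rightarrow> nat \<Rightarrow> bool" where
  "diag M p n = (case prod_decode n of (k, r) \<Rightarrow> case prod_decode r of (a, b) \<Rightarrow>
     if k = 0 then (case prod_decode b of (e, w) \<Rightarrow> eval M (val_env M p e) (dtm a) = val M p w)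
     else if k = 1 then sat M (val_env M p b) (dfm a)
     else if k = 2 then val M p a = val M p b
     else ltI M (val M p a) (val M p b))"

lemma diag_simps [simp]:
  "diag M p (iEv t e w) \<longleftrightarrow> eval M (val_env M p e) (dtm t) = val M p w"
  "diag M p (pair (Suc 0) (pair a e)) \<longleftrightarrow> sat M (val_env M p e) (dfm a)"
  "diag M p (iEq u v) \<longleftrightarrow> val M p u = val M p v"
  "diag M p (iLt u v) \<longleftrightarrow> ltI M (val M p u) (val M p v)"
  by (simp_all add: diag_def)

lemma range_list_env: "range (list_env z l) \<subseteq> A \<longleftrightarrow> z \<in> A \<and> set l \<subseteq> A"
  by (induction l) (auto simp: range_case_nat)

lemma arithmetical_PA_minus: "\<phi> \<in> PA_minus \<Longrightarrow> arithmetical \<phi>"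
  unfolding PA_minus_def Let_def by auto

lemma sentence_PA_minus: "\<phi> \<in> PA_minus \<Longrightarrow> sentence \<phi>"
  unfolding PA_minus_def Let_def by (auto simp: eval_nat_numeral)

context pa_lang
begin

lemma least_cex_in [simp]: "range e \<subseteq> domI M \<Longrightarrow> in_lang L \<phi> \<Longrightarrow> least_cex M \<phi> e \<in> domI M"
  and least_cex: "range e \<subseteq> domI M \<Longrightarrow> in_lang L \<phi> \<Longrightarrow> \<not> sat M e (Forall \<phi>) \<Longrightarrow>
    \<not> sat M (case_nat (least_cex M \<phi> e) e) \<phi> \<and>
    (\<forall>y\<in>domI M. ltI M y (least_cex M \<phi> e) \<longrightarrow> sat M (case_nat y e) \<phi>)"
proof -
  assume e: "range e \<subseteq> domI M" and \<phi>: "in_lang L \<phi>"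
  let ?Q = "\<lambda>x. x \<in> domI M \<and> \<not> sat M (case_nat x e) \<phi> \<and>
    (\<forall>y\<in>domI M. ltI M y x \<longrightarrow> sat M (case_nat y e) \<phi>)"
  have *: "?Q (least_cex M \<phi> e)" if ex: "\<exists>x\<in>domI M. \<not> sat M (case_nat x e) \<phi>"
  proof -
    have "\<exists>x. ?Q x" using lnp[OF \<phi> e] ex by blast
    then have "?Q (SOME x. ?Q x)" by (rule someI_ex)
    then show ?thesis using ex by (simp add: least_cex_def)
  qed
  then show "least_cex M \<phi> e \<in> domI M"
    by (cases "\<exists>x\<in>domI M. \<not> sat M (case_nat x e) \<phi>") (simp_all add: least_cex_def)
  show "\<not> sat M (case_nat (least_cex M \<phi> e) e) \<phi> \<and>
    (\<forall>y\<in>domI M. ltI M y (least_cex M \<phi> e) \<longrightarrow> sat M (case_nat y e) \<phi>)" if "\<not> sat M e (Forall \<phi>)"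
    using * that by simp
qed

end

context pa_minus
begin

lemma val_in [simp]:
  assumes "pa_lang M {}" "p \<in> domI M"
  shows "val M p n \<in> domI M"
proof (induction n rule: less_induct)
  case (less n)
  interpret pa_lang M "{}" by fact
  obtain k r where kr: "prod_decode n = (k, r)" by fastforce
  obtain u v where uv: "prod_decode r = (u, v)" by fastforce
  show ?case
  proof (cases "k = 0 \<or> k = 1")
    case True
    then show ?thesis using kr assms(2) by (subst val.simps) auto
  next
    case False
    then have "u < n" "v < n" using prod_decode_parts_less[OF kr _ uv] by auto
    moreover have "range (list_env (zeroI M) (map (val M p) (list_decode v))) \<subseteq> domI M"
      using less.IH \<open>v < n\<close> list_decode_le unfolding range_list_env by fastforce
    ultimately show ?thesis
      using kr uv False less.IH by (subst val.simps) auto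
  qed
qed

lemma val_env_in: "pa_lang M {} \<Longrightarrow> p \<in> domI M \<Longrightarrow> range (val_env M p e) \<subseteq> domI M"
  by (auto simp: val_env_def range_list_env)

end

text \<open>The conditions are Tarski's clauses for terms and formulas; those on \<open>nHen\<close>
  are instances of the least number principle.\<close>

lemma (in pa_lang) diagram_diag:
  assumes "L = {}" "p \<in> domI M"
  shows "diagram (diag M p)"
proof -
  have pa: "pa_lang M {}" using pa_lang_axioms assms(1) by simp
  have in_dom: "val M p n \<in> domI M" and env: "range (val_env M p e) \<subseteq> domI M" for n e
    using val_in[OF pa assms(2)] val_env_in[OF pa assms(2)] by auto
  have ax: "diag M p (iSat x e)" if x: "x \<in> gn ` PA_minus" for x e
  proof -
    obtain \<phi> where "\<phi> \<in> PA_minus" "x = gn \<phi>" using x by blast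
    then have "dfm x = \<phi>" by (simp add: arithmetical_PA_minus)
    then show ?thesis using base env \<open>\<phi> \<in> PA_minus\<close> by (simp add: models_def)
  qed
  have all: "diag M p (iSat (pair 5 x) e) \<Longrightarrow> diag M p (iSat x (cons_code u e))"
    "diag M p (iSat (pair 5 x) e) \<Longrightarrow> diag M p (iEq (nHen x e) (nNum 0))"
    for x u e
    using in_dom by (simp_all add: least_cex_def)
  have ex: "\<not> diag M p (iSat x (cons_code (nHen x e) e))"
    "diag M p (iLt u (nHen x e)) \<Longrightarrow> diag M p (iSat x (cons_code u e))"
    if "\<not> diag M p (iSat (pair 5 x) e)" for x u e
    using least_cex[OF env, of "dfm x" e] that in_dom[of u] assms(1) by simp_all
  have one: "addI M (zeroI M) (oneI M) = oneI M"
    using num_1 by simp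
  show ?thesis
    unfolding diagram_def
  proof (intro allI)
    fix x y z u v e
    show "diagram_at (diag M p) x y z u v e"
      unfolding diagram_at_def
      by (intro conjI impI; (erule ax all ex, assumption?; fail | simp add: one)?)
  qed
qed

subsection \<open>The model of a diagram\<close>

text \<open>The diagram decides items about all numbers, but only these become elements: for them
  Henkin names carry genuine formula codes and lists of names, so that each one can be shown
  definable from the parameter.\<close>

inductive_set names :: "nat set" where
  names_Num: "nNum x \<in> names"
| names_Par: "nPar \<in> names"
| names_Add: "u \<in> names \<Longrightarrow> v \<in> names \<Longrightarrow> nAdd u v \<in> names"
| names_Mul: "u \<in> names \<Longrightarrow> v \<in> names \<Longrightarrow> nMul u v \<in> names"
| names_Hen: "arithmetical \<phi> \<Longrightarrow> (\<forall>a\<in>set l. a \<in> names) \<Longrightarrow> nHen (gn \<phi>) (list_encode l) \<in> names"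

text \<open>The map \<open>q\<close> realises the quotient of the names by provable equality
  \<open>iEq\<close> inside the given type.\<close>

locale diagram_model =
  fixes P :: "nat \<Rightarrow> bool" and q :: "nat \<Rightarrow> 'a"
  assumes diagram: "diagram P"
    and q_iff: "q u = q v \<longleftrightarrow> P (iEq u v)"
begin

definition sel :: "'a \<Rightarrow> nat" where
  "sel x = (SOME u. q u = x)"

definition dm :: "'a fo_struct" where
  "dm = \<lparr>domI = q ` names, zeroI = q (nNum 0), oneI = q (nNum 1),
     addI = \<lambda>x y. q (nAdd (sel x) (sel y)), mulI = \<lambda>x y. q (nMul (sel x) (sel y)),
     ltI = \<lambda>x y. P (iLt (sel x) (sel y)), relI = \<lambda>_ _. False\<rparr>"

lemma dm_simps [simp]:
  "domI dm = q ` names" "zeroI dm = q (nNum 0)" "oneI dm = q (nNum 1)"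
  by (simp_all add: dm_def)

lemma q_sel [simp]: "q (sel (q u)) = q u"
  unfolding sel_def by (rule someI[of _ u]) simp

lemma P_refl [simp]: "P (iEq u u)"
  using q_iff[of u u] by simp

lemma cong:
  assumes "q x = q y" "q z = q u"
  shows "q (nAdd x z) = q (nAdd y u)" "q (nMul x z) = q (nMul y u)" "P (iLt x z) \<longleftrightarrow> P (iLt y u)"
proof -
  have *: "P (iEq (nAdd x z) (nAdd y u)) \<and> P (iEq (nMul x z) (nMul y u)) \<and> (P (iLt x z) \<longrightarrow> P (iLt y u))"
    if "q x = q y" "q z = q u" for x y z u
    using diagram that unfolding diagram_def diagram_at_def q_iff by (elim allE conjE) blast
  show "q (nAdd x z) = q (nAdd y u)" "q (nMul x z) = q (nMul y u)" "P (iLt x z) \<longleftrightarrow> P (iLt y u)"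
    using *[of x y z u] *[of y x u z] assms unfolding q_iff[symmetric] by auto
qed

lemma add_q [simp]: "addI dm (q u) (q v) = q (nAdd u v)"
  and mul_q [simp]: "mulI dm (q u) (q v) = q (nMul u v)"
  and lt_q [simp]: "ltI dm (q u) (q v) \<longleftrightarrow> P (iLt u v)"
  unfolding dm_def by (simp_all add: cong[of "sel (q u)" u "sel (q v)" v])

lemma struct_dm: "is_struct dm"
  by (auto simp: is_struct_def intro: names.intros)

lemma num_dm [simp]: "num dm x = q (nNum x)"
proof (induction x)
  case (Suc x)
  have "q (nNum (Suc x)) = q (nAdd (nNum x) (nNum 1))"
    using diagram unfolding diagram_def diagram_at_def q_iff by (elim allE conjE)
  then show ?case using Suc by simp
qed simp

abbreviation genv :: "nat list \<Rightarrow> nat \<Rightarrow> 'a" where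
  "genv l \<equiv> list_env (q (nNum 0)) (map q l)"

lemma genv_q: "\<exists>u. genv l i = q u"
  by (induction l arbitrary: i) (auto split: nat.split)

lemma eval_genv_q: "\<exists>u. eval dm (genv l) t = q u"
proof (induction t)
  case (Add s t)
  then obtain u v where "eval dm (genv l) s = q u" "eval dm (genv l) t = q v" by blast
  then show ?case by (intro exI[of _ "nAdd u v"]) simp
next
  case (Mul s t)
  then obtain u v where "eval dm (genv l) s = q u" "eval dm (genv l) t = q v" by blast
  then show ?case by (intro exI[of _ "nMul u v"]) simp
qed (auto simp: genv_q)

lemma eval_iff: "eval dm (genv l) t = q w \<longleftrightarrow> P (iEv (gn_tm t) (list_encode l) w)"
proof (induction t arbitrary: w)
  case (Var i)
  show ?case
  proof (induction l arbitrary: i)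
    case Nil
    have "P (iEv (pair 0 i) 0 w) \<longleftrightarrow> P (iEq (nNum 0) w)"
      using diagram unfolding diagram_def diagram_at_def by (elim allE conjE)
    then show ?case by (simp add: q_iff)
  next
    case (Cons a l)
    have "P (iEv (pair 0 0) (cons_code a (list_encode l)) w) \<longleftrightarrow> P (iEq a w)"
      using diagram unfolding diagram_def diagram_at_def by (elim allE conjE)
    moreover have "P (iEv (pair 0 (Suc j)) (cons_code a (list_encode l)) w) \<longleftrightarrow>
        P (iEv (pair 0 j) (list_encode l) w)" for j
      using diagram unfolding diagram_def diagram_at_def by (elim allE conjE)
    ultimately show ?case using Cons by (cases i) (auto simp: q_iff)
  qed
next
  case Zero
  have "P (iEv (pair 1 0) (list_encode l) w) \<longleftrightarrow> P (iEq (nNum 0) w)"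
    using diagram unfolding diagram_def diagram_at_def by (elim allE conjE)
  then show ?case by (simp add: q_iff)
next
  case One
  have "P (iEv (pair 2 0) (list_encode l) w) \<longleftrightarrow> P (iEq (nNum 1) w)"
    using diagram unfolding diagram_def diagram_at_def by (elim allE conjE)
  then show ?case by (simp add: q_iff)
next
  case (Add s t)
  obtain u v where uv: "eval dm (genv l) s = q u" "eval dm (genv l) t = q v"
    using eval_genv_q by meson
  have "P (iEv (gn_tm s) (list_encode l) u) \<and> P (iEv (gn_tm t) (list_encode l) v) \<longrightarrow>
      (P (iEv (pair 3 (pair (gn_tm s) (gn_tm t))) (list_encode l) w) \<longleftrightarrow> P (iEq (nAdd u v) w))"
    using diagram unfolding diagram_def diagram_at_def by meson
  then show ?case using Add.IH(1)[of u] Add.IH(2)[of v] uv by (simp add: q_iff)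
next
  case (Mul s t)
  obtain u v where uv: "eval dm (genv l) s = q u" "eval dm (genv l) t = q v"
    using eval_genv_q by meson
  have "P (iEv (gn_tm s) (list_encode l) u) \<and> P (iEv (gn_tm t) (list_encode l) v) \<longrightarrow>
      (P (iEv (pair 4 (pair (gn_tm s) (gn_tm t))) (list_encode l) w) \<longleftrightarrow> P (iEq (nMul u v) w))"
    using diagram unfolding diagram_def diagram_at_def by meson
  then show ?case using Mul.IH(1)[of u] Mul.IH(2)[of v] uv by (simp add: q_iff)
qed

text \<open>The truth lemma of a Henkin construction. If the diagram rejects a universal formula, it
  rejects the instance at \<open>nHen\<close>, which is an element because the environment consists
  of names.\<close>

lemma sat_iff:
  assumes "arithmetical \<phi>" "set l \<subseteq> names"
  shows "sat dm (genv l) \<phi> \<longleftrightarrow> P (iSat (gn \<phi>) (list_encode l))"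
  using assms
proof (induction \<phi> arbitrary: l)
  case (Eq s t)
  obtain u v where uv: "eval dm (genv l) s = q u" "eval dm (genv l) t = q v"
    using eval_genv_q by meson
  have "P (iEv (gn_tm s) (list_encode l) u) \<and> P (iEv (gn_tm t) (list_encode l) v) \<longrightarrow>
      (P (iSat (pair 0 (pair (gn_tm s) (gn_tm t))) (list_encode l)) \<longleftrightarrow> P (iEq u v))"
    using diagram unfolding diagram_def diagram_at_def by meson
  then show ?case using uv eval_iff[of l s u] eval_iff[of l t v] by (simp add: q_iff)
next
  case (Lt s t)
  obtain u v where uv: "eval dm (genv l) s = q u" "eval dm (genv l) t = q v"
    using eval_genv_q by meson
  have "P (iEv (gn_tm s) (list_encode l) u) \<and> P (iEv (gn_tm t) (list_encode l) v) \<longrightarrow>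
      (P (iSat (pair 1 (pair (gn_tm s) (gn_tm t))) (list_encode l)) \<longleftrightarrow> P (iLt u v))"
    using diagram unfolding diagram_def diagram_at_def by meson
  then show ?case using uv eval_iff[of l s u] eval_iff[of l t v] by simp
next
  case Falsum
  have "\<not> P (iSat (pair 3 0) (list_encode l))"
    using diagram unfolding diagram_def diagram_at_def by (elim allE conjE)
  then show ?case by simp
next
  case (Imp \<phi> \<psi>)
  have "P (iSat (pair 4 (pair (gn \<phi>) (gn \<psi>))) (list_encode l)) \<longleftrightarrow>
      (P (iSat (gn \<phi>) (list_encode l)) \<longrightarrow> P (iSat (gn \<psi>) (list_encode l)))"
    using diagram unfolding diagram_def diagram_at_def by meson
  then show ?case using Imp by simp
next
  case (Forall \<phi>)
  let ?e = "list_encode l" let ?h = "nHen (gn \<phi>) ?e"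
  have h: "?h \<in> names" using Forall.prems by (intro names_Hen) auto
  have 1: "P (iSat (pair 5 (gn \<phi>)) ?e) \<Longrightarrow> P (iSat (gn \<phi>) (cons_code a ?e))" for a
    using diagram unfolding diagram_def diagram_at_def by meson
  have 2: "\<not> P (iSat (pair 5 (gn \<phi>)) ?e) \<Longrightarrow> \<not> P (iSat (gn \<phi>) (cons_code ?h ?e))"
    using diagram unfolding diagram_def diagram_at_def by meson
  have 3: "sat dm (case_nat (q a) (genv l)) \<phi> \<longleftrightarrow> P (iSat (gn \<phi>) (cons_code a ?e))" if "a \<in> names" for a
    using Forall.IH[of "a # l"] Forall.prems that by simp
  show ?case using 1 2 3 h by auto
qed simp

lemma sat_param:
  assumes "arithmetical \<phi>"
  shows "sat dm (case_nat (q nPar) (\<lambda>_. q (nNum 0))) \<phi> \<longleftrightarrow> P (iSat (gn \<phi>) (cons_code nPar 0))"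
  using sat_iff[OF assms, of "[nPar]"] names_Par by simp

lemma counterexample:
  assumes "arithmetical \<phi>" "set l \<subseteq> names" "\<not> sat dm (genv l) (Forall \<phi>)"
  shows "\<not> sat dm (case_nat (q (nHen (gn \<phi>) (list_encode l))) (genv l)) \<phi>"
    and "y \<in> domI dm \<Longrightarrow> ltI dm y (q (nHen (gn \<phi>) (list_encode l))) \<Longrightarrow> sat dm (case_nat y (genv l)) \<phi>"
proof -
  let ?e = "list_encode l" let ?h = "nHen (gn \<phi>) ?e"
  have h: "?h \<in> names" using assms by (intro names_Hen) auto
  have no: "\<not> P (iSat (pair 5 (gn \<phi>)) ?e)"
    using assms sat_iff[of "Forall \<phi>" l] by auto
  then have 1: "\<not> P (iSat (gn \<phi>) (cons_code ?h ?e))"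
    and 2: "P (iLt a ?h) \<Longrightarrow> P (iSat (gn \<phi>) (cons_code a ?e))" for a
    using diagram unfolding diagram_def diagram_at_def by meson+
  have 3: "sat dm (case_nat (q a) (genv l)) \<phi> \<longleftrightarrow> P (iSat (gn \<phi>) (cons_code a ?e))" if "a \<in> names" for a
    using sat_iff[of \<phi> "a # l"] assms that by simp
  show "\<not> sat dm (case_nat (q ?h) (genv l)) \<phi>" using 1 3 h by simp
  show "sat dm (case_nat y (genv l)) \<phi>" if "y \<in> domI dm" "ltI dm y (q ?h)"
    using that 2 3 by auto
qed

lemma genv_agrees:
  assumes "range e \<subseteq> domI dm"
  shows "\<exists>l. set l \<subseteq> names \<and> (\<forall>i<n. genv l i = e i)"
proof -
  have "\<exists>a\<in>names. q a = e i" for i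
    using assms by (metis dm_simps(1) imageE rangeI subsetD)
  then obtain f where f: "\<And>i. f i \<in> names" "\<And>i. q (f i) = e i" by metis
  have *: "list_env z (map g [k..<k + n]) i = g (k + i)" if "i < n"
    for z :: 'a and g and k i n :: nat
    using that
  proof (induction n arbitrary: k i)
    case (Suc n)
    then show ?case
      by (cases i) (use Suc.IH[of _ "Suc k"] in \<open>auto simp: upt_rec[of k] simp del: upt_Suc\<close>)
  qed simp
  show ?thesis
    using f *[where g = "\<lambda>i. q (f i)" and k = 0 and n = n] by (intro exI[of _ "map f [0..<n]"]) (auto simp: comp_def)
qed

text \<open>The diagram asserts only the base axioms. The least number principle comes from the
  Henkin names, once an assignment is replaced by a finite list of names agreeing with it on the
  free variables.\<close>

lemma pa_lang_dm: "pa_lang dm {}"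
proof unfold_locales
  show "is_struct dm" by (rule struct_dm)
  show "models dm PA_minus"
    unfolding models_def
  proof (intro ballI allI impI)
    fix \<phi> and e :: "nat \<Rightarrow> 'a" assume \<phi>: "\<phi> \<in> PA_minus"
    then have "P (iSat (gn \<phi>) (list_encode []))"
      using diagram unfolding diagram_def diagram_at_def by blast
    then have "sat dm (genv []) \<phi>"
      using sat_iff[of \<phi> "[]"] arithmetical_PA_minus[OF \<phi>] by simp
    then show "sat dm e \<phi>" using sat_sentence[OF sentence_PA_minus[OF \<phi>]] by metis
  qed
  fix \<phi> e x
  assume \<phi>: "arithmetical \<phi>" and e: "range e \<subseteq> domI dm"
    and x: "x \<in> domI dm" "\<not> sat dm (case_nat x e) \<phi>"
  obtain n where n: "fv \<phi> \<subseteq> {..<n}"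
    using finite_fv[of \<phi>] unfolding finite_nat_set_iff_bounded by auto
  obtain l where l: "set l \<subseteq> names" "\<And>i. i < n \<Longrightarrow> genv l i = e i"
    using genv_agrees[OF e] by meson
  have *: "sat dm (case_nat y e) \<phi> \<longleftrightarrow> sat dm (case_nat y (genv l)) \<phi>" for y
    by (rule sat_cong) (use n l(2) in \<open>fastforce split: nat.split\<close>)
  let ?h = "nHen (gn \<phi>) (list_encode l)"
  have "\<not> sat dm (genv l) (Forall \<phi>)" using x * by auto
  note h = counterexample[OF \<phi> l(1) this]
  have "?h \<in> names" using \<phi> l(1) by (intro names_Hen) auto
  then show "\<exists>x\<in>domI dm. \<not> sat dm (case_nat x e) \<phi> \<and>
      (\<forall>y\<in>domI dm. ltI dm y x \<longrightarrow> sat dm (case_nat y e) \<phi>)"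
    using h unfolding * by (intro bexI[of _ "q ?h"]) auto
qed

sublocale dm: pa_lang dm "{}"
  by (rule pa_lang_dm)

section \<open>Definability of named elements from the parameter\<close>

definition named :: "nat \<Rightarrow> bool" where
  "named w \<longleftrightarrow> (\<exists>\<gamma>. arithmetical \<gamma> \<and> (\<forall>e. range e \<subseteq> domI dm \<longrightarrow> e 1 = q nPar \<longrightarrow>
     (sat dm e \<gamma> \<longleftrightarrow> e 0 = q w)))"

text \<open>Parameters with names are eliminated one by one: each is replaced by a quantified
  variable together with the formula that defines it from \<open>c\<close>.\<close>

lemma named_list:
  assumes "\<forall>a\<in>set l. a \<in> names \<and> named a" "arithmetical \<chi>"
  shows "\<exists>\<chi>'. arithmetical \<chi>' \<and> (\<forall>e. range e \<subseteq> domI dm \<longrightarrow> e 1 = q nPar \<longrightarrow>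
     (sat dm e \<chi>' \<longleftrightarrow> sat dm (case_nat (e 0) (case_nat (q nPar) (genv l))) \<chi>))"
  using assms
proof (induction l arbitrary: \<chi>)
  case Nil
  have "(\<lambda>i. eval dm e (if i < 2 then Var i else Zero)) =
      case_nat (e 0) (case_nat (q nPar) (\<lambda>_. q (nNum 0)))" if "e 1 = q nPar" for e
    using that by (auto simp: fun_eq_iff split: nat.split)
  then show ?case
    using Nil by (intro exI[of _ "subst (\<lambda>i. if i < 2 then Var i else Zero) \<chi>"]) (simp add: sat_subst)
next
  case (Cons a l)
  obtain \<gamma> where \<gamma>: "arithmetical \<gamma>"
    "\<And>e. range e \<subseteq> domI dm \<Longrightarrow> e 1 = q nPar \<Longrightarrow> sat dm e \<gamma> \<longleftrightarrow> e 0 = q a"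
    using Cons.prems unfolding named_def by auto
  \<comment> \<open>Below the quantifier the indices are the value of \<open>a\<close>, then
    \<open>x\<close>, then \<open>c\<close>. The substitutions put the value of \<open>a\<close>
    third, as \<open>\<chi>\<close> expects, and let index \<open>1\<close> of
    \<open>\<gamma>\<close> denote \<open>c\<close>.\<close>
  define \<chi>1 where "\<chi>1 = Exists (And (subst (\<lambda>i. if i = 0 then Var 0 else Var (Suc i)) \<gamma>)
    (subst (\<lambda>i. if i = 0 then Var 1 else if i = 1 then Var 2 else if i = 2 then Var 0 else Var i) \<chi>))"
  have "arithmetical \<chi>1" using \<gamma>(1) Cons.prems by (simp add: \<chi>1_def)
  from Cons.IH[OF _ this] Cons.prems(1) obtain \<chi>' where \<chi>': "arithmetical \<chi>'"
    "\<And>e. range e \<subseteq> domI dm \<Longrightarrow> e 1 = q nPar \<Longrightarrow>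
     sat dm e \<chi>' \<longleftrightarrow> sat dm (case_nat (e 0) (case_nat (q nPar) (genv l))) \<chi>1"
    by auto
  have *: "sat dm (case_nat x (case_nat (q nPar) (genv l))) \<chi>1 \<longleftrightarrow>
      sat dm (case_nat x (case_nat (q nPar) (genv (a # l)))) \<chi>" if x: "x \<in> domI dm" for x
  proof -
    let ?g = "case_nat x (case_nat (q nPar) (genv l))"
    have l: "set (map q l) \<subseteq> domI dm" using Cons.prems by auto
    have g: "range ?g \<subseteq> domI dm"
      using x l by (auto simp: range_case_nat range_list_env intro: names.intros)
    have 1: "sat dm (\<lambda>i. eval dm (case_nat y ?g) (if i = 0 then Var 0 else Var (Suc i))) \<gamma> \<longleftrightarrow> y = q a"
      if "y \<in> domI dm" for y
    proof -
      let ?f = "\<lambda>i. eval dm (case_nat y ?g) (if i = 0 then Var 0 else Var (Suc i))"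
      have "range ?f \<subseteq> domI dm" using g that by (auto simp: image_subset_iff)
      moreover have "?f 1 = q nPar" "?f 0 = y" by simp_all
      ultimately show ?thesis using \<gamma>(2)[of ?f] by simp
    qed
    have 2: "(\<lambda>i. eval dm (case_nat (q a) ?g)
        (if i = 0 then Var 1 else if i = 1 then Var 2 else if i = 2 then Var 0 else Var i)) =
      case_nat x (case_nat (q nPar) (genv (a # l)))"
      by (auto simp: fun_eq_iff eval_nat_numeral split: nat.split)
    have "q a \<in> domI dm" using Cons.prems by simp
    then have "sat dm ?g \<chi>1 \<longleftrightarrow> sat dm (\<lambda>i. eval dm (case_nat (q a) ?g)
        (if i = 0 then Var 1 else if i = 1 then Var 2 else if i = 2 then Var 0 else Var i)) \<chi>"
      unfolding \<chi>1_def sat.simps sat_subst using 1 by blast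
    then show ?thesis unfolding 2 .
  qed
  show ?case
  proof (intro exI[of _ \<chi>'] conjI allI impI)
    fix e :: "nat \<Rightarrow> 'a" assume e: "range e \<subseteq> domI dm" "e 1 = q nPar"
    then have "e 0 \<in> domI dm" by blast
    then show "sat dm e \<chi>' \<longleftrightarrow> sat dm (case_nat (e 0) (case_nat (q nPar) (genv (a # l)))) \<chi>"
      using \<chi>'(2)[OF e] * by simp
  qed (rule \<chi>'(1))
qed

lemma named_add:
  assumes "u \<in> names" "v \<in> names" "named u" "named v"
  shows "named (nAdd u v)" "named (nMul u v)"
proof -
  obtain \<gamma> where \<gamma>: "arithmetical \<gamma>"
    "\<And>e. range e \<subseteq> domI dm \<Longrightarrow> e 1 = q nPar \<Longrightarrow> sat dm e \<gamma> \<longleftrightarrow> e 0 = q u"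
    using assms(3) unfolding named_def by blast
  obtain \<delta> where \<delta>: "arithmetical \<delta>"
    "\<And>e. range e \<subseteq> domI dm \<Longrightarrow> e 1 = q nPar \<Longrightarrow> sat dm e \<delta> \<longleftrightarrow> e 0 = q v"
    using assms(4) unfolding named_def by blast
  define \<chi> where "\<chi> t = Exists (Exists (And (subst (\<lambda>i. Var (if i = 0 then 1 else i + 2)) \<gamma>)
    (And (subst (\<lambda>i. Var (if i = 0 then 0 else i + 2)) \<delta>) (Eq (Var 2) (t (Var 1) (Var 0))))))"
    for t :: "tm \<Rightarrow> tm \<Rightarrow> tm"
  have *: "sat dm e (\<chi> t) \<longleftrightarrow> e 0 = eval dm (case_nat (q v) (case_nat (q u) e)) (t (Var 1) (Var 0))"
    if e: "range e \<subseteq> domI dm" "e 1 = q nPar" for e t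
  proof -
    have 1: "sat dm (\<lambda>i. eval dm (case_nat z (case_nat y e)) (Var (if i = 0 then 1 else i + 2))) \<gamma> \<longleftrightarrow> y = q u"
      (is "sat dm ?f \<gamma> \<longleftrightarrow> _")
      if "y \<in> domI dm" for y z
    proof -
      have "range ?f \<subseteq> domI dm" using e that by (auto simp: image_subset_iff)
      moreover have "?f 1 = q nPar" "?f 0 = y" using e by (simp_all add: eval_nat_numeral)
      ultimately show ?thesis using \<gamma>(2)[of ?f] by simp
    qed
    have 2: "sat dm (\<lambda>i. eval dm (case_nat z (case_nat y e)) (Var (if i = 0 then 0 else i + 2))) \<delta> \<longleftrightarrow> z = q v"
      (is "sat dm ?f \<delta> \<longleftrightarrow> _")
      if "z \<in> domI dm" for y z
    proof -
      have "range ?f \<subseteq> domI dm" using e that by (auto simp: image_subset_iff)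
      moreover have "?f 1 = q nPar" "?f 0 = z" using e by (simp_all add: eval_nat_numeral)
      ultimately show ?thesis using \<delta>(2)[of ?f] by simp
    qed
    have q: "q u \<in> domI dm" "q v \<in> domI dm" using assms by auto
    have "sat dm e (\<chi> t) \<longleftrightarrow> (\<exists>y\<in>domI dm. \<exists>z\<in>domI dm. y = q u \<and> z = q v \<and>
      e 0 = eval dm (case_nat z (case_nat y e)) (t (Var 1) (Var 0)))"
      unfolding \<chi>_def sat.simps sat_subst using 1 2
      by (simp add: eval_nat_numeral del: dm_simps)
    then show ?thesis using q by blast
  qed
  have a: "arithmetical (\<chi> t)" for t using \<gamma> \<delta> by (simp add: \<chi>_def)
  show "named (nAdd u v)"
    unfolding named_def by (intro exI[of _ "\<chi> Add"] conjI allI impI a) (simp add: *)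
  show "named (nMul u v)"
    unfolding named_def by (intro exI[of _ "\<chi> Mul"] conjI allI impI a) (simp add: *)
qed

text \<open>Being the least counterexample is expressible with the environment as parameters,
  starting at index \<open>2\<close> since index \<open>1\<close> is kept for \<open>c\<close>.
  Linearity of the order gives uniqueness, and the parameters are then eliminated by
  \<open>named_list\<close>.\<close>

lemma named_Hen:
  assumes \<phi>: "arithmetical \<phi>" and l: "\<forall>a\<in>set l. a \<in> names \<and> named a"
  shows "named (nHen (gn \<phi>) (list_encode l))"
proof -
  let ?h = "nHen (gn \<phi>) (list_encode l)" and ?L = "\<lambda>e i. e (Suc (Suc i))"
  have l': "set l \<subseteq> names" using l by blast
  have h: "q ?h \<in> domI dm" using \<phi> l by (auto intro!: imageI names_Hen)
  define H where "H e \<longleftrightarrow>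
    (\<not> (\<forall>y\<in>domI dm. sat dm (case_nat y (?L e)) \<phi>) \<and> \<not> sat dm (case_nat (e 0) (?L e)) \<phi> \<and>
      (\<forall>y\<in>domI dm. ltI dm y (e 0) \<longrightarrow> sat dm (case_nat y (?L e)) \<phi>)) \<or>
    ((\<forall>y\<in>domI dm. sat dm (case_nat y (?L e)) \<phi>) \<and> e 0 = zeroI dm)" for e
  have at: "dfn dm {} (\<lambda>e. sat dm (case_nat (e 0) (\<lambda>i. e (i + k))) \<phi>)" for k
  proof -
    have "(\<lambda>i. e (case i of 0 \<Rightarrow> 0 | Suc j \<Rightarrow> j + k)) = case_nat (e 0) (\<lambda>i. e (i + k))" for e :: "nat \<Rightarrow> 'a"
      by (auto split: nat.split)
    then show ?thesis
      using dfn_reindex[OF struct_dm dfn_sat[OF \<phi>], of "case_nat 0 (\<lambda>j. j + k)"] by simp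
  qed
  have "dfn dm {} H"
    unfolding H_def
    by (intro dfn_intros) (use at[of 2] at[of 3] in \<open>simp_all add: eval_nat_numeral del: dm_simps\<close>)
  then obtain \<chi> where \<chi>: "arithmetical \<chi>" "\<And>e. range e \<subseteq> domI dm \<Longrightarrow> sat dm e \<chi> \<longleftrightarrow> H e"
    unfolding dfn_def by blast
  obtain \<chi>' where \<chi>': "arithmetical \<chi>'"
    "\<And>e. range e \<subseteq> domI dm \<Longrightarrow> e 1 = q nPar \<Longrightarrow>
      sat dm e \<chi>' \<longleftrightarrow> sat dm (case_nat (e 0) (case_nat (q nPar) (genv l))) \<chi>"
    using named_list[OF l \<chi>(1)] by blast
  have *: "H (case_nat x (case_nat (q nPar) (genv l))) \<longleftrightarrow> x = q ?h" if x: "x \<in> domI dm" for x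
  proof (cases "sat dm (genv l) (Forall \<phi>)")
    case True
    then have "P (iSat (pair 5 (gn \<phi>)) (list_encode l))"
      using sat_iff[of "Forall \<phi>" l] \<phi> l' by simp
    then have "P (iEq ?h (nNum 0))"
      using diagram unfolding diagram_def diagram_at_def by meson
    then have "q ?h = zeroI dm" by (simp add: q_iff)
    then show ?thesis using True by (simp add: H_def)
  next
    case False
    note c = counterexample[OF \<phi> l' False]
    have "x = q ?h" if "\<not> sat dm (case_nat x (genv l)) \<phi>"
      "\<And>y. y \<in> domI dm \<Longrightarrow> ltI dm y x \<Longrightarrow> sat dm (case_nat y (genv l)) \<phi>"
      using dm.lt_linear[OF x h h] c that x h by blast
    moreover have "H (case_nat x (case_nat (q nPar) (genv l))) \<longleftrightarrow> \<not> sat dm (case_nat x (genv l)) \<phi> \<and>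
      (\<forall>y\<in>domI dm. ltI dm y x \<longrightarrow> sat dm (case_nat y (genv l)) \<phi>)"
      using False by (auto simp add: H_def)
    ultimately show ?thesis using c by blast
  qed
  show ?thesis
    unfolding named_def
  proof (intro exI[of _ \<chi>'] conjI allI impI)
    fix e :: "nat \<Rightarrow> 'a" assume e: "range e \<subseteq> domI dm" "e 1 = q nPar"
    then have e0: "e 0 \<in> domI dm" by blast
    have "range (case_nat (e 0) (case_nat (q nPar) (genv l))) \<subseteq> domI dm"
      using e0 l' names_Num names_Par by (auto simp: range_case_nat range_list_env)
    then show "sat dm e \<chi>' \<longleftrightarrow> e 0 = q ?h"
      using \<chi>'(2)[OF e] \<chi>(2) *[OF e0] by simp
  qed (rule \<chi>'(1))
qed

lemma names_named: "w \<in> names \<Longrightarrow> named w"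
proof (induction rule: names.induct)
  case (names_Num x)
  show ?case
    unfolding named_def
    by (rule exI[of _ "Eq (Var 0) (numeral_tm x)"]) simp
next
  case names_Par
  show ?case
    unfolding named_def by (rule exI[of _ "Eq (Var 0) (Var 1)"]) simp
next
  case (names_Hen \<phi> l)
  then show ?case by (intro named_Hen) auto
qed (auto intro: named_add)

lemma definable:
  assumes "x \<in> domI dm"
  shows "\<exists>\<gamma>. arithmetical \<gamma> \<and> fv \<gamma> \<subseteq> {0, 1} \<and>
    (\<forall>e. range e \<subseteq> domI dm \<longrightarrow> e 1 = q nPar \<longrightarrow> (sat dm e \<gamma> \<longleftrightarrow> e 0 = x))"
proof -
  obtain w where "w \<in> names" "x = q w" using assms by auto
  then obtain \<gamma> where \<gamma>: "arithmetical \<gamma>"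
    "\<And>e. range e \<subseteq> domI dm \<Longrightarrow> e 1 = q nPar \<Longrightarrow> sat dm e \<gamma> \<longleftrightarrow> e 0 = x"
    using names_named unfolding named_def by meson
  \<comment> \<open>Variables other than the value and the parameter are set to zero; by the
    defining property of \<open>\<gamma>\<close> their values are irrelevant.\<close>
  let ?\<sigma> = "\<lambda>i. if i = 0 then Var 0 else if i = 1 then Var 1 else Zero"
  have "fv (subst ?\<sigma> \<gamma>) \<subseteq> {0, 1}" by (auto simp: fv_subst split: if_splits)
  moreover have "sat dm e (subst ?\<sigma> \<gamma>) \<longleftrightarrow> e 0 = x" if "range e \<subseteq> domI dm" "e 1 = q nPar" for e
  proof -
    let ?f = "\<lambda>i. eval dm e (?\<sigma> i)"
    have "range ?f \<subseteq> domI dm" using eval_in_dom[OF struct_dm that(1)] by blast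
    then show ?thesis using \<gamma>(2)[of ?f] that by (simp add: sat_subst)
  qed
  ultimately show ?thesis
    using \<gamma>(1) by (intro exI[of _ "subst ?\<sigma> \<gamma>"] conjI allI impI) simp_all
qed

end

subsection \<open>Limits of diagrams\<close>

lemma diagram_limit:
  "(\<And>k. diagram (A k)) \<Longrightarrow> diagram (\<lambda>i. eventually (\<lambda>k. A k i) ultra)"
  unfolding diagram_def
  using diagram_at_limit[of "\<lambda>i. eventually (\<lambda>k. A k i) ultra" A, OF refl]
  by (intro allI) simp

text \<open>Each class of equal names is represented by its least member, and an injection of the
  natural numbers carries the representatives into the infinite type.\<close>

lemma diagram_model_exists:
  assumes "diagram P" "infinite (UNIV :: 'a set)"
  shows "\<exists>q :: nat \<Rightarrow> 'a. diagram_model P q"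
proof -
  obtain j :: "nat \<Rightarrow> 'a" where j: "inj j"
    using infinite_countable_subset[OF assms(2)] by blast
  have refl: "P (iEq u u)" for u
    using assms(1) unfolding diagram_def diagram_at_def by (elim allE conjE)
  have "P (iEq x y) \<and> P (iEq z y) \<longrightarrow> P (iEq x z)" for x y z
    using assms(1) unfolding diagram_def diagram_at_def by (elim allE conjE)
  then have eq: "P (iEq u v) \<longleftrightarrow> (\<lambda>w. P (iEq u w)) = (\<lambda>w. P (iEq v w))" for u v
    using refl by (metis (no_types, lifting))
  have least: "P (iEq u (LEAST w. P (iEq u w)))" for u
    by (rule LeastI[of "\<lambda>w. P (iEq u w)", OF refl])
  have "j (LEAST w. P (iEq u w)) = j (LEAST w. P (iEq v w)) \<longleftrightarrow> P (iEq u v)" for u v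
  proof
    assume "j (LEAST w. P (iEq u w)) = j (LEAST w. P (iEq v w))"
    then have "(LEAST w. P (iEq u w)) = (LEAST w. P (iEq v w))"
      using j by (simp add: inj_eq)
    then show "P (iEq u v)" using least[of u] least[of v] eq by metis
  next
    assume "P (iEq u v)"
    then have "(\<lambda>w. P (iEq u w)) = (\<lambda>w. P (iEq v w))" by (rule eq[THEN iffD1])
    then show "j (LEAST w. P (iEq u w)) = j (LEAST w. P (iEq v w))" by (rule arg_cong)
  qed
  then have "diagram_model P (\<lambda>u. j (LEAST w. P (iEq u w)))"
    using assms(1) by unfold_locales
  then show ?thesis by blast
qed

text \<open>
  The ultraproduct of the expansions \<open>(K, t k)\<close>, restricted to the elements definable from the
  new constant.
\<close>

theorem limit_model:
  fixes K :: "'k fo_struct" and t :: "nat \<Rightarrow> 'k"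
  assumes inf: "infinite (UNIV :: 'a set)" and K: "pa_lang K {}" and t: "\<And>k. t k \<in> domI K"
  shows "\<exists>(M :: 'a fo_struct) c. pa_lang M {} \<and> c \<in> domI M \<and>
    (\<forall>\<phi>. arithmetical \<phi> \<longrightarrow> (sat M (case_nat c (\<lambda>_. zeroI M)) \<phi> \<longleftrightarrow>
       eventually (\<lambda>k. sat K (case_nat (t k) (\<lambda>_. zeroI K)) \<phi>) ultra)) \<and>
    (\<forall>x\<in>domI M. \<exists>\<gamma>. arithmetical \<gamma> \<and> fv \<gamma> \<subseteq> {0, 1} \<and>
       (\<forall>e. range e \<subseteq> domI M \<longrightarrow> e 1 = c \<longrightarrow> (sat M e \<gamma> \<longleftrightarrow> e 0 = x)))"
proof -
  define P where "P i = eventually (\<lambda>k. diag K (t k) i) ultra" for i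
  have "diagram (diag K (t k))" for k
    using pa_lang.diagram_diag[OF K refl t] .
  then have "diagram P"
    unfolding P_def by (rule diagram_limit)
  then obtain q :: "nat \<Rightarrow> 'a" where "diagram_model P q"
    using diagram_model_exists inf by blast
  then interpret D: diagram_model P q .
  show ?thesis
  proof (intro exI[of _ D.dm] exI[of _ "q nPar"] conjI allI impI ballI)
    show "pa_lang D.dm {}" by (rule D.pa_lang_dm)
    show "q nPar \<in> domI D.dm" by (simp add: names_Par)
    fix \<phi> assume "arithmetical \<phi>"
    then show "sat D.dm (case_nat (q nPar) (\<lambda>_. zeroI D.dm)) \<phi> \<longleftrightarrow>
       eventually (\<lambda>k. sat K (case_nat (t k) (\<lambda>_. zeroI K)) \<phi>) ultra"
      using D.sat_param by (simp add: P_def)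
  next
    fix x assume "x \<in> domI D.dm"
    then show "\<exists>\<gamma>. arithmetical \<gamma> \<and> fv \<gamma> \<subseteq> {0, 1} \<and>
       (\<forall>e. range e \<subseteq> domI D.dm \<longrightarrow> e 1 = q nPar \<longrightarrow> (sat D.dm e \<gamma> \<longleftrightarrow> e 0 = x))"
      by (rule D.definable)
  qed
qed

section \<open>A model with a nonstandard definable element\<close>

text \<open>Serves for the diagram's condition on the base axioms, whose set of codes is
  finite.\<close>

lemma arith_finite:
  assumes "finite A" "gfn f"
  shows "arith (\<lambda>e. f e \<in> A)"
  using assms(1)
proof (induction A)
  case empty
  then show ?case by (simp add: dfn_False)
next
  case (insert a A)
  have "arith (\<lambda>e. f e = a \<or> f e \<in> A)"
    by (intro arith_intros assms insert.IH)
  then show ?case by simp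
qed

lemma (in pa_minus) eval_num: "eval M (\<lambda>i. num M (e i)) t = num M (eval Nat_struct e t)"
  by (induction t) (simp_all add: num_add num_mul num_1[simplified])

text \<open>A Tarski-Vaught argument. The least counterexample to a formula at numerals is
  parameter-free definable, because numerals are closed terms; it is therefore standard, and the
  formula already fails in the standard model.\<close>

lemma (in pa_lang) standard_elementary:
  assumes L: "L = {}"
    and standard: "\<And>d \<delta>. d \<in> domI M \<Longrightarrow> arithmetical \<delta> \<Longrightarrow>
      (\<And>e. range e \<subseteq> domI M \<Longrightarrow> sat M e \<delta> \<longleftrightarrow> e 0 = d) \<Longrightarrow> \<exists>n. d = num M n"
    and "arithmetical \<phi>"
  shows "sat M (\<lambda>i. num M (e i)) \<phi> \<longleftrightarrow> sat Nat_struct e \<phi>"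
  using assms(3)
proof (induction \<phi> arbitrary: e)
  case (Forall \<phi>)
  let ?e = "\<lambda>i. num M (e i)"
  have shift: "case_nat (num M n) ?e = (\<lambda>i. num M (case_nat n e i))" for n
    by (auto split: nat.split)
  have IH: "sat M (case_nat (num M n) ?e) \<phi> \<longleftrightarrow> sat Nat_struct (case_nat n e) \<phi>" for n
    unfolding shift using Forall by simp
  have "sat M ?e (Forall \<phi>)" if N: "\<And>n. sat Nat_struct (case_nat n e) \<phi>"
  proof (rule ccontr)
    have e: "range ?e \<subseteq> domI M" by auto
    assume "\<not> sat M ?e (Forall \<phi>)"
    then obtain z where "z \<in> domI M" "\<not> sat M (case_nat z ?e) \<phi>" by auto
    moreover have "in_lang L \<phi>" using Forall.prems L by simp
    ultimately obtain x where x: "x \<in> domI M" "\<not> sat M (case_nat x ?e) \<phi>"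
      "\<And>y. y \<in> domI M \<Longrightarrow> ltI M y x \<Longrightarrow> sat M (case_nat y ?e) \<phi>"
      using lnp[of \<phi> ?e z] e by blast
    have at: "dfn M {} (\<lambda>f. sat M (case_nat (f 0) ?e) \<phi>)"
    proof -
      have "(\<lambda>i. eval M f (case_nat (Var 0) (\<lambda>i. numeral_tm (e i)) i)) = case_nat (f 0) ?e" for f
        by (auto split: nat.split)
      then show ?thesis
        using dfn_subst[OF struct dfn_sat[of "{}" \<phi> M], of "case_nat (Var 0) (\<lambda>i. numeral_tm (e i))"]
          Forall.prems by simp
    qed
    have "dfn M {} (\<lambda>f. \<not> sat M (case_nat (f 0) ?e) \<phi> \<and>
      (\<forall>y\<in>domI M. ltI M y (f 0) \<longrightarrow> sat M (case_nat y ?e) \<phi>))"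
      by (intro dfn_intros at)
    then obtain \<delta> where \<delta>: "arithmetical \<delta>" "\<And>f. range f \<subseteq> domI M \<Longrightarrow> sat M f \<delta> \<longleftrightarrow>
      \<not> sat M (case_nat (f 0) ?e) \<phi> \<and> (\<forall>y\<in>domI M. ltI M y (f 0) \<longrightarrow> sat M (case_nat y ?e) \<phi>)"
      unfolding dfn_def by blast
    have "sat M f \<delta> \<longleftrightarrow> f 0 = x" if f: "range f \<subseteq> domI M" for f
      using \<delta>(2)[OF f] x lt_linear[of "f 0" x x] f by blast
    then obtain n where "x = num M n"
      using standard[OF x(1) \<delta>(1)] by blast
    then show False using x(2) IH N by simp
  qed
  then show ?case using IH by auto
qed (auto simp: eval_num)

text \<open>Finite satisfiability of the diagram conditions together with one item. Quantifying over
  codes of finite sets in place of whole diagrams is what makes this arithmetical.\<close>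

definition fragment_sat :: "nat \<Rightarrow> nat \<Rightarrow> bool" where
  "fragment_sat p a \<longleftrightarrow> (\<forall>n. \<exists>s.
     (\<forall>x<n. \<forall>y<n. \<forall>z<n. \<forall>u<n. \<forall>v<n. \<forall>e<n. diagram_at (\<lambda>i. mem i s) x y z u v e) \<and>
     mem (iSat p (cons_code (nNum a) 0)) s)"

lemma arith_fragment_sat: "arith (\<lambda>e. fragment_sat (e 0) (e 0))"
  unfolding fragment_sat_def diagram_at_def
  by (intro arith_intros arith_mem arith_finite) (simp add: PA_minus_def Let_def)

text \<open>Cutting the true diagram off at \<open>m\<close> gives finite sets whose limit is the
  true diagram. Hence any finitely many conditions already hold for some cut-off.\<close>

lemma fragment_sat_standard:
  assumes "arithmetical \<phi>" "sat Nat_struct (case_nat a (\<lambda>_. 0)) \<phi>"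
  shows "fragment_sat (gn \<phi>) a"
  unfolding fragment_sat_def
proof
  fix n
  let ?D = "diag Nat_struct 0" let ?i = "iSat (gn \<phi>) (cons_code (nNum a) 0)"
  have D: "diagram ?D"
    using pa_lang.diagram_diag[OF pa_lang_Nat refl, of 0] by simp
  define A where "A m i \<longleftrightarrow> i < m \<and> ?D i" for m i
  have lim: "?D i \<longleftrightarrow> eventually (\<lambda>m. A m i) ultra" for i
  proof -
    have "eventually (\<lambda>m. A m i \<longleftrightarrow> ?D i) ultra"
      by (rule eventually_ultra[of "Suc i"]) (auto simp: A_def)
    then show ?thesis by (simp add: ultra_iff ultra_const)
  qed
  have "eventually (\<lambda>m. diagram_at (A m) x y z u v e) ultra" for x y z u v e
    using D diagram_at_limit[of ?D A, OF lim] unfolding diagram_def by blast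
  then have "eventually (\<lambda>m. \<forall>x\<in>{..<n}. \<forall>y\<in>{..<n}. \<forall>z\<in>{..<n}. \<forall>u\<in>{..<n}. \<forall>v\<in>{..<n}. \<forall>e\<in>{..<n}.
      diagram_at (A m) x y z u v e) ultra"
    by (intro eventually_ball_finite ballI finite_lessThan)
  moreover have "eventually (\<lambda>m. A m ?i) ultra"
    using lim[of ?i] assms by simp
  ultimately have "eventually (\<lambda>m. (\<forall>x<n. \<forall>y<n. \<forall>z<n. \<forall>u<n. \<forall>v<n. \<forall>e<n.
      diagram_at (A m) x y z u v e) \<and> A m ?i) ultra"
    by eventually_elim simp
  then have "\<exists>m. (\<forall>x<n. \<forall>y<n. \<forall>z<n. \<forall>u<n. \<forall>v<n. \<forall>e<n. diagram_at (A m) x y z u v e) \<and> A m ?i"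
    by (rule eventually_happens'[OF ultra(1)])
  then obtain m where m: "\<forall>x<n. \<forall>y<n. \<forall>z<n. \<forall>u<n. \<forall>v<n. \<forall>e<n. diagram_at (A m) x y z u v e" "A m ?i"
    by (elim exE conjE)
  have "finite {i. A m i}" by (rule finite_subset[of _ "{..<m}"]) (auto simp: A_def)
  then obtain s where "\<And>i. mem i s \<longleftrightarrow> A m i"
    using finite_set_coded[of "{i. A m i}" 0] by auto
  then have s: "(\<lambda>i. mem i s) = A m" by blast
  show "\<exists>s. (\<forall>x<n. \<forall>y<n. \<forall>z<n. \<forall>u<n. \<forall>v<n. \<forall>e<n. diagram_at (\<lambda>i. mem i s) x y z u v e) \<and> mem ?i s"
  proof (intro exI[of _ s] conjI)
    show "mem ?i s" using m(2) by (simp only: s[symmetric])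
    show "\<forall>x<n. \<forall>y<n. \<forall>z<n. \<forall>u<n. \<forall>v<n. \<forall>e<n. diagram_at (\<lambda>i. mem i s) x y z u v e"
      unfolding s by (rule m(1))
  qed
qed

theorem nonstandard_definable:
  "\<exists>(K :: nat fo_struct) d \<delta>. pa_lang K {} \<and> d \<in> domI K \<and> (\<forall>n. d \<noteq> num K n) \<and> arithmetical \<delta> \<and>
     (\<forall>e. range e \<subseteq> domI K \<longrightarrow> (sat K e \<delta> \<longleftrightarrow> e 0 = d))"
proof (rule ccontr)
  assume "\<not> ?thesis"
  then have no: "\<exists>n. d = num K n" if "pa_lang K {}" "d \<in> domI K" "arithmetical \<delta>"
    "\<And>e. range e \<subseteq> domI K \<Longrightarrow> sat K e \<delta> \<longleftrightarrow> e 0 = d" for K :: "nat fo_struct" and d \<delta>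
    using that by blast
  have sound: "sat Nat_struct (case_nat a (\<lambda>_. 0)) \<phi>"
    if \<phi>: "arithmetical \<phi>" and fr: "fragment_sat (gn \<phi>) a" for \<phi> a
  proof -
    let ?i = "iSat (gn \<phi>) (cons_code (nNum a) 0)"
    obtain s where s: "\<And>n x y z u v e. x < n \<Longrightarrow> y < n \<Longrightarrow> z < n \<Longrightarrow> u < n \<Longrightarrow> v < n \<Longrightarrow> e < n \<Longrightarrow>
        diagram_at (\<lambda>i. mem i (s n)) x y z u v e" "\<And>n. mem ?i (s n)"
      using fr unfolding fragment_sat_def by metis
    \<comment> \<open>Compactness: any fixed instance holds in all sufficiently late fragments, so
      the limit is a full diagram.\<close>
    define P where "P i = eventually (\<lambda>n. mem i (s n)) ultra" for i
    have "eventually (\<lambda>n. diagram_at (\<lambda>i. mem i (s n)) x y z u v e) ultra" for x y z u v e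
      \<comment> \<open>The successor of the sum exceeds each of the six arguments.\<close>
      by (rule eventually_ultra[of "Suc (x + y + z + u + v + e)"], rule s(1)) auto
    then have "diagram P"
      unfolding diagram_def using diagram_at_limit[of P "\<lambda>n i. mem i (s n)", OF P_def] by blast
    then obtain q :: "nat \<Rightarrow> nat" where "diagram_model P q"
      using diagram_model_exists infinite_UNIV_nat by blast
    then interpret D: diagram_model P q .
    have "P ?i" unfolding P_def using s(2) by simp
    then have "sat D.dm (case_nat (q (nNum a)) (\<lambda>_. q (nNum 0))) \<phi>"
      using D.sat_iff[OF \<phi>, of "[nNum a]"] names_Num by simp
    moreover have "case_nat (q (nNum a)) (\<lambda>_. q (nNum 0)) = (\<lambda>i. num D.dm (case_nat a (\<lambda>_. 0) i))"
      by (auto split: nat.split)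
    moreover have "sat D.dm (\<lambda>i. num D.dm (case_nat a (\<lambda>_. 0) i)) \<phi> \<longleftrightarrow>
        sat Nat_struct (case_nat a (\<lambda>_. 0)) \<phi>"
      by (rule D.dm.standard_elementary[OF refl no[OF D.pa_lang_dm] \<phi>])
    ultimately show ?thesis by simp
  qed
  \<comment> \<open>On codes of arithmetical formulas \<open>fragment_sat\<close> now coincides with
    truth in the standard model, so a formula denying it on the diagonal contradicts itself at its
    own code.\<close>
  obtain \<theta> where \<theta>: "arithmetical \<theta>" "\<And>e. sat Nat_struct e \<theta> \<longleftrightarrow> \<not> fragment_sat (e 0) (e 0)"
    using dfn_not[OF arith_fragment_sat] unfolding dfn_def by auto
  have "sat Nat_struct (case_nat (gn \<theta>) (\<lambda>_. 0)) \<theta> \<longleftrightarrow> fragment_sat (gn \<theta>) (gn \<theta>)"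
    using fragment_sat_standard[OF \<theta>(1)] sound[OF \<theta>(1)] by blast
  then show False using \<theta>(2) by simp
qed

section \<open>Expansion by a definable predicate\<close>

primrec args_env :: "'a list \<Rightarrow> (nat \<Rightarrow> 'a) \<Rightarrow> nat \<Rightarrow> 'a" where
  "args_env [] e = e"
| "args_env (x # xs) e = case_nat x (args_env xs e)"

lemma args_env_nth: "args_env xs e i = (if i < length xs then xs ! i else e (i - length xs))"
  by (induction xs arbitrary: i) (auto split: nat.split)

definition expand :: "'a fo_struct \<Rightarrow> psym \<Rightarrow> fm \<Rightarrow> 'a \<Rightarrow> 'a fo_struct" where
  "expand M r \<delta> c = M\<lparr>relI := \<lambda>r' xs. r' = r \<and> sat M (args_env xs (case_nat c (\<lambda>_. zeroI M))) \<delta>\<rparr>"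

lemma expand_simps [simp]:
  "domI (expand M r \<delta> c) = domI M" "zeroI (expand M r \<delta> c) = zeroI M"
  "oneI (expand M r \<delta> c) = oneI M" "addI (expand M r \<delta> c) = addI M"
  "mulI (expand M r \<delta> c) = mulI M" "ltI (expand M r \<delta> c) = ltI M"
  "relI (expand M r \<delta> c) r xs \<longleftrightarrow> sat M (args_env xs (case_nat c (\<lambda>_. zeroI M))) \<delta>"
  by (simp_all add: expand_def)

lemma eval_expand [simp]: "eval (expand M r \<delta> c) e t = eval M e t"
  by (induction t) auto

lemma num_expand [simp]: "num (expand M r \<delta> c) n = num M n"
  by (induction n) auto

lemma sat_expand: "arithmetical \<phi> \<Longrightarrow> sat (expand M r \<delta> c) e \<phi> \<longleftrightarrow> sat M e \<phi>"
  by (induction \<phi> arbitrary: e) auto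

text \<open>Replacing the predicate by its definition leaves an arithmetical formula with the extra
  parameter \<open>c\<close> at index \<open>0\<close>. Definable expansions thereby inherit the
  least number principle.\<close>

lemma expand_eliminate:
  assumes "arithmetical \<delta>" "in_lang {r} \<phi>"
  shows "\<exists>\<phi>'. arithmetical \<phi>' \<and> (\<forall>e. sat (expand M r \<delta> c) e \<phi> \<longleftrightarrow> sat M (case_nat c e) \<phi>')"
  using assms(2)
proof (induction \<phi>)
  case (Eq s t)
  show ?case
    by (rule exI[of _ "subst (\<lambda>i. Var (Suc i)) (Eq s t)"])
       (simp only: sat_subst sat_expand in_lang_subst in_lang.simps, simp)
next
  case (Lt s t)
  show ?case
    by (rule exI[of _ "subst (\<lambda>i. Var (Suc i)) (Lt s t)"])
       (simp only: sat_subst sat_expand in_lang_subst in_lang.simps, simp)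
next
  case (Rel r' ts)
  define \<sigma> where "\<sigma> i = (if i < length ts then subst_tm (\<lambda>j. Var (Suc j)) (ts ! i)
    else if i = length ts then Var 0 else Zero)" for i
  have "(\<lambda>i. eval M (case_nat c e) (\<sigma> i)) =
      args_env (map (eval M e) ts) (case_nat c (\<lambda>_. zeroI M))" for e
    by (rule ext) (auto simp: \<sigma>_def args_env_nth eval_subst_tm split: nat.split)
  moreover have "r' = r" using Rel by simp
  moreover have "eval (expand M r \<delta> c) e = eval M e" for e by (rule ext) simp
  ultimately show ?case
    using assms(1) by (intro exI[of _ "subst \<sigma> \<delta>"]) (simp add: sat_subst)
next
  case Falsum
  show ?case by (rule exI[of _ Falsum]) simp
next
  case (Imp \<phi> \<psi>)
  then obtain \<phi>' \<psi>' where "arithmetical \<phi>'" "\<And>e. sat (expand M r \<delta> c) e \<phi> \<longleftrightarrow> sat M (case_nat c e) \<phi>'"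
    "arithmetical \<psi>'" "\<And>e. sat (expand M r \<delta> c) e \<psi> \<longleftrightarrow> sat M (case_nat c e) \<psi>'" by auto
  then show ?case by (intro exI[of _ "Imp \<phi>' \<psi>'"]) simp
next
  case (Forall \<phi>)
  then obtain \<phi>' where \<phi>': "arithmetical \<phi>'" "\<And>e. sat (expand M r \<delta> c) e \<phi> \<longleftrightarrow> sat M (case_nat c e) \<phi>'"
    by auto
  \<comment> \<open>Below the quantifier the bound variable precedes \<open>c\<close>, whereas
    \<open>\<phi>'\<close> expects \<open>c\<close> first; the two are exchanged.\<close>
  let ?\<sigma> = "case_nat (Var (Suc 0)) (case_nat (Var 0) (\<lambda>i. Var (Suc (Suc i))))"
  have "(\<lambda>i. eval M (case_nat x (case_nat c e)) (?\<sigma> i)) = case_nat c (case_nat x e)" for x e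
    by (auto split: nat.split)
  then show ?case
    using \<phi>' by (intro exI[of _ "Forall (subst ?\<sigma> \<phi>')"]) (simp add: sat_subst)
qed

lemma pa_lang_expand:
  assumes "pa_lang M {}" "c \<in> domI M" "arithmetical \<delta>"
  shows "pa_lang (expand M r \<delta> c) {r}"
proof -
  interpret pa_lang M "{}" by fact
  show ?thesis
  proof unfold_locales
    show "is_struct (expand M r \<delta> c)" using struct by (simp add: is_struct_def)
    show "models (expand M r \<delta> c) PA_minus"
      using base by (simp add: models_def sat_expand arithmetical_PA_minus)
    fix \<phi> e x
    assume \<phi>: "in_lang {r} \<phi>" and e: "range e \<subseteq> domI (expand M r \<delta> c)"
      and x: "x \<in> domI (expand M r \<delta> c)" "\<not> sat (expand M r \<delta> c) (case_nat x e) \<phi>"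
    obtain \<phi>' where \<phi>': "arithmetical \<phi>'" "\<And>e. sat (expand M r \<delta> c) e \<phi> \<longleftrightarrow> sat M (case_nat c e) \<phi>'"
      using expand_eliminate[OF assms(3) \<phi>] by metis
    let ?\<sigma> = "case_nat (Var (Suc 0)) (case_nat (Var 0) (\<lambda>i. Var (Suc (Suc i))))"
    have "(\<lambda>i. eval M (case_nat y (case_nat c e)) (?\<sigma> i)) = case_nat c (case_nat y e)" for y
      by (auto split: nat.split)
    then have *: "sat (expand M r \<delta> c) (case_nat y e) \<phi> \<longleftrightarrow> sat M (case_nat y (case_nat c e)) (subst ?\<sigma> \<phi>')" for y
      by (simp only: \<phi>'(2) sat_subst)
    show "\<exists>x\<in>domI (expand M r \<delta> c). \<not> sat (expand M r \<delta> c) (case_nat x e) \<phi> \<and>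
      (\<forall>y\<in>domI (expand M r \<delta> c). ltI (expand M r \<delta> c) y x \<longrightarrow> sat (expand M r \<delta> c) (case_nat y e) \<phi>)"
      unfolding * expand_simps
    proof (rule lnp)
      show "arithmetical (subst ?\<sigma> \<phi>')" using \<phi>'(1) by simp
      show "range (case_nat c e) \<subseteq> domI M" using e assms(2) by (simp add: range_case_nat)
      show "x \<in> domI M" "\<not> sat M (case_nat x (case_nat c e)) (subst ?\<sigma> \<phi>')"
        using x unfolding * by simp_all
    qed
  qed
qed

section \<open>Induction and bounding\<close>

lemma sat_Forall_powI:
  assumes "\<And>e. range e \<subseteq> domI M \<Longrightarrow> sat M e \<phi>" "range e \<subseteq> domI M"
  shows "sat M e ((Forall ^^ n) \<phi>)"
  using assms(2)
proof (induction n arbitrary: e)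
  case (Suc n)
  then show ?case by (simp add: range_case_nat)
qed (use assms(1) in simp)

context pa_lang
begin

lemma predecessor:
  assumes "x \<in> domI M" "x \<noteq> zeroI M"
  shows "\<exists>w\<in>domI M. x = addI M w (oneI M)"
proof -
  have "ltI M (zeroI M) x" using zero_least[of x x x] assms by auto
  then consider "ltI M (oneI M) x" | "oneI M = x" using discrete[of x x x] assms by auto
  then show ?thesis
  proof cases
    case 1
    then obtain w where "w \<in> domI M" "addI M (oneI M) w = x"
      using lt_diff[of "oneI M" x x] assms by auto
    then show ?thesis using add_comm[of "oneI M" w w] by auto
  next
    case 2
    then show ?thesis using num_1 by (intro bexI[of _ "zeroI M"]) auto
  qed
qed

text \<open>A least counterexample would be a successor whose predecessor satisfies the formula,
  against the induction step.\<close>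

lemma sat_induction_fm:
  assumes \<phi>: "in_lang L \<phi>" and e: "range e \<subseteq> domI M"
  shows "sat M e (induction_fm \<phi>)"
proof -
  have 0: "(\<lambda>i. eval M e (case_nat Zero Var i)) = case_nat (zeroI M) e"
    by (auto split: nat.split)
  have S: "(\<lambda>i. eval M (case_nat a e) (case_nat (Add (Var 0) One) (\<lambda>i. Var (Suc i)) i)) =
      case_nat (addI M a (oneI M)) e" for a
    by (auto split: nat.split)
  have "sat M (case_nat a e) \<phi>"
    if z: "sat M (case_nat (zeroI M) e) \<phi>" and
      step: "\<And>a. a \<in> domI M \<Longrightarrow> sat M (case_nat a e) \<phi> \<Longrightarrow> sat M (case_nat (addI M a (oneI M)) e) \<phi>"
      and a: "a \<in> domI M" for a
  proof (rule ccontr)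
    assume "\<not> sat M (case_nat a e) \<phi>"
    then obtain x where x: "x \<in> domI M" "\<not> sat M (case_nat x e) \<phi>"
      "\<And>y. y \<in> domI M \<Longrightarrow> ltI M y x \<Longrightarrow> sat M (case_nat y e) \<phi>"
      using lnp[OF \<phi> e a] by blast
    then have "x \<noteq> zeroI M" using z by blast
    then obtain w where w: "w \<in> domI M" "x = addI M w (oneI M)"
      using predecessor x(1) by blast
    then have "sat M (case_nat w e) \<phi>" using x(3) lt_Suc by simp
    then show False using step w x(2) by simp
  qed
  then show ?thesis
    unfolding induction_fm_def inst_def by (auto simp: sat_subst 0 S)
qed

lemma models_Induction: "models M (Induction L)"
  unfolding models_def Induction_def using sat_Forall_powI[OF sat_induction_fm] by blast

section \<open>Least elements and collection for definable relations\<close>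

lemma dfn_least:
  assumes "dfn M L P" "range e \<subseteq> domI M" "x \<in> domI M" "P (case_nat x e)"
  shows "\<exists>x\<in>domI M. P (case_nat x e) \<and> (\<forall>y\<in>domI M. ltI M y x \<longrightarrow> \<not> P (case_nat y e))"
proof -
  obtain \<phi> where \<phi>: "in_lang L \<phi>" "\<And>e. range e \<subseteq> domI M \<Longrightarrow> sat M e \<phi> \<longleftrightarrow> \<not> P e"
    using dfn_not[OF assms(1)] unfolding dfn_def by blast
  have *: "sat M (case_nat y e) \<phi> \<longleftrightarrow> \<not> P (case_nat y e)" if "y \<in> domI M" for y
    using \<phi>(2) assms(2) that by (simp add: range_case_nat)
  show ?thesis
    using lnp[OF \<phi>(1) assms(2,3)] * assms(3,4) by auto
qed

text \<open>Parameters are allowed through the tail \<open>e\<close> of the assignment; a defining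
  formula under test may use arbitrary ones.\<close>

definition dfn2 :: "('a \<Rightarrow> 'a \<Rightarrow> bool) \<Rightarrow> bool" where
  "dfn2 R \<longleftrightarrow> (\<exists>P e. dfn M L P \<and> range e \<subseteq> domI M \<and>
     (\<forall>a\<in>domI M. \<forall>x\<in>domI M. R a x \<longleftrightarrow> P (case_nat a (case_nat x e))))"

lemma dfn2E:
  assumes "dfn2 R"
  obtains P e where "dfn M L P" "range e \<subseteq> domI M"
    "\<And>a x. a \<in> domI M \<Longrightarrow> x \<in> domI M \<Longrightarrow> R a x \<longleftrightarrow> P (case_nat a (case_nat x e))"
proof -
  obtain P e where "dfn M L P \<and> range e \<subseteq> domI M \<and>
     (\<forall>a\<in>domI M. \<forall>x\<in>domI M. R a x \<longleftrightarrow> P (case_nat a (case_nat x e)))"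
    using assms unfolding dfn2_def by (elim exE)
  then show thesis using that[of P e] by simp
qed

lemma dfn_at2:
  assumes "dfn M L P"
  shows "dfn M L (\<lambda>f. P (case_nat (f j) (case_nat (f k) (\<lambda>i. f (i + n)))))"
proof -
  have "(\<lambda>i. f (case i of 0 \<Rightarrow> j | Suc 0 \<Rightarrow> k | Suc (Suc m) \<Rightarrow> m + n)) =
      case_nat (f j) (case_nat (f k) (\<lambda>i. f (i + n)))" for f :: "nat \<Rightarrow> 'a"
    by (auto split: nat.split)
  then show ?thesis
    using dfn_reindex[OF struct assms, of "case_nat j (case_nat k (\<lambda>m. m + n))"] by simp
qed

text \<open>Collection, by induction on the bound for \<open>a\<close>: a least \<open>z\<close> at
  which no common bound exists would be \<open>w + 1\<close>, where a bound for all
  \<open>a < w\<close> and one for \<open>a = w\<close> are available.\<close>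

lemma bounding:
  assumes "dfn2 R" "c \<in> domI M"
    and R: "\<And>a. a \<in> domI M \<Longrightarrow> ltI M a c \<Longrightarrow> \<exists>y\<in>domI M. \<forall>x\<in>domI M. R a x \<longrightarrow> ltI M x y"
  shows "\<exists>y\<in>domI M. \<forall>a\<in>domI M. ltI M a c \<longrightarrow> (\<forall>x\<in>domI M. R a x \<longrightarrow> ltI M x y)"
proof (rule ccontr)
  assume no: "\<not> ?thesis"
  obtain P e where P: "dfn M L P" "range e \<subseteq> domI M"
    "\<And>a x. a \<in> domI M \<Longrightarrow> x \<in> domI M \<Longrightarrow> R a x \<longleftrightarrow> P (case_nat a (case_nat x e))"
    by (rule dfn2E[OF assms(1)]) (rule that)
  define B where "B f \<longleftrightarrow> (\<exists>y\<in>domI M. \<forall>a\<in>domI M. ltI M a (f 0) \<longrightarrow>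
    (\<forall>x\<in>domI M. P (case_nat a (case_nat x (\<lambda>i. f (Suc i)))) \<longrightarrow> ltI M x y))" for f
  have "dfn M L B"
    unfolding B_def
    by (intro dfn_intros) (use dfn_at2[OF P(1), of 1 0 4] in \<open>simp add: eval_nat_numeral\<close>)
  moreover have B: "B (case_nat z e) \<longleftrightarrow>
      (\<exists>y\<in>domI M. \<forall>a\<in>domI M. ltI M a z \<longrightarrow> (\<forall>x\<in>domI M. R a x \<longrightarrow> ltI M x y))" for z
    unfolding B_def using P(3) by simp
  moreover have "\<not> B (case_nat c e)"
    using no unfolding B by blast
  ultimately obtain z where z: "z \<in> domI M" "\<not> B (case_nat z e)"
    "\<And>y. y \<in> domI M \<Longrightarrow> ltI M y z \<Longrightarrow> B (case_nat y e)"
    using dfn_least[OF dfn_not P(2) assms(2), of B] by blast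
  have zc: "ltI M z c \<or> z = c"
    using z(3)[OF assms(2)] \<open>\<not> B (case_nat c e)\<close> lt_linear[of z c c] z(1) assms(2) by blast
  have "z \<noteq> zeroI M"
  proof
    assume "z = zeroI M"
    then have "\<not> ltI M a z" if "a \<in> domI M" for a
      using lt_num_iff[OF that, of 0] by simp
    then show False using z(2) zero_in unfolding B by blast
  qed
  then obtain w where w: "w \<in> domI M" "z = addI M w (oneI M)"
    using predecessor z(1) by blast
  then have "ltI M w z" using lt_Suc by simp
  then have "ltI M w c" using zc lt_trans[OF w(1) z(1) assms(2)] by blast
  obtain y1 where y1: "y1 \<in> domI M" "\<And>x. x \<in> domI M \<Longrightarrow> R w x \<Longrightarrow> ltI M x y1"
    using R[OF w(1) \<open>ltI M w c\<close>] by blast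
  obtain y2 where y2: "y2 \<in> domI M" "\<And>a x. a \<in> domI M \<Longrightarrow> ltI M a w \<Longrightarrow> x \<in> domI M \<Longrightarrow> R a x \<Longrightarrow> ltI M x y2"
    using z(3)[OF w(1) \<open>ltI M w z\<close>] unfolding B by blast
  \<comment> \<open>The witness is the larger of the two bounds.\<close>
  have "\<exists>y\<in>domI M. \<forall>x\<in>domI M. ltI M x y1 \<or> ltI M x y2 \<longrightarrow> ltI M x y"
    using lt_linear[OF y1(1) y2(1) y2(1)] lt_trans[OF _ y1(1) y2(1)] lt_trans[OF _ y2(1) y1(1)] y1(1) y2(1)
    by blast
  then obtain y where y: "y \<in> domI M" "\<And>x. x \<in> domI M \<Longrightarrow> ltI M x y1 \<or> ltI M x y2 \<Longrightarrow> ltI M x y"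
    by blast
  have "ltI M x y" if "a \<in> domI M" "ltI M a z" "x \<in> domI M" "R a x" for a x
    using that y y1 y2 lt_Suc_iff[OF that(1) w(1)] w(2) by blast
  then show False using z(2) y(1) unfolding B by blast
qed

text \<open>At nonstandard \<open>a < c\<close> nothing is known about \<open>R a\<close>, so
  collection is applied to \<open>Q\<close>, which keeps only uniquely determined values and is
  bounded at each \<open>a\<close>. All standard numbers lie below \<open>c\<close>, so one bound
  covers the whole enumeration.\<close>

lemma no_cofinal_enumeration:
  assumes R: "dfn2 R" and c: "c \<in> domI M" "\<And>n. c \<noteq> num M n"
    and cofinal: "\<And>x. x \<in> domI M \<Longrightarrow> \<exists>n. \<exists>x'\<in>domI M. (x = x' \<or> ltI M x x') \<and>
      (\<forall>y\<in>domI M. R (num M n) y \<longleftrightarrow> y = x')"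
  shows False
proof -
  define Q where "Q a x \<longleftrightarrow> R a x \<and> (\<forall>y\<in>domI M. R a y \<longrightarrow> y = x)" for a x
  obtain P e where P: "dfn M L P" "range e \<subseteq> domI M"
    "\<And>a x. a \<in> domI M \<Longrightarrow> x \<in> domI M \<Longrightarrow> R a x \<longleftrightarrow> P (case_nat a (case_nat x e))"
    by (rule dfn2E[OF R]) (rule that)
  let ?P = "\<lambda>f. P f \<and> (\<forall>y\<in>domI M. P (case_nat (f 0) (case_nat y (\<lambda>i. f (Suc (Suc i))))) \<longrightarrow> y = f 1)"
  have "dfn M L ?P"
    by (intro dfn_intros P(1)) (use dfn_at2[OF P(1), of 1 0 3] in \<open>simp add: eval_nat_numeral\<close>)
  then have "dfn2 Q"
    unfolding dfn2_def Q_def by (intro exI[of _ ?P] exI[of _ e]) (simp add: P(2,3))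
  moreover have "\<exists>y\<in>domI M. \<forall>x\<in>domI M. Q a x \<longrightarrow> ltI M x y" if "a \<in> domI M" for a
  proof (cases "\<exists>x\<in>domI M. Q a x")
    case True
    then obtain x where x: "x \<in> domI M" "Q a x" by blast
    show ?thesis
    proof (intro bexI[of _ "addI M x (oneI M)"] ballI impI)
      fix y assume "y \<in> domI M" "Q a y"
      then have "y = x" using x unfolding Q_def by blast
      then show "ltI M y (addI M x (oneI M))" using lt_Suc[OF x(1)] by simp
    qed (use x(1) in simp)
  qed (use zero_in in blast)
  ultimately obtain y where y: "y \<in> domI M"
    "\<And>a x. a \<in> domI M \<Longrightarrow> ltI M a c \<Longrightarrow> x \<in> domI M \<Longrightarrow> Q a x \<Longrightarrow> ltI M x y"
    using bounding[of Q c] c(1) by blast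
  obtain n x' where x': "x' \<in> domI M" "y = x' \<or> ltI M y x'"
    "\<And>z. z \<in> domI M \<Longrightarrow> R (num M n) z \<longleftrightarrow> z = x'"
    using cofinal[OF y(1)] by blast
  have "Q (num M n) x'" unfolding Q_def using x'(1,3) by blast
  then have "ltI M x' y"
    using y(2)[of "num M n" x'] nonstandard_above[OF c] x'(1) by simp
  then show False
    using x'(1,2) lt_irrefl[of y y y] lt_trans[of y x' y] y(1) by blast
qed

end

section \<open>Failure of semantic definability\<close>

lemma (in pa_minus) sat_close:
  assumes "range e \<subseteq> domI M" "\<And>e. range e \<subseteq> domI M \<Longrightarrow> sat M e \<delta> \<longleftrightarrow> e 0 = d"
  shows "sat M e (subst (case_nat (Var 0) (\<lambda>_. Zero)) \<delta>) \<longleftrightarrow> e 0 = d"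
proof -
  let ?f = "\<lambda>i. eval M e (case_nat (Var 0) (\<lambda>_. Zero) i)"
  have "range ?f \<subseteq> domI M" using eval_in_dom[OF struct assms(1)] by blast
  then show ?thesis using assms(2)[of ?f] by (simp add: sat_subst)
qed

lemma fv_close: "fv (subst (case_nat (Var 0) (\<lambda>_. Zero)) \<delta>) \<subseteq> {0}"
  by (auto simp: fv_subst split: nat.splits)

lemma rel_subst_arithmetical: "arithmetical \<phi> \<Longrightarrow> rel_subst R \<psi> d \<phi> = \<phi>"
  by (induction \<phi> arbitrary: d) auto

lemma in_lang_Exists1 [simp]: "in_lang L (Exists1 \<phi>) \<longleftrightarrow> in_lang L \<phi>"
  by (auto simp: Exists1_def)

lemma sentence_Exists1:
  assumes "fv \<phi> \<subseteq> {0}"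
  shows "sentence (Exists1 \<phi>)"
proof -
  have 0: "i = 0" if "i \<in> fv \<phi>" for i using assms that by blast
  have "subst (case_nat (Var 0) (\<lambda>i. Var (Suc (Suc i)))) \<phi> = \<phi>"
    by (rule subst_id) (drule 0, simp)
  then show ?thesis
    using 0 by (auto simp: Exists1_def)
qed

lemma sat_rel_subst_binary:
  assumes "r = PD \<or> r = PS" "arithmetical \<chi>"
  shows "sat M e (rel_subst r \<psi> 0 (Forall (Iff (Rel r [quot \<phi>, Var 0]) \<chi>))) \<longleftrightarrow>
    (\<forall>y\<in>domI M. sat M (case_nat (num M (gn \<phi>)) (case_nat y e)) \<psi> \<longleftrightarrow> sat M (case_nat y e) \<chi>)"
proof -
  let ?\<sigma> = "\<lambda>i. if i < arity r then [quot \<phi>, Var 0] ! i else Var (Suc 0 + (i - arity r))"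
  have 1: "rel_subst r \<psi> 0 (Forall (Iff (Rel r [quot \<phi>, Var 0]) \<chi>)) = Forall (Iff (subst ?\<sigma> \<psi>) \<chi>)"
    by (simp add: rel_subst_arithmetical[OF assms(2)])
  have "arity r = 2" using assms(1) by auto
  then have 2: "(\<lambda>i. eval M (case_nat y e) (?\<sigma> i)) = case_nat (num M (gn \<phi>)) (case_nat y e)" for y
    by (intro ext) (auto simp: quot_def less_Suc_eq numeral_2_eq_2 split: nat.split)
  show ?thesis
    unfolding 1 sat.simps(6) sat_Iff sat_subst 2 by (rule refl)
qed

text \<open>\<open>K\<close> and \<open>M0\<close> agree on sentences, so \<open>c\<close>, a limit
  of codes of truths of \<open>K\<close>, also codes the truths of \<open>M0\<close> at standard
  places. A defined \<open>D\<close> would single out each \<open>\<emptyset>\<close>-definable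
  element by a standard number, although these elements are cofinal.\<close>

theorem TB_not_semantically_defines_DEF:
  assumes "infinite (UNIV :: 'a set)"
  shows "\<not> semantically_defines TYPE('a) TB DEF"
proof
  assume def: "semantically_defines TYPE('a) TB DEF"
  obtain K :: "nat fo_struct" and d \<delta>' where K: "pa_lang K {}" and d: "d \<in> domI K" "\<And>n. d \<noteq> num K n"
    and \<delta>': "arithmetical \<delta>'" "\<And>e. range e \<subseteq> domI K \<Longrightarrow> sat K e \<delta>' \<longleftrightarrow> e 0 = d"
    using nonstandard_definable by metis
  interpret K: pa_lang K "{}" by (rule K)
  define \<delta> where "\<delta> = subst (case_nat (Var 0) (\<lambda>_. Zero)) \<delta>'"
  have \<delta>: "arithmetical \<delta>" "fv \<delta> \<subseteq> {0}" "\<And>e. range e \<subseteq> domI K \<Longrightarrow> sat K e \<delta> \<longleftrightarrow> e 0 = d"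
    using \<delta>' fv_close K.sat_close by (simp_all add: \<delta>_def)
  let ?Ke = "\<lambda>_ :: nat. zeroI K"
  define A where "A k = {gn \<phi> | \<phi>. arithmetical \<phi> \<and> sentence \<phi> \<and> sat K ?Ke \<phi> \<and> gn \<phi> < k}" for k
  have "finite (A k)" for k
    by (rule finite_subset[of _ "{..<k}"]) (auto simp: A_def)
  then have "\<exists>t. \<forall>x. mem x t \<longleftrightarrow> x \<in> A k" for k
    using finite_set_coded by blast
  then obtain t where t: "\<And>k x. mem x (t k) \<longleftrightarrow> x \<in> A k" by metis
  obtain M0 :: "'a fo_struct" and c where M0: "pa_lang M0 {}" and c: "c \<in> domI M0"
    and los: "\<And>\<phi>. arithmetical \<phi> \<Longrightarrow> sat M0 (case_nat c (\<lambda>_. zeroI M0)) \<phi> \<longleftrightarrow>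
       eventually (\<lambda>k. sat K (case_nat (num K (t k)) ?Ke) \<phi>) ultra"
    and dfb: "\<And>x. x \<in> domI M0 \<Longrightarrow> \<exists>\<gamma>. arithmetical \<gamma> \<and> fv \<gamma> \<subseteq> {0, 1} \<and>
       (\<forall>e. range e \<subseteq> domI M0 \<longrightarrow> e 1 = c \<longrightarrow> (sat M0 e \<gamma> \<longleftrightarrow> e 0 = x))"
    using limit_model[OF assms K, of "\<lambda>k. num K (t k)"] K.num_in by auto
  interpret M0: pa_lang M0 "{}" by (rule M0)
  define M where "M = expand M0 PT mem_fm c"
  have M: "pa_lang M {PT}"
    unfolding M_def by (rule pa_lang_expand[OF M0 c arithmetical_mem_fm])
  interpret M: pa_lang M "{PT}" by (rule M)
  have sentences: "sat M0 e \<phi> \<longleftrightarrow> sat K ?Ke \<phi>" if "arithmetical \<phi>" "sentence \<phi>" for e \<phi>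
  proof -
    have "sat M0 e \<phi> \<longleftrightarrow> sat M0 (case_nat c (\<lambda>_. zeroI M0)) \<phi>"
      by (rule sat_sentence[OF that(2)])
    moreover have "sat K (case_nat (num K (t k)) ?Ke) \<phi> \<longleftrightarrow> sat K ?Ke \<phi>" for k
      by (rule sat_sentence[OF that(2)])
    ultimately show ?thesis using los[OF that(1)] by (simp add: ultra_const)
  qed
  have T: "relI M PT [num M0 (gn \<phi>)] \<longleftrightarrow> sat M0 e \<phi>" if \<phi>: "arithmetical \<phi>" "sentence \<phi>" for e \<phi>
  proof -
    let ?\<chi> = "subst (case_nat (numeral_tm (gn \<phi>)) Var) mem_fm"
    have env: "(\<lambda>i. eval M0 e (case_nat (numeral_tm n) Var i)) = case_nat (num M0 n) e" for n e
      by (auto split: nat.split)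
    have "relI M PT [num M0 (gn \<phi>)] \<longleftrightarrow> sat M0 (case_nat c (\<lambda>_. zeroI M0)) ?\<chi>"
      by (simp add: M_def sat_subst env)
    also have "\<dots> \<longleftrightarrow> eventually (\<lambda>k. mem (gn \<phi>) (t k)) ultra"
    proof -
      have "(\<lambda>i. eval K e (case_nat (numeral_tm n) Var i)) = case_nat (num K n) e" for n e
        by (auto split: nat.split)
      then show ?thesis
        using los[of ?\<chi>] arithmetical_mem_fm by (simp add: sat_subst K.sat_mem_fm)
    qed
    also have "\<dots> \<longleftrightarrow> eventually (\<lambda>k. sat K ?Ke \<phi>) ultra"
    proof -
      \<comment> \<open>From \<open>gn \<phi> < k\<close> on, membership in \<open>A k\<close> is
        truth of \<open>\<phi>\<close>; injectivity of the coding excludes another formula with the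
        same code.\<close>
      have "eventually (\<lambda>k. mem (gn \<phi>) (t k) \<longleftrightarrow> sat K ?Ke \<phi>) ultra"
        by (rule eventually_ultra[of "Suc (gn \<phi>)"]) (use \<phi> gn_inj in \<open>auto simp: t A_def\<close>)
      then show ?thesis by (simp only: ultra_iff)
    qed
    finally show ?thesis using sentences[OF \<phi>] by (simp add: ultra_const)
  qed
  have "models M (axms TB)"
    unfolding models_def
  proof (intro ballI allI impI)
    fix \<Phi> and e :: "nat \<Rightarrow> 'a"
    assume e: "range e \<subseteq> domI M" and "\<Phi> \<in> axms TB"
    then have "\<Phi> \<in> PA_minus \<or> \<Phi> \<in> Induction {PT} \<or>
      (\<exists>\<phi>. \<Phi> = Iff (Rel PT [quot \<phi>]) \<phi> \<and> arithmetical \<phi> \<and> sentence \<phi>)"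
      unfolding TB_def by auto
    then consider "\<Phi> \<in> PA_minus" | "\<Phi> \<in> Induction {PT}" |
      \<phi> where "\<Phi> = Iff (Rel PT [quot \<phi>]) \<phi>" "arithmetical \<phi>" "sentence \<phi>" by blast
    then show "sat M e \<Phi>"
    proof cases
      case 1
      then show ?thesis using M.base e unfolding models_def by blast
    next
      case 2
      then show ?thesis using M.models_Induction e unfolding models_def by blast
    next
      case 3
      have "eval M e (quot \<phi>) = num M0 (gn \<phi>)" by (simp add: quot_def M_def)
      then show ?thesis using T[OF 3(2,3), of e] 3 by (simp add: M_def sat_expand)
    qed
  qed
  moreover have "is_struct M" by (rule M.struct)
  ultimately obtain \<psi> e where \<psi>: "in_lang {PT} \<psi>" "range e \<subseteq> domI M"
    and ax: "\<And>\<Phi>. \<Phi> \<in> axms DEF \<Longrightarrow> sat M e (rel_subst PD \<psi> 0 \<Phi>)"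
    using def unfolding semantically_defines_def by (auto simp: TB_def DEF_def)
  have R: "sat M (case_nat (num M0 (gn \<beta>)) (case_nat y e)) \<psi> \<longleftrightarrow> y = b"
    if \<beta>: "arithmetical \<beta>" "fv \<beta> \<subseteq> {0}" "\<And>f. range f \<subseteq> domI M0 \<Longrightarrow> sat M0 f \<beta> \<longleftrightarrow> f 0 = b"
      and b: "b \<in> domI M0" and y: "y \<in> domI M0" for \<beta> b y
  proof -
    have "sat M e (rel_subst PD \<psi> 0 (Forall (Iff (Rel PD [quot \<beta>, Var 0]) (And (Exists1 \<beta>) \<beta>))))"
      by (rule ax) (use \<beta> in \<open>auto simp: DEF_def\<close>)
    then have "sat M (case_nat (num M0 (gn \<beta>)) (case_nat y e)) \<psi> \<longleftrightarrow> sat M (case_nat y e) (And (Exists1 \<beta>) \<beta>)"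
      using \<beta> y by (subst (asm) sat_rel_subst_binary) (simp_all add: M_def)
    also have "\<dots> \<longleftrightarrow> sat M0 (case_nat y e) (And (Exists1 \<beta>) \<beta>)"
      unfolding M_def by (rule sat_expand) (simp add: \<beta>)
    also have "\<dots> \<longleftrightarrow> y = b"
      using \<beta>(3) \<psi>(2) y b by (auto simp: sat_Exists1[OF \<beta>(2)] range_case_nat M_def)
    finally show ?thesis .
  qed
  \<comment> \<open>Unique existence is a sentence, so \<open>\<delta>\<close> also defines an
    element \<open>d'\<close> of \<open>M0\<close>.\<close>
  have "sat K ?Ke (Exists1 \<delta>)"
    using \<delta>(3) d(1) by (auto simp: sat_Exists1[OF \<delta>(2)] range_case_nat)
  moreover have "sentence (Exists1 \<delta>)"
    using \<delta>(2) by (rule sentence_Exists1)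
  ultimately have "\<exists>!x. x \<in> domI M0 \<and> sat M0 (case_nat x (\<lambda>_. zeroI M0)) \<delta>"
    using sentences[of "Exists1 \<delta>" "\<lambda>_. zeroI M0"] \<delta>(1) sat_Exists1[OF \<delta>(2), of M0] by simp
  then obtain d' where d': "d' \<in> domI M0"
    "\<And>x. x \<in> domI M0 \<Longrightarrow> sat M0 (case_nat x (\<lambda>_. zeroI M0)) \<delta> \<longleftrightarrow> x = d'" by blast
  have d'': "sat M0 f \<delta> \<longleftrightarrow> f 0 = d'" if "range f \<subseteq> domI M0" for f
  proof -
    have "sat M0 f \<delta> \<longleftrightarrow> sat M0 (case_nat (f 0) (\<lambda>_. zeroI M0)) \<delta>"
      by (rule sat_cong) (use \<delta>(2) in \<open>force\<close>)
    then show ?thesis using d' that by blast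
  qed
  \<comment> \<open>That \<open>\<delta>\<close> holds of the numeral of \<open>n\<close> is a
    sentence; it fails in \<open>K\<close>, hence in \<open>M0\<close>.\<close>
  have nonstd: "d' \<noteq> num M0 n" for n
  proof
    assume *: "d' = num M0 n"
    let ?\<chi> = "subst (\<lambda>_. numeral_tm n) \<delta>"
    have "sat M0 (\<lambda>_. zeroI M0) ?\<chi>" using d''[of "\<lambda>_. num M0 n"] * by (simp add: sat_subst)
    moreover have "sentence ?\<chi>" by (simp add: fv_subst)
    ultimately have "sat K ?Ke ?\<chi>" using sentences \<delta>(1) by simp
    then show False using \<delta>(3)[of "\<lambda>_. num K n"] d(2)[of n] by (auto simp: sat_subst)
  qed
  \<comment> \<open>All codes \<open>t k\<close> are standard in \<open>K\<close> and thus below the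
    nonstandard \<open>d\<close>, a fact expressible by one formula and inherited by the
    limit.\<close>
  have cd: "ltI M0 c d'"
  proof -
    let ?\<chi> = "Exists (And \<delta> (Lt (Var 1) (Var 0)))"
    have "sat K (case_nat (num K (t k)) ?Ke) ?\<chi>" for k
      using \<delta>(3)[of "case_nat d (case_nat (num K (t k)) ?Ke)"] d(1) K.nonstandard_above[OF d]
      by (auto simp: range_case_nat)
    then have "sat M0 (case_nat c (\<lambda>_. zeroI M0)) ?\<chi>"
      using los[of ?\<chi>] \<delta>(1) by (simp del: sat.simps)
    then obtain x where "x \<in> domI M0" "sat M0 (case_nat x (case_nat c (\<lambda>_. zeroI M0))) \<delta>" "ltI M0 c x"
      by auto
    then show ?thesis using d''[of "case_nat x (case_nat c (\<lambda>_. zeroI M0))"] c by (auto simp: range_case_nat)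
  qed
  define R where "R a x \<longleftrightarrow> sat M (case_nat a (case_nat x e)) \<psi>" for a x
  have "M.dfn2 R"
    unfolding M.dfn2_def R_def using dfn_sat[OF \<psi>(1)] \<psi>(2) by blast
  moreover have "d' \<in> domI M" "\<And>n. d' \<noteq> num M n"
    using d'(1) nonstd by (simp_all add: M_def)
  moreover have "\<exists>n. \<exists>x'\<in>domI M. (x = x' \<or> ltI M x x') \<and> (\<forall>y\<in>domI M. R (num M n) y \<longleftrightarrow> y = x')"
    if "x \<in> domI M" for x
  proof -
    have x: "x \<in> domI M0" using that by (simp add: M_def)
    obtain \<gamma> where \<gamma>: "arithmetical \<gamma>"
      "\<And>e. range e \<subseteq> domI M0 \<Longrightarrow> e 1 = c \<Longrightarrow> sat M0 e \<gamma> \<longleftrightarrow> e 0 = x"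
      using dfb[OF x] by blast
    let ?g = "\<lambda>x a. sat M0 (case_nat x (case_nat a (\<lambda>_. zeroI M0))) \<gamma>"
    \<comment> \<open>\<open>x\<close> is defined from \<open>c\<close> by \<open>\<gamma>\<close>.
      For other values \<open>a\<close> of the parameter \<open>\<gamma>\<close> need not define
      anything, so only unique solutions are kept; this makes the values bounded for each
      \<open>a\<close>.\<close>
    define G where "G a x \<longleftrightarrow> ?g x a \<and> (\<forall>y\<in>domI M0. ?g y a \<longrightarrow> y = x)" for a x
    have g: "dfn M0 {} (\<lambda>f. ?g (f i) (f j))" for i j
    proof -
      have "(\<lambda>k. eval M0 f (case_nat (Var i) (case_nat (Var j) (\<lambda>_. Zero)) k)) =
          case_nat (f i) (case_nat (f j) (\<lambda>_. zeroI M0))" for f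
        by (auto split: nat.split)
      then show ?thesis
        using dfn_subst[OF M0.struct dfn_sat[OF \<gamma>(1)], of "case_nat (Var i) (case_nat (Var j) (\<lambda>_. Zero))"]
        by simp
    qed
    have G: "dfn M0 {} (\<lambda>f. G (f i) (f j))" for i j
      unfolding G_def by (intro dfn_intros g)
    have "M0.dfn2 G"
      unfolding M0.dfn2_def using G[of 0 1]
      by (intro exI[of _ "\<lambda>f. G (f 0) (f 1)"] exI[of _ "\<lambda>_. zeroI M0"]) auto
    moreover have "\<exists>y\<in>domI M0. \<forall>x\<in>domI M0. G a x \<longrightarrow> ltI M0 x y" for a
    proof (cases "\<exists>x\<in>domI M0. G a x")
      case True
      then obtain x where x: "x \<in> domI M0" "G a x" by blast
      show ?thesis
      proof (intro bexI[of _ "addI M0 x (oneI M0)"] ballI impI)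
        fix y assume "y \<in> domI M0" "G a y"
        then have "y = x" using x unfolding G_def by blast
        then show "ltI M0 y (addI M0 x (oneI M0))" using M0.lt_Suc[OF x(1)] by simp
      qed (use x(1) in simp)
    qed (use M0.zero_in in blast)
    ultimately have ex: "\<exists>y\<in>domI M0. \<forall>a\<in>domI M0. ltI M0 a d' \<longrightarrow> (\<forall>x\<in>domI M0. G a x \<longrightarrow> ltI M0 x y)"
      using M0.bounding[OF _ d'(1)] by blast
    \<comment> \<open>Bounding over all \<open>a < d'\<close> removes \<open>c\<close>: since
      \<open>d'\<close> is \<open>\<emptyset>\<close>-definable, so is the least bound
      \<open>b\<close>, and it exceeds \<open>x\<close> because \<open>c < d'\<close>.\<close>
    define B where "B y \<longleftrightarrow> (\<forall>a\<in>domI M0. ltI M0 a d' \<longrightarrow> (\<forall>x\<in>domI M0. G a x \<longrightarrow> ltI M0 x y))" for y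
    have "dfn M0 {} (\<lambda>f. f 0 = d')"
      unfolding dfn_def using \<delta>(1) d'' by blast
    then have eq_d': "dfn M0 {} (\<lambda>f. f i = d')" for i
      using dfn_reindex[OF M0.struct, of _ _ "\<lambda>_. i"] by blast
    have lt_d': "dfn M0 {} (\<lambda>f. ltI M0 (f i) d')" for i
    proof (rule dfn_cong)
      show "dfn M0 {} (\<lambda>f. \<exists>z\<in>domI M0. z = d' \<and> ltI M0 (f i) z)"
        by (intro dfn_intros eq_d')
    qed (use d'(1) in blast)
    have B: "dfn M0 {} (\<lambda>f. B (f i))" for i
      unfolding B_def by (intro dfn_intros lt_d' G)
    obtain b where b: "b \<in> domI M0" "B b" "\<And>y. y \<in> domI M0 \<Longrightarrow> ltI M0 y b \<Longrightarrow> \<not> B y"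
    proof -
      have "\<exists>x\<in>domI M0. B x \<and> (\<forall>y\<in>domI M0. ltI M0 y x \<longrightarrow> \<not> B y)"
        using M0.dfn_least[OF B[of 0], of "\<lambda>_. zeroI M0"] ex unfolding B_def[symmetric] by auto
      then show thesis using that by blast
    qed
    have "dfn M0 {} (\<lambda>f. B (f 0) \<and> (\<forall>y\<in>domI M0. ltI M0 y (f 0) \<longrightarrow> \<not> B y))"
      by (intro dfn_intros B)
    then obtain \<beta>' where \<beta>': "arithmetical \<beta>'"
      "\<And>f. range f \<subseteq> domI M0 \<Longrightarrow> sat M0 f \<beta>' \<longleftrightarrow> B (f 0) \<and> (\<forall>y\<in>domI M0. ltI M0 y (f 0) \<longrightarrow> \<not> B y)"
      unfolding dfn_def by blast
    have "sat M0 f \<beta>' \<longleftrightarrow> f 0 = b" if f: "range f \<subseteq> domI M0" for f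
    proof -
      have "f 0 \<in> domI M0" using f by blast
      then show ?thesis using \<beta>'(2)[OF f] b M0.lt_linear[of "f 0" b b] by blast
    qed
    note close = M0.sat_close[OF _ this]
    let ?\<beta> = "subst (case_nat (Var 0) (\<lambda>_. Zero)) \<beta>'"
    have "R (num M0 (gn ?\<beta>)) y \<longleftrightarrow> y = b" if "y \<in> domI M0" for y
      unfolding R_def by (rule R) (use \<beta>'(1) fv_close close b(1) that in auto)
    moreover have "G c x"
      unfolding G_def using \<gamma>(2) x c by (auto simp: range_case_nat)
    then have "ltI M0 x b" using b(2) cd c x unfolding B_def by blast
    ultimately show ?thesis using b(1) by (intro exI[of _ "gn ?\<beta>"] bexI[of _ b]) (auto simp: M_def)
  qed
  ultimately show False by (rule M.no_cofinal_enumeration)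
qed

lemma sat_unary: "fv \<phi> \<subseteq> {0} \<Longrightarrow> e 0 = e' 0 \<Longrightarrow> sat M e \<phi> \<longleftrightarrow> sat M e' \<phi>"
  by (rule sat_cong) auto

theorem DEF_not_semantically_defines_USB:
  assumes "infinite (UNIV :: 'a set)"
  shows "\<not> semantically_defines TYPE('a) DEF USB"
proof
  assume def: "semantically_defines TYPE('a) DEF USB"
  let ?N = Nat_struct and ?Ne = "\<lambda>_ :: nat. 0 :: nat"
  \<comment> \<open>Each formula contributes at most one pair, so the part of \<open>D\<close> for
    formulas with code below \<open>k\<close> is finite and has a standard code.\<close>
  define A where "A k = {pair (gn \<phi>) y | \<phi> y. arithmetical \<phi> \<and> fv \<phi> \<subseteq> {0} \<and> gn \<phi> < k \<and>
    (\<exists>!x. sat ?N (case_nat x ?Ne) \<phi>) \<and> sat ?N (case_nat y ?Ne) \<phi>}" for k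
  have "finite (A k)" for k
  proof (rule finite_subset)
    show "A k \<subseteq> (\<lambda>n. pair n (THE x. sat ?N (case_nat x ?Ne) (dfm n))) ` {..<k}"
      unfolding A_def by (auto intro!: image_eqI the1_equality[symmetric])
  qed simp
  then have "\<exists>t\<ge>k. \<forall>x. mem x t \<longleftrightarrow> x \<in> A k" for k
    using finite_set_coded by blast
  then obtain t where t: "\<And>k. k \<le> t k" "\<And>k x. mem x (t k) \<longleftrightarrow> x \<in> A k" by metis
  have "arith (\<lambda>f. mem (pair (f 0) (f 1)) (f 2))"
    by (intro arith_mem arith_intros)
  then obtain \<delta> where \<delta>: "arithmetical \<delta>" "\<And>f. sat ?N f \<delta> \<longleftrightarrow> mem (pair (f 0) (f 1)) (f 2)"
    unfolding dfn_def by auto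
  obtain M0 :: "'a fo_struct" and c where M0: "pa_lang M0 {}" and c: "c \<in> domI M0"
    and los: "\<And>\<phi>. arithmetical \<phi> \<Longrightarrow> sat M0 (case_nat c (\<lambda>_. zeroI M0)) \<phi> \<longleftrightarrow>
       eventually (\<lambda>k. sat ?N (case_nat (t k) ?Ne) \<phi>) ultra"
    and dfb: "\<And>x. x \<in> domI M0 \<Longrightarrow> \<exists>\<gamma>. arithmetical \<gamma> \<and> fv \<gamma> \<subseteq> {0, 1} \<and>
       (\<forall>e. range e \<subseteq> domI M0 \<longrightarrow> e 1 = c \<longrightarrow> (sat M0 e \<gamma> \<longleftrightarrow> e 0 = x))"
    using limit_model[OF assms pa_lang_Nat, of t] by auto
  interpret M0: pa_lang M0 "{}" by (rule M0)
  define M where "M = expand M0 PD \<delta> c"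
  have M: "pa_lang M {PD}"
    unfolding M_def by (rule pa_lang_expand[OF M0 c \<delta>(1)])
  interpret M: pa_lang M "{PD}" by (rule M)
  have D: "relI M PD [num M0 (gn \<phi>), y] \<longleftrightarrow> sat M0 (case_nat y e) (And (Exists1 \<phi>) \<phi>)"
    if \<phi>: "arithmetical \<phi>" "fv \<phi> \<subseteq> {0}" and y: "y \<in> domI M0" for e \<phi> y
  proof -
    let ?\<sigma> = "case_nat (numeral_tm (gn \<phi>)) Var"
    \<comment> \<open>The whole axiom is transferred as a single formula in the parameter
      \<open>c\<close>, so it holds at nonstandard arguments too.\<close>
    let ?\<chi> = "Forall (Iff (subst ?\<sigma> \<delta>) (And (Exists1 \<phi>) \<phi>))"
    have envM: "(\<lambda>i. eval M0 e (?\<sigma> i)) = case_nat (num M0 (gn \<phi>)) e" for e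
      by (auto split: nat.split)
    have envN: "(\<lambda>i. eval ?N e (?\<sigma> i)) = case_nat (gn \<phi>) e" for e
      by (auto split: nat.split)
    have "fv (And (Exists1 \<phi>) \<phi>) \<subseteq> {0}" using \<phi> sentence_Exists1 by simp
    note irr = sat_unary[OF this]
    have "sat ?N (case_nat (t k) ?Ne) ?\<chi>" if k: "Suc (gn \<phi>) \<le> k" for k
    proof -
      have "mem (pair (gn \<phi>) y) (t k) \<longleftrightarrow> sat ?N (case_nat y (case_nat (t k) ?Ne)) (And (Exists1 \<phi>) \<phi>)" for y
      proof -
        have "mem (pair (gn \<phi>) y) (t k) \<longleftrightarrow> (\<exists>!x. sat ?N (case_nat x ?Ne) \<phi>) \<and> sat ?N (case_nat y ?Ne) \<phi>"
        proof
          assume "mem (pair (gn \<phi>) y) (t k)"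
          then obtain \<phi>' where "arithmetical \<phi>'" "gn \<phi> = gn \<phi>'"
            "\<exists>!x. sat ?N (case_nat x ?Ne) \<phi>'" "sat ?N (case_nat y ?Ne) \<phi>'"
            unfolding t(2) A_def by (auto simp: prod_encode_eq)
          then show "(\<exists>!x. sat ?N (case_nat x ?Ne) \<phi>) \<and> sat ?N (case_nat y ?Ne) \<phi>"
            using gn_inj[OF \<phi>(1)] by metis
        next
          assume "(\<exists>!x. sat ?N (case_nat x ?Ne) \<phi>) \<and> sat ?N (case_nat y ?Ne) \<phi>"
          then show "mem (pair (gn \<phi>) y) (t k)"
            unfolding t(2) A_def using \<phi> k by auto
        qed
        also have "\<dots> \<longleftrightarrow> sat ?N (case_nat y ?Ne) (And (Exists1 \<phi>) \<phi>)"
        proof -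
          have "sat ?N (case_nat x (case_nat y ?Ne)) \<phi> \<longleftrightarrow> sat ?N (case_nat x ?Ne) \<phi>" for x
            by (rule sat_unary[OF \<phi>(2)]) simp
          then show ?thesis by (simp add: sat_Exists1[OF \<phi>(2)])
        qed
        also have "\<dots> \<longleftrightarrow> sat ?N (case_nat y (case_nat (t k) ?Ne)) (And (Exists1 \<phi>) \<phi>)"
          by (rule irr) simp
        finally show ?thesis .
      qed
      then show ?thesis
        unfolding sat.simps(6) sat_Iff sat_subst envN by (simp only: \<delta>(2)) (simp add: numeral_2_eq_2)
    qed
    then have "eventually (\<lambda>k. sat ?N (case_nat (t k) ?Ne) ?\<chi>) ultra"
      by (rule eventually_ultra)
    moreover have "arithmetical ?\<chi>" using \<delta>(1) \<phi>(1) by simp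
    ultimately have "sat M0 (case_nat c (\<lambda>_. zeroI M0)) ?\<chi>"
      using los by blast
    then have "sat M0 (case_nat (num M0 (gn \<phi>)) (case_nat y (case_nat c (\<lambda>_. zeroI M0)))) \<delta> \<longleftrightarrow>
        sat M0 (case_nat y (case_nat c (\<lambda>_. zeroI M0))) (And (Exists1 \<phi>) \<phi>)"
      unfolding sat.simps(6) sat_Iff sat_subst envM using y by blast
    also have "\<dots> \<longleftrightarrow> sat M0 (case_nat y e) (And (Exists1 \<phi>) \<phi>)"
      by (rule irr) simp
    finally show ?thesis by (simp add: M_def)
  qed
  have "models M (axms DEF)"
    unfolding models_def
  proof (intro ballI allI impI)
    fix \<Phi> and e :: "nat \<Rightarrow> 'a"
    assume e: "range e \<subseteq> domI M" and "\<Phi> \<in> axms DEF"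
    then have "\<Phi> \<in> PA_minus \<or> \<Phi> \<in> Induction {PD} \<or>
      (\<exists>\<phi>. \<Phi> = Forall (Iff (Rel PD [quot \<phi>, Var 0]) (And (Exists1 \<phi>) \<phi>)) \<and> arithmetical \<phi> \<and> fv \<phi> \<subseteq> {0})"
      unfolding DEF_def by auto
    then consider "\<Phi> \<in> PA_minus" | "\<Phi> \<in> Induction {PD}" |
      \<phi> where "\<Phi> = Forall (Iff (Rel PD [quot \<phi>, Var 0]) (And (Exists1 \<phi>) \<phi>))"
        "arithmetical \<phi>" "fv \<phi> \<subseteq> {0}" by blast
    then show "sat M e \<Phi>"
    proof cases
      case 1
      then show ?thesis using M.base e unfolding models_def by blast
    next
      case 2
      then show ?thesis using M.models_Induction e unfolding models_def by blast
    next
      case 3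
      have 4: "sat M f (And (Exists1 \<phi>) \<phi>) \<longleftrightarrow> sat M0 f (And (Exists1 \<phi>) \<phi>)" for f
        unfolding M_def by (rule sat_expand) (simp add: 3)
      have "map (eval M (case_nat y e)) [quot \<phi>, Var 0] = [num M0 (gn \<phi>), y]" for y
        by (simp add: quot_def M_def)
      then show ?thesis
        using D[OF 3(2,3)] unfolding 3(1) sat.simps(6) sat_Iff 4 by (simp add: M_def)
    qed
  qed
  moreover have "is_struct M" by (rule M.struct)
  ultimately obtain \<psi> e where \<psi>: "in_lang {PD} \<psi>" "range e \<subseteq> domI M"
    and ax: "\<And>\<Phi>. \<Phi> \<in> axms USB \<Longrightarrow> sat M e (rel_subst PS \<psi> 0 \<Phi>)"
    using def unfolding semantically_defines_def by (auto simp: USB_def DEF_def)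
  have S: "sat M (case_nat (num M0 (gn \<phi>)) (case_nat y e)) \<psi> \<longleftrightarrow> sat M0 (case_nat y e) \<phi>"
    if \<phi>: "arithmetical \<phi>" "fv \<phi> \<subseteq> {0}" and y: "y \<in> domI M0" for \<phi> y
  proof -
    have "sat M e (rel_subst PS \<psi> 0 (Forall (Iff (Rel PS [quot \<phi>, Var 0]) \<phi>)))"
      by (rule ax) (use \<phi> in \<open>auto simp: USB_def\<close>)
    then show ?thesis
      using \<phi> y by (subst (asm) sat_rel_subst_binary) (simp_all add: M_def sat_expand)
  qed
  \<comment> \<open>Since \<open>t k \<ge> k\<close>, no standard value is taken eventually.\<close>
  have nonstd: "c \<noteq> num M0 n" for n
  proof
    assume "c = num M0 n"
    then have "sat M0 (case_nat c (\<lambda>_. zeroI M0)) (Eq (Var 0) (numeral_tm n))" by simp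
    then have "eventually (\<lambda>k. t k = n) ultra" using los[of "Eq (Var 0) (numeral_tm n)"] by simp
    moreover have "eventually (\<lambda>k. t k \<noteq> n) ultra"
      by (rule eventually_ultra[of "Suc n"]) (use t(1) in \<open>metis Suc_n_not_le_n le_trans\<close>)
    ultimately show False by (simp add: ultra_not)
  qed
  let ?z = "\<lambda>x c. addI M0 (mulI M0 (addI M0 x c) (addI M0 x c)) x"
  have z_inj: "x = x' \<and> a = a'"
    if "x \<in> domI M0" "a \<in> domI M0" "x' \<in> domI M0" "a' \<in> domI M0" "?z x a = ?z x' a'" for x a x' a'
  proof -
    \<comment> \<open>Injectivity is a true sentence of arithmetic and so holds in the limit.
      Indices 3, 2, 1, 0 of \<open>?\<chi>\<close> stand for \<open>x\<close>, \<open>a\<close>,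
      \<open>x'\<close>, \<open>a'\<close>.\<close>
    let ?t = "\<lambda>i j. Add (Mul (Add (Var i) (Var j)) (Add (Var i) (Var j))) (Var i)"
    let ?\<chi> = "let i = Suc 0; j = Suc i; k = Suc j in
      Forall (Forall (Forall (Forall (Imp (Eq (?t k j) (?t i 0))
        (And (Eq (Var k) (Var i)) (Eq (Var j) (Var 0)))))))"
    have inj: "x = x' \<and> a = a'" if "(x + a) * (x + a) + x = (x' + a') * (x' + a') + x'" for x a x' a' :: nat
    proof -
      \<comment> \<open>The value lies between \<open>(x + a)^2\<close> and
        \<open>(x + a + 1)^2\<close>, the latter excluded; so it determines \<open>x + a\<close>,
        and then \<open>x\<close>.\<close>
      have less: "(x + a) * (x + a) + x < (y + b) * (y + b) + y" if "x + a < y + b" for x a y b :: nat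
      proof -
        have "Suc (x + a) * Suc (x + a) \<le> (y + b) * (y + b)" using that by (intro mult_le_mono) auto
        then show ?thesis by simp
      qed
      have "x + a = x' + a'" using less[of x a x' a'] less[of x' a' x a] that by linarith
      then show ?thesis using that by simp
    qed
    have "sat ?N f ?\<chi>" for f
      by (simp only: Let_def sat.simps eval.simps Nat_struct_simps nat.case, intro ballI impI, drule inj, simp)
    then have "eventually (\<lambda>k. sat ?N (case_nat (t k) ?Ne) ?\<chi>) ultra"
      by (intro always_eventually allI)
    moreover have "arithmetical ?\<chi>" by (simp add: Let_def)
    ultimately have "sat M0 (case_nat c (\<lambda>_. zeroI M0)) ?\<chi>" using los by blast
    then show ?thesis
      unfolding Let_def sat.simps eval.simps nat.case using that by blast
  qed
  have z_in: "?z x a \<in> domI M0" if "x \<in> domI M0" "a \<in> domI M0" for x a using that by simp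
  \<comment> \<open>\<open>R a\<close> tests the formula coded by \<open>a\<close> at the pair of
    \<open>x\<close> and \<open>c\<close>; \<open>c\<close> becomes a parameter of this
    relation.\<close>
  define R where "R a x \<longleftrightarrow> sat M (case_nat a (case_nat (?z x c) e)) \<psi>" for a x
  have "M.dfn2 R"
  proof -
    let ?x = "Add (Mul (Add (Var 1) (Var 2)) (Add (Var 1) (Var 2))) (Var 1)"
    let ?\<sigma> = "case_nat (Var 0) (case_nat ?x (\<lambda>i. Var (i + 3)))"
    have "(\<lambda>i. eval M (case_nat a (case_nat x (case_nat c e))) (?\<sigma> i)) = case_nat a (case_nat (?z x c) e)" for a x
      by (auto simp: M_def eval_nat_numeral split: nat.split)
    then have "R a x \<longleftrightarrow> sat M (case_nat a (case_nat x (case_nat c e))) (subst ?\<sigma> \<psi>)" for a x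
      by (simp only: R_def sat_subst)
    moreover have "dfn M {PD} (\<lambda>f. sat M f (subst ?\<sigma> \<psi>))"
      by (rule dfn_sat) (simp add: \<psi>)
    moreover have "range (case_nat c e) \<subseteq> domI M" using \<psi>(2) c by (simp add: range_case_nat M_def)
    ultimately show ?thesis unfolding M.dfn2_def by blast
  qed
  moreover have "c \<in> domI M" "\<And>n. c \<noteq> num M n"
    using c nonstd by (simp_all add: M_def)
  moreover have "\<exists>n. \<exists>x'\<in>domI M. (x = x' \<or> ltI M x x') \<and> (\<forall>y\<in>domI M. R (num M n) y \<longleftrightarrow> y = x')"
    if "x \<in> domI M" for x
  proof -
    have x: "x \<in> domI M0" using that by (simp add: M_def)
    obtain \<gamma> where \<gamma>: "arithmetical \<gamma>" "fv \<gamma> \<subseteq> {0, 1}"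
      "\<And>e. range e \<subseteq> domI M0 \<Longrightarrow> e 1 = c \<Longrightarrow> sat M0 e \<gamma> \<longleftrightarrow> e 0 = x"
      using dfb[OF x] by blast
    let ?x = "Add (Mul (Add (Var 0) (Var 1)) (Add (Var 0) (Var 1))) (Var 0)"
    \<comment> \<open>\<open>\<phi>\<close> unpacks its argument and applies \<open>\<gamma>\<close>
      to the components. It may hold of other pairs, but among those with second component
      \<open>c\<close> only of the one whose first component is \<open>x\<close>.\<close>
    define \<phi> where "\<phi> = Exists (Exists (And (Eq (Var 2) ?x) \<gamma>))"
    have "arithmetical \<phi>" using \<gamma>(1) by (simp add: \<phi>_def)
    moreover have "fv \<phi> \<subseteq> {0}" using \<gamma>(2) by (auto simp: \<phi>_def)
    moreover have "sat M0 (case_nat (?z y c) e) \<phi> \<longleftrightarrow> y = x" if y: "y \<in> domI M0" for y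
    proof -
      have e: "range e \<subseteq> domI M0" using \<psi>(2) by (simp add: M_def)
      have "sat M0 (case_nat (?z y c) e) \<phi> \<longleftrightarrow> (\<exists>a\<in>domI M0. \<exists>x'\<in>domI M0. ?z y c = ?z x' a \<and>
          sat M0 (case_nat x' (case_nat a (case_nat (?z y c) e))) \<gamma>)"
        by (simp add: \<phi>_def eval_nat_numeral cong: conj_cong)
      also have "\<dots> \<longleftrightarrow> sat M0 (case_nat y (case_nat c (case_nat (?z y c) e))) \<gamma>"
        using z_inj[OF y c] y c by metis
      also have "\<dots> \<longleftrightarrow> y = x"
        using \<gamma>(3)[of "case_nat y (case_nat c (case_nat (?z y c) e))"] y c e z_in[OF y c]
        by (simp add: range_case_nat)
      finally show ?thesis .
    qed
    ultimately have "R (num M (gn \<phi>)) y \<longleftrightarrow> y = x" if "y \<in> domI M" for y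
      using S[of \<phi> "?z y c"] z_in[OF _ c] that unfolding R_def M_def by simp
    then show ?thesis using that by blast
  qed
  ultimately show False by (rule M.no_cofinal_enumeration)
qed

section \<open>Derived rules\<close>

lemma weaken: "\<Gamma> \<turnstile> \<phi> \<Longrightarrow> \<Gamma> \<subseteq> \<Delta> \<Longrightarrow> \<Delta> \<turnstile> \<phi>"
proof (induction arbitrary: \<Delta> rule: derives.induct)
  case (ImpI \<phi> \<Gamma> \<psi>)
  have "insert \<phi> \<Delta> \<turnstile> \<psi>" by (rule ImpI.IH) (use ImpI.prems in blast)
  then show ?case by (rule derives.ImpI)
next
  case (Contr \<phi> \<Gamma>)
  have "insert (Neg \<phi>) \<Delta> \<turnstile> Falsum" by (rule Contr.IH) (use Contr.prems in blast)
  then show ?case by (rule derives.Contr)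
next
  case (ForallI \<Gamma> \<phi>)
  have "lift ` \<Delta> \<turnstile> \<phi>" by (rule ForallI.IH) (use ForallI.prems in blast)
  then show ?case by (rule derives.ForallI)
next
  case (Assm \<phi> \<Gamma>)
  then show ?case by (intro derives.Assm) blast
next
  case (ImpE \<Gamma> \<phi> \<psi>)
  then show ?case by (blast intro: derives.ImpE)
next
  case (ForallE \<Gamma> \<phi> t)
  then show ?case by (blast intro: derives.ForallE)
next
  case (EqI \<Gamma> t)
  show ?case by (rule derives.EqI)
next
  case (EqE \<Gamma> s t \<phi>)
  then show ?case by (blast intro: derives.EqE)
qed

lemma assm_insert: "insert \<phi> \<Gamma> \<turnstile> \<phi>"
  by (rule Assm) simp

lemma weaken_insert: "\<Gamma> \<turnstile> \<psi> \<Longrightarrow> insert \<phi> \<Gamma> \<turnstile> \<psi>"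
  by (erule weaken) blast

lemma FalsumE: "\<Gamma> \<turnstile> Falsum \<Longrightarrow> \<Gamma> \<turnstile> \<phi>"
  by (rule Contr) (rule weaken_insert)

lemma AndI: "\<Gamma> \<turnstile> \<phi> \<Longrightarrow> \<Gamma> \<turnstile> \<psi> \<Longrightarrow> \<Gamma> \<turnstile> And \<phi> \<psi>"
  by (rule ImpI) (rule ImpE[OF ImpE[OF assm_insert weaken_insert] weaken_insert])

lemma AndE1: "\<Gamma> \<turnstile> And \<phi> \<psi> \<Longrightarrow> \<Gamma> \<turnstile> \<phi>"
proof (rule Contr)
  assume *: "\<Gamma> \<turnstile> And \<phi> \<psi>"
  have "insert \<phi> (insert (Neg \<phi>) \<Gamma>) \<turnstile> Falsum"
    by (rule ImpE[OF weaken_insert[OF assm_insert] assm_insert])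
  then have "insert (Neg \<phi>) \<Gamma> \<turnstile> Imp \<phi> (Neg \<psi>)"
    by (rule ImpI[OF FalsumE])
  then show "insert (Neg \<phi>) \<Gamma> \<turnstile> Falsum"
    by (rule ImpE[OF weaken_insert[OF *]])
qed

lemma AndE2: "\<Gamma> \<turnstile> And \<phi> \<psi> \<Longrightarrow> \<Gamma> \<turnstile> \<psi>"
proof (rule Contr)
  assume *: "\<Gamma> \<turnstile> And \<phi> \<psi>"
  have "insert (Neg \<psi>) \<Gamma> \<turnstile> Imp \<phi> (Neg \<psi>)"
    by (rule ImpI) (rule weaken_insert[OF assm_insert])
  then show "insert (Neg \<psi>) \<Gamma> \<turnstile> Falsum"
    by (rule ImpE[OF weaken_insert[OF *]])
qed

lemma OrE:
  assumes "\<Gamma> \<turnstile> Or \<phi> \<psi>" "insert \<phi> \<Gamma> \<turnstile> \<chi>" "insert \<psi> \<Gamma> \<turnstile> \<chi>"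
  shows "\<Gamma> \<turnstile> \<chi>"
proof (rule Contr)
  let ?\<Gamma> = "insert (Neg \<chi>) \<Gamma>"
  have "insert \<phi> ?\<Gamma> \<turnstile> Falsum" "insert \<psi> ?\<Gamma> \<turnstile> Falsum"
    by (rule ImpE[OF Assm weaken[OF assms(2)]] ImpE[OF Assm weaken[OF assms(3)]]; blast)+
  from this[THEN ImpI] have n: "?\<Gamma> \<turnstile> Neg \<phi>" "?\<Gamma> \<turnstile> Neg \<psi>"
    by simp_all
  show "?\<Gamma> \<turnstile> Falsum"
    by (rule ImpE[OF n(2) ImpE[OF weaken_insert[OF assms(1)] n(1)]])
qed

lemma IffI: "insert \<phi> \<Gamma> \<turnstile> \<psi> \<Longrightarrow> insert \<psi> \<Gamma> \<turnstile> \<phi> \<Longrightarrow> \<Gamma> \<turnstile> Iff \<phi> \<psi>"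
  by (rule AndI[OF ImpI ImpI])

lemma IffD1: "\<Gamma> \<turnstile> Iff \<phi> \<psi> \<Longrightarrow> \<Gamma> \<turnstile> \<phi> \<Longrightarrow> \<Gamma> \<turnstile> \<psi>"
  by (rule ImpE[OF AndE1])

lemma IffD2: "\<Gamma> \<turnstile> Iff \<phi> \<psi> \<Longrightarrow> \<Gamma> \<turnstile> \<psi> \<Longrightarrow> \<Gamma> \<turnstile> \<phi>"
  by (rule ImpE[OF AndE2])

lemma inst_simps [simp]:
  "inst t (Imp \<phi> \<psi>) = Imp (inst t \<phi>) (inst t \<psi>)" "inst t Falsum = Falsum"
  "inst t (Eq s u) = Eq (subst_tm (case_nat t Var) s) (subst_tm (case_nat t Var) u)"
  "inst t (Lt s u) = Lt (subst_tm (case_nat t Var) s) (subst_tm (case_nat t Var) u)"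
  "inst t (Rel r ts) = Rel r (map (subst_tm (case_nat t Var)) ts)"
  by (simp_all add: inst_def)

lemma lift_simps [simp]:
  "lift (Imp \<phi> \<psi>) = Imp (lift \<phi>) (lift \<psi>)" "lift Falsum = Falsum"
  by (simp_all add: lift_def)

abbreviation shift :: "tm \<Rightarrow> tm" where "shift \<equiv> subst_tm (\<lambda>j. Var (Suc j))"

lemma subst_shift [simp]: "subst_tm (case_nat t Var) (shift s) = s"
  by (simp add: subst_tm_subst_tm)

lemma lift_sentence: "sentence \<phi> \<Longrightarrow> lift \<phi> = \<phi>"
  unfolding lift_def by (rule subst_id) simp

lemma ExI: "\<Gamma> \<turnstile> inst t \<phi> \<Longrightarrow> \<Gamma> \<turnstile> Exists \<phi>"
proof (rule ImpI)
  assume *: "\<Gamma> \<turnstile> inst t \<phi>"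
  have "insert (Forall (Neg \<phi>)) \<Gamma> \<turnstile> inst t (Neg \<phi>)"
    by (rule ForallE[OF assm_insert])
  then show "insert (Forall (Neg \<phi>)) \<Gamma> \<turnstile> Falsum"
    using weaken_insert[OF *] unfolding inst_simps by (rule ImpE)
qed

lemma ExE:
  assumes "\<Gamma> \<turnstile> Exists \<phi>" "insert \<phi> (lift ` \<Gamma>) \<turnstile> lift \<chi>"
  shows "\<Gamma> \<turnstile> \<chi>"
proof (rule Contr)
  let ?\<Delta> = "insert (Neg \<chi>) \<Gamma>"
  have "insert \<phi> (lift ` ?\<Delta>) \<turnstile> lift \<chi>"
    using assms(2) by (rule weaken) auto
  then have "insert \<phi> (lift ` ?\<Delta>) \<turnstile> Falsum"
    by (rule ImpE[rotated]) (rule Assm, simp)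
  then have "?\<Delta> \<turnstile> Forall (Neg \<phi>)"
    by (rule ForallI[OF ImpI])
  then show "?\<Delta> \<turnstile> Falsum"
    by (rule ImpE[OF weaken_insert[OF assms(1)]])
qed

lemma eq_sym: "\<Gamma> \<turnstile> Eq s t \<Longrightarrow> \<Gamma> \<turnstile> Eq t s"
  using EqE[of \<Gamma> s t "Eq (Var 0) (shift s)"] by (simp add: EqI)

lemma eq_trans: "\<Gamma> \<turnstile> Eq s t \<Longrightarrow> \<Gamma> \<turnstile> Eq t u \<Longrightarrow> \<Gamma> \<turnstile> Eq s u"
  using EqE[of \<Gamma> t u "Eq (shift s) (Var 0)"] by simp

lemma add_cong: "\<Gamma> \<turnstile> Eq s s' \<Longrightarrow> \<Gamma> \<turnstile> Eq t t' \<Longrightarrow> \<Gamma> \<turnstile> Eq (Add s t) (Add s' t')"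
  using EqE[of \<Gamma> s s' "Eq (Add (shift s) (shift t)) (Add (Var 0) (shift t))"]
    EqE[of \<Gamma> t t' "Eq (Add (shift s) (shift t)) (Add (shift s') (Var 0))"] by (simp add: EqI)

lemma mul_cong: "\<Gamma> \<turnstile> Eq s s' \<Longrightarrow> \<Gamma> \<turnstile> Eq t t' \<Longrightarrow> \<Gamma> \<turnstile> Eq (Mul s t) (Mul s' t')"
  using EqE[of \<Gamma> s s' "Eq (Mul (shift s) (shift t)) (Mul (Var 0) (shift t))"]
    EqE[of \<Gamma> t t' "Eq (Mul (shift s) (shift t)) (Mul (shift s') (Var 0))"] by (simp add: EqI)

lemma lt_cong: "\<Gamma> \<turnstile> Eq s s' \<Longrightarrow> \<Gamma> \<turnstile> Eq t t' \<Longrightarrow> \<Gamma> \<turnstile> Lt s t \<Longrightarrow> \<Gamma> \<turnstile> Lt s' t'"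
  using EqE[of \<Gamma> s s' "Lt (Var 0) (shift t)"] EqE[of \<Gamma> t t' "Lt (shift s') (Var 0)"] by simp

section \<open>Arithmetic inside the base theory\<close>

lemma base_instance:
  assumes "PA_minus \<subseteq> \<Gamma>" "Forall (Forall (Forall \<phi>)) \<in> PA_minus"
  shows "\<Gamma> \<turnstile> subst (case_nat a (case_nat b (case_nat c Var))) \<phi>"
proof -
  let ?c = "case_nat c Var" and ?b = "case_nat b Var" and ?a = "case_nat a Var"
  have "\<Gamma> \<turnstile> inst c (Forall (Forall \<phi>))"
    by (rule ForallE, rule Assm) (use assms in blast)
  then have "\<Gamma> \<turnstile> Forall (Forall (subst (up (up ?c)) \<phi>))"
    by (simp add: inst_def)
  then have "\<Gamma> \<turnstile> inst b (Forall (subst (up (up ?c)) \<phi>))"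
    by (rule ForallE)
  then have "\<Gamma> \<turnstile> Forall (subst (up ?b) (subst (up (up ?c)) \<phi>))"
    by (simp add: inst_def)
  then have "\<Gamma> \<turnstile> subst ?a (subst (up ?b) (subst (up (up ?c)) \<phi>))"
    unfolding inst_def[symmetric] by (rule ForallE)
  \<comment> \<open>The quantifiers are instantiated from the outermost, index \<open>2\<close>,
    inwards; the three substitutions compose to a simultaneous one.\<close>
  also have "subst ?a (subst (up ?b) (subst (up (up ?c)) \<phi>)) = subst (case_nat a (case_nat b (case_nat c Var))) \<phi>"
    unfolding subst_subst
    by (rule arg_cong[of _ _ "\<lambda>\<sigma>. subst \<sigma> \<phi>"], rule ext)
       (auto simp: subst_tm_subst_tm up_def split: nat.split)
  finally show ?thesis .
qed

lemma base_axioms: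
  assumes "PA_minus \<subseteq> \<Gamma>"
  shows "\<Gamma> \<turnstile> Eq (Add (Add a b) c) (Add a (Add b c))" "\<Gamma> \<turnstile> Eq (Add a b) (Add b a)"
    "\<Gamma> \<turnstile> Eq (Mul a (Add b c)) (Add (Mul a b) (Mul a c))" "\<Gamma> \<turnstile> Eq (Add a Zero) a"
    "\<Gamma> \<turnstile> Eq (Mul a Zero) Zero" "\<Gamma> \<turnstile> Eq (Mul a One) a"
    "\<Gamma> \<turnstile> Imp (And (Lt a b) (Lt b c)) (Lt a c)" "\<Gamma> \<turnstile> Neg (Lt a a)"
    "\<Gamma> \<turnstile> Or (Or (Lt a b) (Eq a b)) (Lt b a)" "\<Gamma> \<turnstile> Imp (Lt a b) (Lt (Add a c) (Add b c))"
    "\<Gamma> \<turnstile> Imp (And (Lt Zero c) (Lt a b)) (Lt (Mul a c) (Mul b c))" "\<Gamma> \<turnstile> Lt Zero One"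
  using base_instance[OF assms, of "Eq (Add (Add (Var 0) (Var 1)) (Var 2)) (Add (Var 0) (Add (Var 1) (Var 2)))" a b c]
    base_instance[OF assms, of "Eq (Add (Var 0) (Var 1)) (Add (Var 1) (Var 0))" a b c]
    base_instance[OF assms, of "Eq (Mul (Var 0) (Add (Var 1) (Var 2))) (Add (Mul (Var 0) (Var 1)) (Mul (Var 0) (Var 2)))" a b c]
    base_instance[OF assms, of "Eq (Add (Var 0) Zero) (Var 0)" a b c]
    base_instance[OF assms, of "Eq (Mul (Var 0) Zero) Zero" a b c]
    base_instance[OF assms, of "Eq (Mul (Var 0) One) (Var 0)" a b c]
    base_instance[OF assms, of "Imp (And (Lt (Var 0) (Var 1)) (Lt (Var 1) (Var 2))) (Lt (Var 0) (Var 2))" a b c]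
    base_instance[OF assms, of "Neg (Lt (Var 0) (Var 0))" a b c]
    base_instance[OF assms, of "Or (Or (Lt (Var 0) (Var 1)) (Eq (Var 0) (Var 1))) (Lt (Var 1) (Var 0))" a b c]
    base_instance[OF assms, of "Imp (Lt (Var 0) (Var 1)) (Lt (Add (Var 0) (Var 2)) (Add (Var 1) (Var 2)))" a b c]
    base_instance[OF assms, of "Imp (And (Lt Zero (Var 2)) (Lt (Var 0) (Var 1))) (Lt (Mul (Var 0) (Var 2)) (Mul (Var 1) (Var 2)))" a b c]
    base_instance[OF assms, of "Lt Zero One" a b c]
  by (simp_all add: PA_minus_def Let_def eval_nat_numeral)

lemma derives_num_add:
  assumes "PA_minus \<subseteq> \<Gamma>"
  shows "\<Gamma> \<turnstile> Eq (Add (numeral_tm m) (numeral_tm n)) (numeral_tm (m + n))"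
proof (induction n)
  case 0
  then show ?case using base_axioms(4)[OF assms] by simp
next
  case (Suc n)
  have "\<Gamma> \<turnstile> Eq (Add (Add (numeral_tm m) (numeral_tm n)) One) (numeral_tm (m + Suc n))"
    using add_cong[OF Suc EqI[of _ One]] by simp
  then show ?case
    using eq_trans[OF eq_sym[OF base_axioms(1)[OF assms]]] by simp
qed

lemma derives_num_mul:
  assumes "PA_minus \<subseteq> \<Gamma>"
  shows "\<Gamma> \<turnstile> Eq (Mul (numeral_tm m) (numeral_tm n)) (numeral_tm (m * n))"
proof (induction n)
  case 0
  then show ?case using base_axioms(5)[OF assms] by simp
next
  case (Suc n)
  let ?m = "numeral_tm m" and ?n = "numeral_tm n"
  have "\<Gamma> \<turnstile> Eq (Mul ?m (Add ?n One)) (Add (Mul ?m ?n) (Mul ?m One))"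
    by (rule base_axioms(3)[OF assms])
  moreover have "\<Gamma> \<turnstile> Eq (Add (Mul ?m ?n) (Mul ?m One)) (Add (numeral_tm (m * n)) ?m)"
    by (rule add_cong[OF Suc base_axioms(6)[OF assms]])
  moreover have "\<Gamma> \<turnstile> Eq (Add (numeral_tm (m * n)) ?m) (numeral_tm (m * n + m))"
    by (rule derives_num_add[OF assms])
  ultimately have "\<Gamma> \<turnstile> Eq (Mul ?m (Add ?n One)) (numeral_tm (m * n + m))"
    by (blast intro: eq_trans)
  moreover have "m * Suc n = m * n + m" by simp
  ultimately show ?case by (simp only: numeral_tm.simps)
qed

text \<open>Evaluation of closed terms is provable, by induction on the term from the provable
  addition and multiplication tables; any \<open>e\<close> may be used, as no variable
  occurs.\<close>

lemma derives_closed_term: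
  assumes "PA_minus \<subseteq> \<Gamma>" "fv_tm t = {}"
  shows "\<Gamma> \<turnstile> Eq t (numeral_tm (eval Nat_struct e t))"
  using assms(2)
proof (induction t)
  case Zero
  then show ?case by (simp add: EqI)
next
  case One
  have "\<Gamma> \<turnstile> Eq One (Add Zero One)"
    by (rule eq_sym, rule eq_trans[OF base_axioms(2) base_axioms(4)]) (rule assms)+
  then show ?case by simp
next
  case (Add s t)
  then show ?case
    using eq_trans[OF add_cong derives_num_add[OF assms(1)]] by simp
next
  case (Mul s t)
  then show ?case
    using eq_trans[OF mul_cong derives_num_mul[OF assms(1)]] by simp
qed simp

lemma derives_closed_eq:
  assumes "PA_minus \<subseteq> \<Gamma>" "fv_tm s = {}" "fv_tm t = {}"
    "eval Nat_struct e s = eval Nat_struct e t"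
  shows "\<Gamma> \<turnstile> Eq s t"
  by (rule eq_trans[OF derives_closed_term[OF assms(1,2), of e, unfolded assms(4)]
      eq_sym[OF derives_closed_term[OF assms(1,3)]]])

lemma derives_num_pos:
  assumes "PA_minus \<subseteq> \<Gamma>"
  shows "\<Gamma> \<turnstile> Lt Zero (numeral_tm (Suc n))"
proof (induction n)
  case 0
  have "\<Gamma> \<turnstile> Eq One (Add Zero One)" by (rule derives_closed_eq[OF assms]) simp_all
  then show ?case using lt_cong[OF EqI _ base_axioms(12)[OF assms]] by simp
next
  case (Suc n)
  have 1: "\<Gamma> \<turnstile> Lt Zero (Add Zero One)"
    using lt_cong[OF EqI _ base_axioms(12)[OF assms], of "Add Zero One"]
      derives_closed_eq[OF assms, of One "Add Zero One"] by simp
  have "\<Gamma> \<turnstile> Lt (Add Zero One) (Add (numeral_tm (Suc n)) One)"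
    by (rule ImpE[OF base_axioms(10)[OF assms] Suc])
  then show ?case
    using ImpE[OF base_axioms(7)[OF assms] AndI[OF 1]] by simp
qed

text \<open>Cancellation is not among the base axioms. It follows from linearity, since
  multiplication by a positive numeral is strictly monotone and either strict inequality would give
  \<open>u < u\<close>.\<close>

lemma derives_mul_cancel:
  assumes "PA_minus \<subseteq> \<Gamma>" "\<Gamma> \<turnstile> Eq (Mul s (numeral_tm (Suc n))) (Mul t (numeral_tm (Suc n)))"
  shows "\<Gamma> \<turnstile> Eq s t"
proof -
  let ?n = "numeral_tm (Suc n)"
  have lt: "insert (Lt a b) \<Delta> \<turnstile> Eq s t"
    if eq: "\<Delta> \<turnstile> Eq (Mul a ?n) (Mul b ?n)" and pa: "PA_minus \<subseteq> \<Delta>" for a b \<Delta>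
  proof -
    let ?\<Delta> = "insert (Lt a b) \<Delta>"
    have pa': "PA_minus \<subseteq> ?\<Delta>" using pa by blast
    have "?\<Delta> \<turnstile> Lt (Mul a ?n) (Mul b ?n)"
      by (rule ImpE[OF base_axioms(11)[OF pa'] AndI[OF derives_num_pos[OF pa'] assm_insert]])
    then have "?\<Delta> \<turnstile> Lt (Mul b ?n) (Mul b ?n)"
      by (rule lt_cong[OF weaken_insert[OF eq] EqI])
    then show ?thesis
      by (rule FalsumE[OF ImpE[OF base_axioms(8)[OF pa']]])
  qed
  show ?thesis
  proof (rule OrE[OF base_axioms(9)[OF assms(1)]])
    have "insert (Or (Lt s t) (Eq s t)) \<Gamma> \<turnstile> Or (Lt s t) (Eq s t)" by (rule assm_insert)
    then show "insert (Or (Lt s t) (Eq s t)) \<Gamma> \<turnstile> Eq s t"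
      by (rule OrE) (rule lt, use assms weaken_insert in blast, use assms in blast, rule assm_insert)
    show "insert (Lt t s) \<Gamma> \<turnstile> Eq s t"
      by (rule lt[OF eq_sym[OF assms(2)] assms(1)])
  qed
qed

section \<open>Interpretations of theories\<close>

lemma lift_image_sentences: "(\<And>\<phi>. \<phi> \<in> \<Gamma> \<Longrightarrow> sentence \<phi>) \<Longrightarrow> lift ` \<Gamma> = \<Gamma>"
  by (force simp: lift_sentence image_iff)

lemma sentence_Forall_pow: "fv \<phi> \<subseteq> {..<n} \<Longrightarrow> sentence ((Forall ^^ n) \<phi>)"
proof -
  have "fv ((Forall ^^ n) \<phi>) = {i. i + n \<in> fv \<phi>}"
    by (induction n) auto
  then show "fv \<phi> \<subseteq> {..<n} \<Longrightarrow> sentence ((Forall ^^ n) \<phi>)" by auto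
qed

context
  fixes R :: psym and \<psi> :: fm
  assumes fv_\<psi>: "fv \<psi> \<subseteq> {..<arity R}"
begin

text \<open>Without parameters in \<open>\<psi>\<close>, the depth affects only indices that do not
  occur.\<close>

lemma rel_subst_depth: "rel_subst R \<psi> d \<phi> = rel_subst R \<psi> d' \<phi>"
proof (induction \<phi> arbitrary: d d')
  case (Rel r ts)
  have "subst (\<lambda>i. if i < arity R then ts ! i else Var (d + (i - arity R))) \<psi> =
      subst (\<lambda>i. if i < arity R then ts ! i else Var (d' + (i - arity R))) \<psi>"
    by (rule subst_cong) (use fv_\<psi> in auto)
  then show ?case by simp
next
  case (Forall \<phi>)
  show ?case using Forall[of "Suc d" "Suc d'"] by simp
next
  case (Imp \<phi> \<chi>)
  show ?case using Imp(1)[of d d'] Imp(2)[of d d'] by simp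
qed simp_all

lemma rel_subst_subst:
  "in_lang {R} \<phi> \<Longrightarrow> rel_subst R \<psi> d (subst \<sigma> \<phi>) = subst \<sigma> (rel_subst R \<psi> d' \<phi>)"
proof (induction \<phi> arbitrary: \<sigma> d d')
  case (Rel r ts)
  then have r: "r = R" "length ts = arity R" by auto
  then show ?case
    unfolding r rel_subst.simps subst.simps if_P[OF refl] subst_subst
    by (intro subst_cong) (use fv_\<psi> r(2) in auto)
next
  case (Imp \<phi> \<chi>)
  then show ?case using Imp(1)[of d \<sigma> d'] Imp(2)[of d \<sigma> d'] by simp
next
  case (Forall \<phi>)
  then show ?case using Forall(1)[of "Suc d" "up \<sigma>" "Suc d'"] by simp
qed simp_all

lemma rel_subst_induction_fm:
  assumes "in_lang {R} \<phi>"
  shows "rel_subst R \<psi> d (induction_fm \<phi>) = induction_fm (rel_subst R \<psi> 0 \<phi>)"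
  using rel_subst_subst[OF assms, of _ _ 0] rel_subst_depth[of _ \<phi> 0]
  unfolding induction_fm_def inst_def by simp

lemma rel_subst_Forall_pow: "rel_subst R \<psi> d ((Forall ^^ n) \<phi>) = (Forall ^^ n) (rel_subst R \<psi> (d + n) \<phi>)"
  by (induction n arbitrary: d) auto

lemma fv_rel_subst: "in_lang {R} \<phi> \<Longrightarrow> fv (rel_subst R \<psi> d \<phi>) \<subseteq> fv \<phi>"
proof (induction \<phi> arbitrary: d)
  case (Rel r ts)
  then show ?case using fv_\<psi> by (fastforce simp: fv_subst)
next
  case (Imp \<phi> \<chi>)
  then show ?case using Imp(1)[of d] Imp(2)[of d] by auto
next
  case (Forall \<phi>)
  then show ?case using Forall(1)[of "Suc d"] by auto
qed auto

lemma in_lang_rel_subst: "in_lang {R} \<phi> \<Longrightarrow> in_lang {W} \<psi> \<Longrightarrow> in_lang {W} (rel_subst R \<psi> d \<phi>)"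
  by (induction \<phi> arbitrary: d) auto

text \<open>The translation commutes with substitution, so a translated induction instance is
  literally an induction axiom for the other predicate and needs no derivation.\<close>

lemma rel_subst_Induction:
  assumes "\<Phi> \<in> Induction {R}" "in_lang {W} \<psi>"
  shows "rel_subst R \<psi> 0 \<Phi> \<in> Induction {W}"
proof -
  obtain n \<phi> where \<Phi>: "\<Phi> = (Forall ^^ n) (induction_fm \<phi>)"
    and \<phi>: "in_lang {R} \<phi>" "fv (induction_fm \<phi>) \<subseteq> {..<n}"
    using assms(1) unfolding Induction_def by blast
  have "in_lang {R} (induction_fm \<phi>)" using \<phi>(1) by (simp add: induction_fm_def inst_def)
  then have "fv (induction_fm (rel_subst R \<psi> 0 \<phi>)) \<subseteq> {..<n}"
    using fv_rel_subst[of "induction_fm \<phi>" 0] \<phi> by (simp only: rel_subst_induction_fm) blast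
  then show ?thesis
    unfolding Induction_def \<Phi> rel_subst_Forall_pow rel_subst_induction_fm[OF \<phi>(1)]
    using in_lang_rel_subst[OF \<phi>(1) assms(2)] by blast
qed

end

lemma sentence_Induction: "\<Phi> \<in> Induction L \<Longrightarrow> sentence \<Phi>"
  unfolding Induction_def using sentence_Forall_pow by blast

section \<open>Syntactic definability\<close>

lemma syntactically_definesI:
  assumes "in_lang {symb W} \<psi>" "fv \<psi> \<subseteq> {..<arity (symb V)}"
    "axms W = PA_minus \<union> Induction {symb W} \<union> B" "axms V = PA_minus \<union> Induction {symb V} \<union> C"
    "\<And>\<Phi>. \<Phi> \<in> C \<Longrightarrow> axms W \<turnstile> rel_subst (symb V) \<psi> 0 \<Phi>"
  shows "syntactically_defines W V"
  unfolding syntactically_defines_def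
proof (intro exI[of _ \<psi>] conjI ballI)
  fix \<Phi> assume "\<Phi> \<in> axms V"
  then consider "\<Phi> \<in> PA_minus" | "\<Phi> \<in> Induction {symb V}" | "\<Phi> \<in> C"
    using assms(4) by blast
  then show "axms W \<turnstile> rel_subst (symb V) \<psi> 0 \<Phi>"
  proof cases
    case 1
    then show ?thesis
      using assms(3) by (intro Assm) (simp add: rel_subst_arithmetical arithmetical_PA_minus)
  next
    case 2
    then show ?thesis
      using rel_subst_Induction[OF assms(2) _ assms(1)] assms(3) by (intro Assm) blast
  qed (rule assms(5))
qed (use assms in blast)+

lemma subst_unary: "fv \<phi> \<subseteq> {0} \<Longrightarrow> \<sigma> 0 = \<tau> 0 \<Longrightarrow> subst \<sigma> \<phi> = subst \<tau> \<phi>"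
  by (rule subst_cong) (metis empty_iff insert_iff subsetD)

lemma Exists1_unary:
  assumes "fv \<phi> \<subseteq> {0}"
  shows "Exists1 \<phi> = Exists (And \<phi> (Forall (Imp \<phi> (Eq (Var 0) (Var 1)))))"
  using subst_unary[OF assms, of "case_nat (Var 0) (\<lambda>i. Var (Suc (Suc i)))" Var]
  by (simp add: Exists1_def)

lemma sentence_axms: "\<Phi> \<in> axms DEF \<Longrightarrow> sentence \<Phi>" "\<Phi> \<in> axms USB \<Longrightarrow> sentence \<Phi>"
  unfolding DEF_def USB_def
  using sentence_PA_minus sentence_Induction sentence_Exists1 by auto

lemma inst_sentence: "sentence \<phi> \<Longrightarrow> inst t \<phi> = \<phi>"
  unfolding inst_def by (rule subst_id) simp

text \<open>
  For a sentence \<open>\<phi>\<close>, the formula \<open>\<phi> \<longrightarrow> x = 0\<close> has a unique solution iff \<open>\<phi>\<close> holds. Its code \<open>m\<close>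
  satisfies \<open>8 m = (8 + y) (10 + y) + 32\<close> with \<open>y = (n + k) (n + k + 1) + 2 n\<close>, where \<open>n\<close> and \<open>k\<close>
  are the codes of \<open>\<phi>\<close> and of \<open>x = 0\<close>.
\<close>

definition guard_poly :: "tm \<Rightarrow> tm" where
  "guard_poly x = (let k = numeral_tm (gn (Eq (Var 0) Zero));
     y = Add (Mul (Add x k) (Add (Add x k) One)) (Add x x) in
     Add (Mul (Add (numeral_tm 8) y) (Add (numeral_tm 10) y)) (numeral_tm 32))"

definition T_fm :: fm where
  "T_fm = Exists (And (Eq (Mul (Var 0) (numeral_tm 8)) (guard_poly (Var 1))) (Rel PD [Var 0, Zero]))"

lemma subst_guard_poly: "subst_tm \<sigma> (guard_poly t) = guard_poly (subst_tm \<sigma> t)"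
  by (simp add: guard_poly_def Let_def)

lemma fv_guard_poly: "fv_tm (guard_poly t) = fv_tm t"
  by (auto simp: guard_poly_def Let_def)

text \<open>Here \<open>m\<close> is the pair of the tag \<open>4\<close> of implications and the
  pair \<open>y\<close> of the two codes. From \<open>2 m = (4 + y)(5 + y) + 8\<close>, multiplying
  by four gives \<open>(8 + 2 y)(10 + 2 y) + 32\<close>, which involves only the polynomial
  \<open>2 y\<close>.\<close>

lemma eval_guard_poly:
  "eval Nat_struct e (guard_poly (quot \<phi>)) = gn (Imp \<phi> (Eq (Var 0) Zero)) * 8"
proof -
  define k where "k = gn (Eq (Var 0) Zero)"
  define y where "y = prod_encode (gn \<phi>, k)"
  define m where "m = prod_encode (4, y)"
  have y: "y + y = (gn \<phi> + k) * Suc (gn \<phi> + k) + gn \<phi> + gn \<phi>"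
    and m: "m + m = (4 + y) * Suc (4 + y) + 4 + 4"
    using prod_encode_eq_iff y_def m_def by blast+
  have "m * 8 = (m + m) * 4" by simp
  also have "\<dots> = (8 + (y + y)) * (10 + (y + y)) + 32"
    unfolding m by (simp add: algebra_simps)
  also have "\<dots> = eval Nat_struct e (guard_poly (quot \<phi>))"
    unfolding y by (simp add: guard_poly_def Let_def quot_def k_def del: gn.simps)
  finally show ?thesis by (simp add: m_def y_def k_def)
qed

text \<open>If \<open>\<phi>\<close> fails, every \<open>x\<close> solves the implication, so
  uniqueness would identify \<open>0\<close> and \<open>1\<close>, against \<open>0 < 1\<close>. If
  \<open>\<phi>\<close> holds, \<open>0\<close> is the only solution.\<close>

lemma DEF_guard:
  assumes \<phi>: "arithmetical \<phi>" "sentence \<phi>"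
  shows "axms DEF \<turnstile> Iff (Rel PD [quot (Imp \<phi> (Eq (Var 0) Zero)), Zero]) \<phi>"
proof -
  let ?\<chi> = "Imp \<phi> (Eq (Var 0) Zero)" and ?\<Gamma> = "axms DEF" and ?u = "Eq (Var 0) (Var 1)"
  let ?C = "Imp \<phi> (Eq Zero Zero)"
  have pa: "PA_minus \<subseteq> ?\<Gamma>" by (auto simp: DEF_def)
  have lift_\<Gamma>: "lift ` ?\<Gamma> = ?\<Gamma>" by (rule lift_image_sentences) (rule sentence_axms)
  have l\<phi>: "lift \<phi> = \<phi>" and i\<phi>: "inst t \<phi> = \<phi>" for t
    using \<phi>(2) by (simp_all add: lift_sentence inst_sentence)
  have s\<phi>: "subst \<sigma> \<phi> = \<phi>" for \<sigma>
    by (rule subst_id) (simp add: \<phi>(2))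
  have fv: "fv ?\<chi> \<subseteq> {0}" using \<phi>(2) by simp
  have "?\<Gamma> \<turnstile> Forall (Iff (Rel PD [quot ?\<chi>, Var 0]) (And (Exists1 ?\<chi>) ?\<chi>))"
    by (rule Assm) (use \<phi>(1) fv in \<open>auto simp: DEF_def\<close>)
  from ForallE[OF this, of Zero]
  have D: "?\<Gamma> \<turnstile> Iff (Rel PD [quot ?\<chi>, Zero]) (And (Exists1 ?\<chi>) ?C)"
    by (simp add: inst_sentence[OF sentence_Exists1[OF fv]] i\<phi>)
  have "insert (And (Exists1 ?\<chi>) ?C) ?\<Gamma> \<turnstile> \<phi>"
  proof (rule Contr)
    let ?\<Delta> = "insert (Neg \<phi>) (insert (And (Exists1 ?\<chi>) ?C) ?\<Gamma>)"
    let ?b = "And ?\<chi> (Forall (Imp ?\<chi> ?u))"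
    let ?\<Delta>' = "insert ?b (lift ` ?\<Delta>)"
    have sub: "?\<Gamma> \<subseteq> ?\<Delta>'" using lift_\<Gamma> by auto
    have no: "?\<Delta>' \<turnstile> Neg \<phi>" by (rule Assm) (simp add: l\<phi>)
    have imp: "?\<Delta>' \<turnstile> Imp \<phi> \<alpha>" for \<alpha>
      by (rule ImpI, rule FalsumE, rule ImpE[OF weaken_insert[OF no] assm_insert])
    have all: "?\<Delta>' \<turnstile> Forall (Imp ?\<chi> ?u)" by (rule AndE2[OF assm_insert])
    have eq: "?\<Delta>' \<turnstile> Eq t (Var 0)" for t
    proof -
      have "inst t (Imp ?\<chi> ?u) = Imp (Imp \<phi> (Eq t Zero)) (Eq t (Var 0))" by (simp add: i\<phi>)
      from ForallE[OF all, of t, unfolded this] show ?thesis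
        by (rule ImpE[OF _ imp])
    qed
    have "?\<Delta>' \<turnstile> Eq Zero One" by (rule eq_trans[OF eq eq_sym[OF eq]])
    moreover have pa': "PA_minus \<subseteq> ?\<Delta>'" using pa sub by blast
    ultimately have "?\<Delta>' \<turnstile> Lt One One"
      by (blast intro: lt_cong EqI base_axioms(12))
    then have "?\<Delta>' \<turnstile> lift Falsum"
      using ImpE[OF base_axioms(8)[OF pa']] by simp
    moreover have "?\<Delta> \<turnstile> Exists ?b"
      unfolding Exists1_unary[OF fv, symmetric] by (rule AndE1, rule Assm) blast
    ultimately show "?\<Delta> \<turnstile> Falsum" by (rule ExE[rotated])
  qed
  moreover have "insert \<phi> ?\<Gamma> \<turnstile> And (Exists1 ?\<chi>) ?C"
  proof (rule AndI)
    let ?\<Delta> = "insert \<phi> ?\<Gamma>"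
    have "insert ?\<chi> (lift ` ?\<Delta>) \<turnstile> Eq (Var 0) Zero"
      by (rule ImpE[OF assm_insert]) (rule Assm, simp add: l\<phi>)
    then have "?\<Delta> \<turnstile> Forall (Imp ?\<chi> (Eq (Var 0) Zero))"
      by (rule ForallI[OF ImpI])
    then have "?\<Delta> \<turnstile> And ?C (Forall (Imp ?\<chi> (Eq (Var 0) Zero)))"
      by (rule AndI[OF ImpI[OF EqI]])
    then have "?\<Delta> \<turnstile> inst Zero (And ?\<chi> (Forall (Imp ?\<chi> ?u)))"
      by (simp add: inst_def s\<phi>)
    then show "?\<Delta> \<turnstile> Exists1 ?\<chi>"
      unfolding Exists1_unary[OF fv] by (rule ExI)
    show "?\<Delta> \<turnstile> ?C" by (rule ImpI[OF EqI])
  qed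
  ultimately have "?\<Gamma> \<turnstile> Iff (And (Exists1 ?\<chi>) ?C) \<phi>" by (rule IffI)
  then show ?thesis
    using D by (meson IffD1 IffD2 IffI assm_insert weaken_insert)
qed

theorem DEF_syntactically_defines_TB: "syntactically_defines DEF TB"
proof (rule syntactically_definesI[where \<psi> = T_fm])
  show "in_lang {symb DEF} T_fm" by (simp add: DEF_def T_fm_def)
  show "fv T_fm \<subseteq> {..<arity (symb TB)}" by (auto simp: TB_def T_fm_def fv_guard_poly)
  show "axms DEF = PA_minus \<union> Induction {symb DEF} \<union>
     {Forall (Iff (Rel PD [quot \<phi>, Var 0]) (And (Exists1 \<phi>) \<phi>)) | \<phi>. arithmetical \<phi> \<and> fv \<phi> \<subseteq> {0}}"
    by (simp add: DEF_def)
  show "axms TB = PA_minus \<union> Induction {symb TB} \<union>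
     {Iff (Rel PT [quot \<phi>]) \<phi> | \<phi>. arithmetical \<phi> \<and> sentence \<phi>}"
    by (simp add: TB_def)
  fix \<Phi> assume "\<Phi> \<in> {Iff (Rel PT [quot \<phi>]) \<phi> | \<phi>. arithmetical \<phi> \<and> sentence \<phi>}"
  then obtain \<phi> where \<Phi>: "\<Phi> = Iff (Rel PT [quot \<phi>]) \<phi>" and \<phi>: "arithmetical \<phi>" "sentence \<phi>" by blast
  let ?\<Gamma> = "axms DEF" and ?m = "quot (Imp \<phi> (Eq (Var 0) Zero))" and ?p = "guard_poly (quot \<phi>)"
  let ?b = "And (Eq (Mul (Var 0) (numeral_tm 8)) ?p) (Rel PD [Var 0, Zero])"
  have eq: "rel_subst (symb TB) T_fm 0 \<Phi> = Iff (Exists ?b) \<phi>"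
    by (simp add: \<Phi> TB_def T_fm_def rel_subst_arithmetical[OF \<phi>(1)] subst_guard_poly)
  have pa: "PA_minus \<subseteq> ?\<Gamma>" by (auto simp: DEF_def)
  have lift_\<Gamma>: "lift ` ?\<Gamma> = ?\<Gamma>" by (rule lift_image_sentences) (rule sentence_axms)
  have m: "\<Delta> \<turnstile> Eq (Mul ?m (numeral_tm 8)) ?p" if "PA_minus \<subseteq> \<Delta>" for \<Delta>
    by (rule derives_closed_eq[OF that, where e = "\<lambda>_. 0"])
       (simp_all add: fv_guard_poly eval_guard_poly quot_def[of "Imp _ _"] del: gn.simps)
  have "insert (Exists ?b) ?\<Gamma> \<turnstile> \<phi>"
  proof (rule ExE[OF assm_insert])
    let ?\<Delta> = "insert ?b (lift ` insert (Exists ?b) ?\<Gamma>)"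
    have sub: "?\<Gamma> \<subseteq> ?\<Delta>" using lift_\<Gamma> by auto
    then have pa': "PA_minus \<subseteq> ?\<Delta>" using pa by blast
    have "?\<Delta> \<turnstile> Eq (Mul (Var 0) (numeral_tm 8)) (Mul ?m (numeral_tm 8))"
      by (rule eq_trans[OF AndE1[OF assm_insert] eq_sym[OF m[OF pa']]])
    \<comment> \<open>The factor is cancelled as the successor of \<open>7\<close>, which identifies
      the witness with the numeral of the intended code.\<close>
    then have "?\<Delta> \<turnstile> Eq (Var 0) ?m"
      using derives_mul_cancel[OF pa', of _ 7] by (simp del: numeral_tm.simps)
    moreover have "?\<Delta> \<turnstile> Rel PD [Var 0, Zero]" by (rule AndE2[OF assm_insert])
    ultimately have "?\<Delta> \<turnstile> Rel PD [?m, Zero]"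
      using EqE[of ?\<Delta> "Var 0" ?m "Rel PD [Var 0, Zero]"] by simp
    then have "?\<Delta> \<turnstile> \<phi>" by (rule IffD1[OF weaken[OF DEF_guard[OF \<phi>] sub]])
    then show "?\<Delta> \<turnstile> lift \<phi>" by (simp add: lift_sentence \<phi>(2))
  qed
  moreover have "insert \<phi> ?\<Gamma> \<turnstile> Exists ?b"
  proof (rule ExI[where t = ?m])
    have "insert \<phi> ?\<Gamma> \<turnstile> Rel PD [?m, Zero]"
      by (rule IffD2[OF weaken_insert[OF DEF_guard[OF \<phi>]] assm_insert])
    moreover have "insert \<phi> ?\<Gamma> \<turnstile> Eq (Mul ?m (numeral_tm 8)) ?p"
      by (rule m) (use pa in blast)
    ultimately show "insert \<phi> ?\<Gamma> \<turnstile> inst ?m ?b"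
      using AndI by (simp add: subst_guard_poly)
  qed
  ultimately show "axms DEF \<turnstile> rel_subst (symb TB) T_fm 0 \<Phi>"
    unfolding eq by (rule IffI)
qed

theorem USB_syntactically_defines_DEF: "syntactically_defines USB DEF"
proof (rule syntactically_definesI)
  \<comment> \<open>Index \<open>0\<close> is the code and \<open>1\<close> the argument; below the
    quantifier both have moved up by one.\<close>
  let ?\<psi> = "And (Rel PS [Var 0, Var 1]) (Forall (Imp (Rel PS [Var 1, Var 0]) (Eq (Var 0) (Var 2))))"
  show "in_lang {symb USB} ?\<psi>" by (simp add: USB_def)
  show "fv ?\<psi> \<subseteq> {..<arity (symb DEF)}" by (auto simp: DEF_def)
  show "axms USB = PA_minus \<union> Induction {symb USB} \<union>
     {Forall (Iff (Rel PS [quot \<phi>, Var 0]) \<phi>) | \<phi>. arithmetical \<phi> \<and> fv \<phi> \<subseteq> {0}}"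
    by (simp add: USB_def)
  show "axms DEF = PA_minus \<union> Induction {symb DEF} \<union>
     {Forall (Iff (Rel PD [quot \<phi>, Var 0]) (And (Exists1 \<phi>) \<phi>)) | \<phi>. arithmetical \<phi> \<and> fv \<phi> \<subseteq> {0}}"
    by (simp add: DEF_def)
  fix \<Phi>
  assume "\<Phi> \<in> {Forall (Iff (Rel PD [quot \<phi>, Var 0]) (And (Exists1 \<phi>) \<phi>)) | \<phi>. arithmetical \<phi> \<and> fv \<phi> \<subseteq> {0}}"
  then obtain \<phi> where \<Phi>: "\<Phi> = Forall (Iff (Rel PD [quot \<phi>, Var 0]) (And (Exists1 \<phi>) \<phi>))"
    and \<phi>: "arithmetical \<phi>" "fv \<phi> \<subseteq> {0}" by blast
  let ?\<Gamma> = "axms USB" and ?u = "Eq (Var 0) (Var 1)" and ?S = "\<lambda>t. Rel PS [quot \<phi>, t]"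
  let ?all = "Forall (Imp (?S (Var 0)) ?u)" and ?b = "And \<phi> (Forall (Imp \<phi> (Eq (Var 0) (Var 1))))"
  have eq: "rel_subst (symb DEF) ?\<psi> 0 \<Phi> = Forall (Iff (And (?S (Var 0)) ?all) (And (Exists1 \<phi>) \<phi>))"
    by (simp add: \<Phi> DEF_def rel_subst_arithmetical \<phi>(1) numeral_2_eq_2)
  have lift_\<Gamma>: "lift ` ?\<Gamma> = ?\<Gamma>" by (rule lift_image_sentences) (rule sentence_axms)
  let ?at = "\<lambda>t. subst (\<lambda>_. t) \<phi>"
  have inst_\<phi>: "inst t \<phi> = ?at t" and at_0: "?at (Var 0) = \<phi>" and lift_\<phi>: "lift \<phi> = ?at (Var 1)" for t
    using subst_unary[OF \<phi>(2), of "case_nat t Var" "\<lambda>_. t"] subst_unary[OF \<phi>(2), of "\<lambda>_. Var 0" Var]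
      subst_unary[OF \<phi>(2), of "\<lambda>i. Var (Suc i)" "\<lambda>_. Var 1"] by (simp_all add: inst_def lift_def)
  have "?\<Gamma> \<turnstile> Forall (Iff (Rel PS [quot \<phi>, Var 0]) \<phi>)"
    by (rule Assm) (use \<phi> in \<open>auto simp: USB_def\<close>)
  from ForallE[OF this] have S: "?\<Gamma> \<turnstile> Iff (?S t) (?at t)" for t
    by (simp add: inst_\<phi>)
  have SD1: "\<Delta> \<turnstile> ?at t" if "\<Delta> \<turnstile> ?S t" "?\<Gamma> \<subseteq> \<Delta>" for \<Delta> t
    using IffD1[OF weaken[OF S that(2)] that(1)] .
  have SD2: "\<Delta> \<turnstile> ?S t" if "\<Delta> \<turnstile> ?at t" "?\<Gamma> \<subseteq> \<Delta>" for \<Delta> t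
    using IffD2[OF weaken[OF S that(2)] that(1)] .
  let ?A = "And (?S (Var 0)) ?all" and ?B = "And (Exists1 \<phi>) \<phi>"
  have "insert ?A ?\<Gamma> \<turnstile> ?B"
  proof (rule AndI)
    let ?\<Delta> = "insert ?A ?\<Gamma>"
    have "?\<Delta> \<turnstile> ?at (Var 0)" by (rule SD1[OF AndE1[OF assm_insert]]) blast
    then show S0: "?\<Delta> \<turnstile> \<phi>" by (simp add: at_0)
    let ?\<Delta>' = "insert \<phi> (lift ` ?\<Delta>)"
    have "lift ?all = Forall (Imp (?S (Var 0)) (Eq (Var 0) (Var (Suc (Suc 0)))))"
      by (simp add: lift_def)
    then have "?\<Delta>' \<turnstile> And (lift (?S (Var 0))) (Forall (Imp (?S (Var 0)) (Eq (Var 0) (Var (Suc (Suc 0))))))"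
      by (intro Assm) simp
    from ForallE[OF AndE2[OF this], of "Var 0"]
    have "?\<Delta>' \<turnstile> Imp (?S (Var 0)) ?u" by simp
    moreover have "?\<Delta>' \<turnstile> ?S (Var 0)"
      by (rule SD2) (use lift_\<Gamma> in \<open>auto simp: at_0 intro: Assm\<close>)
    ultimately have "?\<Delta>' \<turnstile> ?u" by (rule ImpE)
    then have "?\<Delta> \<turnstile> Forall (Imp \<phi> ?u)" by (rule ForallI[OF ImpI])
    then have b: "?\<Delta> \<turnstile> ?b" by (rule AndI[OF S0])
    have "up (case_nat (Var 0) Var) 0 = Var 0" by simp
    then have "subst (up (case_nat (Var 0) Var)) \<phi> = \<phi>"
      using subst_unary[OF \<phi>(2), of _ Var] by simp
    then have "inst (Var 0) ?b = ?b"
      using inst_\<phi>[of "Var 0"] at_0 by (simp add: inst_def)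
    then show "?\<Delta> \<turnstile> Exists1 \<phi>"
      unfolding Exists1_unary[OF \<phi>(2)] using b by (intro ExI[of _ "Var 0"]) simp
  qed
  moreover have "insert ?B ?\<Gamma> \<turnstile> ?A"
  proof (rule AndI)
    let ?\<Delta> = "insert ?B ?\<Gamma>"
    show "?\<Delta> \<turnstile> ?S (Var 0)"
      by (rule SD2) (use AndE2[OF assm_insert] at_0 in auto)
    let ?\<Delta>1 = "insert (?S (Var 0)) (lift ` ?\<Delta>)"
    have ex: "?\<Delta>1 \<turnstile> Exists ?b"
    proof -
      have "?\<Delta>1 \<turnstile> And (lift (Exists1 \<phi>)) (lift \<phi>)" by (rule Assm) simp
      then have "?\<Delta>1 \<turnstile> lift (Exists1 \<phi>)" by (rule AndE1)
      then have "?\<Delta>1 \<turnstile> Exists1 \<phi>" unfolding lift_sentence[OF sentence_Exists1[OF \<phi>(2)]] .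
      then show ?thesis by (simp only: Exists1_unary[OF \<phi>(2)])
    qed
    let ?\<Delta>2 = "insert ?b (lift ` ?\<Delta>1)"
    have sub: "?\<Gamma> \<subseteq> ?\<Delta>2"
    proof
      fix \<gamma> assume "\<gamma> \<in> ?\<Gamma>"
      then have "\<gamma> \<in> lift ` lift ` ?\<Gamma>" unfolding lift_\<Gamma> .
      then show "\<gamma> \<in> ?\<Delta>2" by blast
    qed
    have all: "?\<Delta>2 \<turnstile> Forall (Imp \<phi> ?u)" by (rule AndE2[OF assm_insert])
    have imp: "?\<Delta>2 \<turnstile> Eq t (Var 0)" if "?\<Delta>2 \<turnstile> ?at t" for t
      using ImpE[OF ForallE[OF all, of t, unfolded inst_simps inst_\<phi>] that] by simp
    have "?\<Delta>2 \<turnstile> ?S (Var 1)"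
      by (rule Assm) (simp add: lift_def)
    then have 1: "?\<Delta>2 \<turnstile> Eq (Var 1) (Var 0)"
      by (intro imp SD1 sub)
    \<comment> \<open>Two quantifiers have been opened: \<open>Var 0\<close> is the unique solution,
      \<open>Var 1\<close> the element satisfying \<open>S\<close>, and \<open>Var 2\<close> the
      original argument. Both of the latter equal the first.\<close>
    have "lift (lift \<phi>) = ?at (Var 2)"
      unfolding lift_def subst_subst by (rule subst_unary[OF \<phi>(2)]) simp
    then have "?\<Delta>2 \<turnstile> And (lift (lift (Exists1 \<phi>))) (?at (Var 2))"
      by (intro Assm) auto
    then have 2: "?\<Delta>2 \<turnstile> Eq (Var 2) (Var 0)"
      by (rule imp[OF AndE2])
    have "?\<Delta>2 \<turnstile> lift ?u"
      using eq_trans[OF 1 eq_sym[OF 2]] by (simp add: lift_def eval_nat_numeral)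
    then have "?\<Delta>1 \<turnstile> ?u" by (rule ExE[OF ex])
    then show "?\<Delta> \<turnstile> ?all" by (rule ForallI[OF ImpI])
  qed
  ultimately have "?\<Gamma> \<turnstile> Iff ?A ?B" by (rule IffI)
  then show "axms USB \<turnstile> rel_subst (symb DEF) ?\<psi> 0 \<Phi>"
    unfolding eq using ForallI[of ?\<Gamma>] lift_\<Gamma> by simp
qed

theorem corollary51:
  assumes "infinite (UNIV :: 'a set)"
  shows "syntactically_defines DEF TB \<and> syntactically_defines USB DEF \<and>
    \<not> semantically_defines TYPE('a) TB DEF \<and> \<not> semantically_defines TYPE('a) DEF USB"
  using DEF_syntactically_defines_TB USB_syntactically_defines_DEF
    TB_not_semantically_defines_DEF[OF assms] DEF_not_semantically_defines_USB[OF assms] by blast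

end
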